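(* Let $\beta$ be bubble parameters compatible with a choice of scalars $Q$, and for each $i\in I$ let $D_i\in\Bbbk^\times$. Let $\hat Q,\hat\beta$ be the parameters $$\hat{\mathsf{c}}^{+}_{i,\lambda}=D_i^{-\lambda_i+1}\mathsf{c}^{+}_{i,\lambda},\quad \hat{\mathsf{c}}^{-}_{i,\lambda}=D_i^{\lambda_i+1}\mathsf{c}^{-}_{i,\lambda},\quad \hat\beta_{i,\lambda}=D_i^{-2}\beta_{i,\lambda},$$ $$\hat t_{ii}=-\hat\beta_{i,\lambda},\qquad \hat t_{ij}=D_it_{ij}\ \text{ if }(\alpha_i,\alpha_j)=-1,\qquad \hat t_{ik}=t_{ik}\ \text{ if }(\alpha_i,\alpha_k)=0$$ (which are again compatible). Then there is an isomorphism of 2-categories $$\beth\colon \mathcal{U}_{Q,\beta}(\mathfrak{g})\longrightarrow\mathcal{U}_{\hat Q,\hat\beta}(\mathfrak{g})$$ that is the identity on objects and 1-morphisms and is defined on generating 2-morphisms by $$\beth(x_{i,\lambda})=D_i\,x_{i,\lambda},\qquad \beth(\psi_{ii,\lambda})=D_i^{-1}\psi_{ii,\lambda}\qquad(i\in I,\ \lambda\in X),$$ all other generating 2-morphisms (the crossings $\psi_{ij,\lambda}$ with $i\neq j$, and all caps and cups) being sent to the corresponding generators.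
   Context: **Cartan data.** $\Bbbk$ is a field. A symmetric (simply-laced) Cartan datum consists of a free $\mathbb{Z}$-module $X$ (weight lattice), an index set $I$, elements $\alpha_i,\Lambda_i\in X$ and $h_i\in X^\vee=\mathrm{Hom}_{\mathbb{Z}}(X,\mathbb{Z})$ for $i\in I$, and a bilinear form $(\cdot,\cdot)$ on $X$ with $(\alpha_i,\alpha_i)=2$; $(\alpha_i,\alpha_j)\in\{0,-1\}$ for $i\neq j$; $\langle h_i,\lambda\rangle=(\alpha_i,\lambda)$; $\langle h_j,\Lambda_i\rangle=\delta_{ij}$. The matrix $a_{ij}=\langle h_i,\alpha_j\rangle=(\alpha_i,\alpha_j)$ is the Cartan matrix of $\mathfrak{g}$. Write $i\cdot j=(\alpha_i,\alpha_j)$ and $\lambda_i=\langle h_i,\lambda\rangle$. **Parameters.** A choice of scalars $Q$ is a family $t_{ij}\in\Bbbk^\times$ ($i\neq j$) with $t_{ij}=t_{ji}$ when $a_{ij}=0$. Bubble parameters $\beta$ consist of scalars $\beta_i=\beta_{i,\lambda}\in\Bbbk^\times$ (one scalar $\beta_i$ for each $i$, also written $\beta_{i,\lambda}$) and $\mathsf{c}^{+}_{i,\lambda},\mathsf{c}^{-}_{i,\lambda}\in\Bbbk^\times$ for $i\in I,\lambda\in X$. Put $t_{ii}:=-\beta_i$. They are compatible with $Q$ if for all $i,j\in I$ (including $i=j$) and $\lambda\in X$: $\mathsf{c}^{+}_{i,\lambda}\mathsf{c}^{-}_{i,\lambda}=-1/\beta_i=1/t_{ii}$, $\ \mathsf{c}^{+}_{i,\lambda+\alpha_j}=t_{ij}\mathsf{c}^{+}_{i,\lambda}$,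 $\ \mathsf{c}^{-}_{i,\lambda-\alpha_j}=t_{ij}\mathsf{c}^{-}_{i,\lambda}$. **The 2-category $\mathcal{U}_{Q,\beta}(\mathfrak{g})$** (for $\beta$ compatible with $Q$) is the graded additive $\Bbbk$-linear 2-category with: - Objects: $\lambda\in X$. - 1-morphisms: formal direct sums of grading shifts $\langle t\rangle$ of composites of $\mathbf{1}_\lambda$, $\mathcal{E}_i\mathbf{1}_\lambda=\mathbf{1}_{\lambda+\alpha_i}\mathcal{E}_i$, $\mathcal{F}_i\mathbf{1}_\lambda=\mathbf{1}_{\lambda-\alpha_i}\mathcal{F}_i$. - 2-morphisms: $\Bbbk$-linear combinations of vertical/horizontal composites of the following generators (with identities and shifts): dots $x_{i,\lambda}\colon\mathcal{E}_i\mathbf{1}_\lambda\to\mathcal{E}_i\mathbf{1}_\lambda\langle 2\rangle$; crossings $\psi_{ij,\lambda}\colon\mathcal{E}_i\mathcal{E}_j\mathbf{1}_\lambda\to\mathcal{E}_j\mathcal{E}_i\mathbf{1}_\lambda\langle -i\cdot j\rangle$; cups $\eta_{i,\lambda}\colon\mathbf{1}_\lambda\to\mathcal{F}_i\mathcal{E}_i\mathbf{1}_\lambda\langle 1+\lambda_i\rangle$ and $\eta'_{i,\lambda}\colon\mathbf{1}_\lambda\to\mathcal{E}_i\mathcal{F}_i\mathbf{1}_\lambda\langle 1-\lambda_i\rangle$; caps $\epsilon'_{i,\lambda}\colon\mathcal{F}_i\mathcal{E}_i\mathbf{1}_\lambda\to\mathbf{1}_\lambda\langle 1+\lambda_i\rangle$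 and $\epsilon_{i,\lambda}\colon\mathcal{E}_i\mathcal{F}_i\mathbf{1}_\lambda\to\mathbf{1}_\lambda\langle 1-\lambda_i\rangle$. Horizontal composition with identity 2-morphisms of $\mathcal{E}_i,\mathcal{F}_i$ is written by juxtaposition; weight subscripts and shifts are suppressed when determined by the source. The relations (for all indices and weights) are: (1) Biadjointness: $(\epsilon_{i,\lambda+\alpha_i}\mathcal{E}_i)(\mathcal{E}_i\eta_{i,\lambda})=\mathrm{id}_{\mathcal{E}_i\mathbf{1}_\lambda}=(\mathcal{E}_i\epsilon'_{i,\lambda})(\eta'_{i,\lambda+\alpha_i}\mathcal{E}_i)$ and $(\mathcal{F}_i\epsilon_{i,\lambda+\alpha_i})(\eta_{i,\lambda}\mathcal{F}_i)=\mathrm{id}_{\mathcal{F}_i\mathbf{1}_{\lambda+\alpha_i}}=(\epsilon'_{i,\lambda}\mathcal{F}_i)(\mathcal{F}_i\eta'_{i,\lambda+\alpha_i})$. (2) Cyclicity: on $\mathcal{F}_i\mathbf{1}_{\lambda+\alpha_i}$, $(\epsilon'_i\mathcal{F}_i)(\mathcal{F}_ix_i\mathcal{F}_i)(\mathcal{F}_i\eta'_i)=(\mathcal{F}_i\epsilon_i)(\mathcal{F}_ix_i\mathcal{F}_i)(\eta_i\mathcal{F}_i)$ (this is the downward dot). As maps $\mathcal{F}_i\mathcal{F}_j\mathbf{1}_\lambda\to\mathcal{F}_j\mathcal{F}_i\mathbf{1}_\lambda\langle -i\cdot j\rangle$, the two composites $\mathcal{F}_i\mathcal{F}_j\xrightarrow{\eta_j}\mathcal{F}_j\mathcal{E}_j\mathcal{F}_i\mathcal{F}_j\xrightarrow{\eta_i}\mathcal{F}_j\mathcal{F}_i\mathcal{E}_i\mathcal{E}_j\mathcal{F}_i\mathcal{F}_j\xrightarrow{\psi_{ij}}\mathcal{F}_j\mathcal{F}_i\mathcal{E}_j\mathcal{E}_i\mathcal{F}_i\mathcal{F}_j\xrightarrow{\epsilon_i}\mathcal{F}_j\mathcal{F}_i\mathcal{E}_j\mathcal{F}_j\xrightarrow{\epsilon_j}\mathcal{F}_j\mathcal{F}_i$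 and $\mathcal{F}_i\mathcal{F}_j\xrightarrow{\eta'_i}\mathcal{F}_i\mathcal{F}_j\mathcal{E}_i\mathcal{F}_i\xrightarrow{\eta'_j}\mathcal{F}_i\mathcal{F}_j\mathcal{E}_i\mathcal{E}_j\mathcal{F}_j\mathcal{F}_i\xrightarrow{\psi_{ij}}\mathcal{F}_i\mathcal{F}_j\mathcal{E}_j\mathcal{E}_i\mathcal{F}_j\mathcal{F}_i\xrightarrow{\epsilon'_j}\mathcal{F}_i\mathcal{E}_i\mathcal{F}_j\mathcal{F}_i\xrightarrow{\epsilon'_i}\mathcal{F}_j\mathcal{F}_i$ are equal (this is the downward crossing). Sideways crossings are defined by $\sigma_{ij}:=(\mathcal{F}_j\mathcal{E}_i\epsilon_j)(\mathcal{F}_j\psi_{ji}\mathcal{F}_j)(\eta_j\mathcal{E}_i\mathcal{F}_j)\colon\mathcal{E}_i\mathcal{F}_j\mathbf{1}_\lambda\to\mathcal{F}_j\mathcal{E}_i\mathbf{1}_\lambda$ and $\sigma'_{ij}:=(\epsilon'_i\mathcal{E}_j\mathcal{F}_i)(\mathcal{F}_i\psi_{ji}\mathcal{F}_i)(\mathcal{F}_i\mathcal{E}_j\eta'_i)\colon\mathcal{F}_i\mathcal{E}_j\mathbf{1}_\lambda\to\mathcal{E}_j\mathcal{F}_i\mathbf{1}_\lambda$. (3) KLR relations: $\psi_{ji}\psi_{ij}=0$ if $i=j$; $=t_{ij}\,\mathrm{id}$ if $i\cdot j=0$; $=t_{ij}\,x_i\mathcal{E}_j+t_{ji}\,\mathcal{E}_ix_j$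 if $i\cdot j=-1$. NilHecke: $\psi_{ii}(x_i\mathcal{E}_i)-(\mathcal{E}_ix_i)\psi_{ii}=\mathrm{id}=(x_i\mathcal{E}_i)\psi_{ii}-\psi_{ii}(\mathcal{E}_ix_i)$. For $i\neq j$: $\psi_{ij}(x_i\mathcal{E}_j)=(\mathcal{E}_jx_i)\psi_{ij}$ and $(x_j\mathcal{E}_i)\psi_{ij}=\psi_{ij}(\mathcal{E}_ix_j)$. Cubic: $(\psi_{jk}\mathcal{E}_i)(\mathcal{E}_j\psi_{ik})(\psi_{ij}\mathcal{E}_k)-(\mathcal{E}_k\psi_{ij})(\psi_{ik}\mathcal{E}_j)(\mathcal{E}_i\psi_{jk})$ equals $t_{ij}\,\mathrm{id}$ if $i=k$ and $i\cdot j=-1$, and $0$ otherwise. (4) Mixed relations: for $i\neq j$, $\sigma_{ij}\sigma'_{ji}=\mathrm{id}_{\mathcal{F}_j\mathcal{E}_i\mathbf{1}_\lambda}$ and $\sigma'_{ji}\sigma_{ij}=\mathrm{id}_{\mathcal{E}_i\mathcal{F}_j\mathbf{1}_\lambda}$. (5) Bubbles: for $m\ge 0$ let $\circlearrowright_{i,\lambda}(m)=\epsilon_{i,\lambda}(x_i^m\mathcal{F}_i)\eta'_{i,\lambda}$ (clockwise) and $\circlearrowleft_{i,\lambda}(m)=\epsilon'_{i,\lambda}(\mathcal{F}_ix_i^m)\eta_{i,\lambda}$ (counterclockwise), endomorphisms of $\mathbf{1}_\lambda$. Then for $m\geq 0$: $\circlearrowright_{i,\lambda}(m)=0$ if $m<\lambda_i-1$;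 $\circlearrowleft_{i,\lambda}(m)=0$ if $m<-\lambda_i-1$; $\circlearrowright_{i,\lambda}(\lambda_i-1)=\mathsf{c}^{+}_{i,\lambda}\mathrm{id}$ if $\lambda_i\ge1$; $\circlearrowleft_{i,\lambda}(-\lambda_i-1)=\mathsf{c}^{-}_{i,\lambda}\mathrm{id}$ if $\lambda_i\le-1$. Fake bubbles (formal symbols with negative $m$) are defined by $\circlearrowright_{i,\lambda}(\lambda_i-1)=\mathsf{c}^{+}_{i,\lambda}\mathrm{id}$ for $\lambda_i\le0$; $\circlearrowleft_{i,\lambda}(-\lambda_i-1)=\mathsf{c}^{-}_{i,\lambda}\mathrm{id}$ for $\lambda_i\ge0$; for $\lambda_i<0$, $0<j<-\lambda_i+1$: $\circlearrowright_{i,\lambda}(\lambda_i-1+j)=-\frac1{\mathsf{c}^{-}_{i,\lambda}}\sum_{x+y=j,\,y\ge1}\circlearrowright_{i,\lambda}(\lambda_i-1+x)\circlearrowleft_{i,\lambda}(-\lambda_i-1+y)$; for $\lambda_i>0$, $0<j<\lambda_i+1$: $\circlearrowleft_{i,\lambda}(-\lambda_i-1+j)=-\frac1{\mathsf{c}^{+}_{i,\lambda}}\sum_{x+y=j,\,x\ge1}\circlearrowright_{i,\lambda}(\lambda_i-1+x)\circlearrowleft_{i,\lambda}(-\lambda_i-1+y)$; both are $0$ for $j<0$. (Here $x,y\geq 0$.) Equivalently, bubbles satisfy the infinite Grassmannian relation $\big(\sum_{r\ge0}\circlearrowright_{i,\lambda}(\lambda_i-1+r)t^r\big)\big(\sum_{s\ge0}\circlearrowleft_{i,\lambda}(-\lambda_i-1+s)t^s\big)=-1/\beta_{i,\lambda}$.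 (6) $\mathfrak{sl}_2$ relations (sums over $f_1,f_2,f_3\ge0$, empty if the total is negative): $\mathrm{id}_{\mathcal{E}_i\mathcal{F}_i\mathbf{1}_\lambda}=\beta_{i,\lambda}\,\sigma'_{ii}\sigma_{ii}-\beta_{i,\lambda}\sum_{f_1+f_2+f_3=\lambda_i-1}(x_i^{f_3}\mathcal{F}_i)\eta'_{i,\lambda}\circ\circlearrowleft_{i,\lambda}(-\lambda_i-1+f_2)\circ\epsilon_{i,\lambda}(x_i^{f_1}\mathcal{F}_i)$, $\mathrm{id}_{\mathcal{F}_i\mathcal{E}_i\mathbf{1}_\lambda}=\beta_{i,\lambda}\,\sigma_{ii}\sigma'_{ii}-\beta_{i,\lambda}\sum_{f_1+f_2+f_3=-\lambda_i-1}(\mathcal{F}_ix_i^{f_3})\eta_{i,\lambda}\circ\circlearrowright_{i,\lambda}(\lambda_i-1+f_2)\circ\epsilon'_{i,\lambda}(\mathcal{F}_ix_i^{f_1})$. *)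

theory Defs
  imports Complex_Main
begin

section \<open>Strict graded additive linear 2-categories\<close>

text \<open>
  Strict 2-categories with partial composition operations on carrier sets.  Vertical composition
  \<open>vcomp C a b\<close> is a after b, horizontal composition \<open>hcomp C a b\<close> has a on the left, and the same
  order is used for 1-morphisms.  The field \<open>shift1 C n\<close> is the grading shift by n on 1-morphisms,
  and \<open>shift2 C n\<close> its action on 2-morphisms.
\<close>

record ('o, 'm, 't, 'k) twocat =
  Obj :: "'o set"
  Mor1 :: "'m set"
  src1 :: "'m \<Rightarrow> 'o"
  tgt1 :: "'m \<Rightarrow> 'o"
  id1 :: "'o \<Rightarrow> 'm"
  comp1 :: "'m \<Rightarrow> 'm \<Rightarrow> 'm"
  Mor2 :: "'t set"
  src2 :: "'t \<Rightarrow> 'm"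
  tgt2 :: "'t \<Rightarrow> 'm"
  id2 :: "'m \<Rightarrow> 't"
  vcomp :: "'t \<Rightarrow> 't \<Rightarrow> 't"
  hcomp :: "'t \<Rightarrow> 't \<Rightarrow> 't"
  zero2 :: "'m \<Rightarrow> 'm \<Rightarrow> 't"
  add2 :: "'t \<Rightarrow> 't \<Rightarrow> 't"
  smult2 :: "'k \<Rightarrow> 't \<Rightarrow> 't"
  shift1 :: "int \<Rightarrow> 'm \<Rightarrow> 'm"
  shift2 :: "int \<Rightarrow> 't \<Rightarrow> 't"

definition hom1 :: "('o,'m,'t,'k) twocat \<Rightarrow> 'o \<Rightarrow> 'o \<Rightarrow> 'm set" where
  "hom1 C a b = {f \<in> Mor1 C. src1 C f = a \<and> tgt1 C f = b}"

definition hom2 :: "('o,'m,'t,'k) twocat \<Rightarrow> 'm \<Rightarrow> 'm \<Rightarrow> 't set" where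
  "hom2 C f g = {u \<in> Mor2 C. src2 C u = f \<and> tgt2 C u = g}"

locale strict_2category =
  fixes C :: "('o,'m,'t,'k) twocat"
  assumes src1_in: "f \<in> Mor1 C \<Longrightarrow> src1 C f \<in> Obj C"
    and tgt1_in: "f \<in> Mor1 C \<Longrightarrow> tgt1 C f \<in> Obj C"
    and id1_in: "a \<in> Obj C \<Longrightarrow> id1 C a \<in> hom1 C a a"
    and comp1_in: "f \<in> hom1 C a b \<Longrightarrow> g \<in> hom1 C b c \<Longrightarrow> comp1 C g f \<in> hom1 C a c"
    and comp1_assoc: "f \<in> hom1 C a b \<Longrightarrow> g \<in> hom1 C b c \<Longrightarrow> h \<in> hom1 C c d \<Longrightarrow>
      comp1 C (comp1 C h g) f = comp1 C h (comp1 C g f)"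
    and comp1_id: "f \<in> hom1 C a b \<Longrightarrow> comp1 C f (id1 C a) = f"
    and id_comp1: "f \<in> hom1 C a b \<Longrightarrow> comp1 C (id1 C b) f = f"
    and Mor2_parallel: "u \<in> Mor2 C \<Longrightarrow> \<exists>a b. src2 C u \<in> hom1 C a b \<and> tgt2 C u \<in> hom1 C a b"
    and id2_in: "f \<in> Mor1 C \<Longrightarrow> id2 C f \<in> hom2 C f f"
    and vcomp_in: "u \<in> hom2 C f g \<Longrightarrow> v \<in> hom2 C g h \<Longrightarrow> vcomp C v u \<in> hom2 C f h"
    and vcomp_assoc: "u \<in> hom2 C f g \<Longrightarrow> v \<in> hom2 C g h \<Longrightarrow> w \<in> hom2 C h k \<Longrightarrow>
      vcomp C (vcomp C w v) u = vcomp C w (vcomp C v u)"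
    and vcomp_id: "u \<in> hom2 C f g \<Longrightarrow> vcomp C u (id2 C f) = u"
    and id_vcomp: "u \<in> hom2 C f g \<Longrightarrow> vcomp C (id2 C g) u = u"
    and hcomp_in: "f \<in> hom1 C a b \<Longrightarrow> f' \<in> hom1 C b c \<Longrightarrow> u \<in> hom2 C f g \<Longrightarrow> u' \<in> hom2 C f' g' \<Longrightarrow>
      hcomp C u' u \<in> hom2 C (comp1 C f' f) (comp1 C g' g)"
    and hcomp_assoc: "f \<in> hom1 C a b \<Longrightarrow> f' \<in> hom1 C b c \<Longrightarrow> f'' \<in> hom1 C c d \<Longrightarrow>
      u \<in> hom2 C f g \<Longrightarrow> u' \<in> hom2 C f' g' \<Longrightarrow> u'' \<in> hom2 C f'' g'' \<Longrightarrow>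
      hcomp C (hcomp C u'' u') u = hcomp C u'' (hcomp C u' u)"
    and hcomp_unit: "f \<in> hom1 C a b \<Longrightarrow> u \<in> hom2 C f g \<Longrightarrow> hcomp C u (id2 C (id1 C a)) = u"
    and unit_hcomp: "f \<in> hom1 C a b \<Longrightarrow> u \<in> hom2 C f g \<Longrightarrow> hcomp C (id2 C (id1 C b)) u = u"
    and hcomp_id2: "f \<in> hom1 C a b \<Longrightarrow> g \<in> hom1 C b c \<Longrightarrow>
      hcomp C (id2 C g) (id2 C f) = id2 C (comp1 C g f)"
    and interchange: "f \<in> hom1 C a b \<Longrightarrow> f' \<in> hom1 C b c \<Longrightarrow> u \<in> hom2 C f g \<Longrightarrow> v \<in> hom2 C g h \<Longrightarrow>
      u' \<in> hom2 C f' g' \<Longrightarrow> v' \<in> hom2 C g' h' \<Longrightarrow>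
      hcomp C (vcomp C v' u') (vcomp C v u) = vcomp C (hcomp C v' v) (hcomp C u' u)"

locale linear_2category = strict_2category C
  for C :: "('o,'m,'t,'k::field) twocat" +
  assumes zero2_in: "f \<in> hom1 C a b \<Longrightarrow> g \<in> hom1 C a b \<Longrightarrow> zero2 C f g \<in> hom2 C f g"
    and add2_in: "u \<in> hom2 C f g \<Longrightarrow> v \<in> hom2 C f g \<Longrightarrow> add2 C u v \<in> hom2 C f g"
    and smult2_in: "u \<in> hom2 C f g \<Longrightarrow> smult2 C r u \<in> hom2 C f g"
    and add2_assoc: "u \<in> hom2 C f g \<Longrightarrow> v \<in> hom2 C f g \<Longrightarrow> w \<in> hom2 C f g \<Longrightarrow>
      add2 C (add2 C u v) w = add2 C u (add2 C v w)"
    and add2_commute: "u \<in> hom2 C f g \<Longrightarrow> v \<in> hom2 C f g \<Longrightarrow> add2 C u v = add2 C v u"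
    and add2_zero: "u \<in> hom2 C f g \<Longrightarrow> add2 C u (zero2 C f g) = u"
    and add2_neg: "u \<in> hom2 C f g \<Longrightarrow> add2 C u (smult2 C (- 1) u) = zero2 C f g"
    and smult2_one: "u \<in> hom2 C f g \<Longrightarrow> smult2 C 1 u = u"
    and smult2_smult2: "u \<in> hom2 C f g \<Longrightarrow> smult2 C r (smult2 C s u) = smult2 C (r * s) u"
    and smult2_add: "u \<in> hom2 C f g \<Longrightarrow> v \<in> hom2 C f g \<Longrightarrow>
      smult2 C r (add2 C u v) = add2 C (smult2 C r u) (smult2 C r v)"
    and add_smult2: "u \<in> hom2 C f g \<Longrightarrow> smult2 C (r + s) u = add2 C (smult2 C r u) (smult2 C s u)"
    and vcomp_add_left: "u \<in> hom2 C f g \<Longrightarrow> v \<in> hom2 C g h \<Longrightarrow> w \<in> hom2 C g h \<Longrightarrow>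
      vcomp C (add2 C v w) u = add2 C (vcomp C v u) (vcomp C w u)"
    and vcomp_add_right: "u \<in> hom2 C f g \<Longrightarrow> v \<in> hom2 C f g \<Longrightarrow> w \<in> hom2 C g h \<Longrightarrow>
      vcomp C w (add2 C u v) = add2 C (vcomp C w u) (vcomp C w v)"
    and vcomp_smult_left: "u \<in> hom2 C f g \<Longrightarrow> v \<in> hom2 C g h \<Longrightarrow>
      vcomp C (smult2 C r v) u = smult2 C r (vcomp C v u)"
    and vcomp_smult_right: "u \<in> hom2 C f g \<Longrightarrow> v \<in> hom2 C g h \<Longrightarrow>
      vcomp C v (smult2 C r u) = smult2 C r (vcomp C v u)"
    and hcomp_add_left: "f \<in> hom1 C a b \<Longrightarrow> f' \<in> hom1 C b c \<Longrightarrow>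
      u \<in> hom2 C f g \<Longrightarrow> u' \<in> hom2 C f' g' \<Longrightarrow> v' \<in> hom2 C f' g' \<Longrightarrow>
      hcomp C (add2 C u' v') u = add2 C (hcomp C u' u) (hcomp C v' u)"
    and hcomp_add_right: "f \<in> hom1 C a b \<Longrightarrow> f' \<in> hom1 C b c \<Longrightarrow>
      u \<in> hom2 C f g \<Longrightarrow> v \<in> hom2 C f g \<Longrightarrow> u' \<in> hom2 C f' g' \<Longrightarrow>
      hcomp C u' (add2 C u v) = add2 C (hcomp C u' u) (hcomp C u' v)"
    and hcomp_smult_left: "f \<in> hom1 C a b \<Longrightarrow> f' \<in> hom1 C b c \<Longrightarrow>
      u \<in> hom2 C f g \<Longrightarrow> u' \<in> hom2 C f' g' \<Longrightarrow>
      hcomp C (smult2 C r u') u = smult2 C r (hcomp C u' u)"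
    and hcomp_smult_right: "f \<in> hom1 C a b \<Longrightarrow> f' \<in> hom1 C b c \<Longrightarrow>
      u \<in> hom2 C f g \<Longrightarrow> u' \<in> hom2 C f' g' \<Longrightarrow>
      hcomp C u' (smult2 C r u) = smult2 C r (hcomp C u' u)"

text \<open>Every Hom-category is additive, and carries a strict action of the integers by shifts that is
  compatible with horizontal composition.\<close>

locale graded_additive_2category = linear_2category C
  for C :: "('o,'m,'t,'k::field) twocat" +
  assumes zero_object: "a \<in> Obj C \<Longrightarrow> b \<in> Obj C \<Longrightarrow> \<exists>z \<in> hom1 C a b. id2 C z = zero2 C z z"
    and biproducts: "f \<in> hom1 C a b \<Longrightarrow> g \<in> hom1 C a b \<Longrightarrow>
      \<exists>s \<in> hom1 C a b. \<exists>i \<in> hom2 C f s. \<exists>j \<in> hom2 C g s. \<exists>p \<in> hom2 C s f. \<exists>q \<in> hom2 C s g.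
        vcomp C p i = id2 C f \<and> vcomp C q j = id2 C g \<and>
        vcomp C p j = zero2 C g f \<and> vcomp C q i = zero2 C f g \<and>
        add2 C (vcomp C i p) (vcomp C j q) = id2 C s"
    and shift1_in: "f \<in> hom1 C a b \<Longrightarrow> shift1 C n f \<in> hom1 C a b"
    and shift2_in: "u \<in> hom2 C f g \<Longrightarrow> shift2 C n u \<in> hom2 C (shift1 C n f) (shift1 C n g)"
    and shift1_0: "f \<in> Mor1 C \<Longrightarrow> shift1 C 0 f = f"
    and shift1_shift1: "f \<in> Mor1 C \<Longrightarrow> shift1 C m (shift1 C n f) = shift1 C (m + n) f"
    and shift2_0: "u \<in> Mor2 C \<Longrightarrow> shift2 C 0 u = u"
    and shift2_shift2: "u \<in> Mor2 C \<Longrightarrow> shift2 C m (shift2 C n u) = shift2 C (m + n) u"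
    and shift2_id2: "f \<in> Mor1 C \<Longrightarrow> shift2 C n (id2 C f) = id2 C (shift1 C n f)"
    and shift2_vcomp: "u \<in> hom2 C f g \<Longrightarrow> v \<in> hom2 C g h \<Longrightarrow>
      shift2 C n (vcomp C v u) = vcomp C (shift2 C n v) (shift2 C n u)"
    and shift2_add: "u \<in> hom2 C f g \<Longrightarrow> v \<in> hom2 C f g \<Longrightarrow>
      shift2 C n (add2 C u v) = add2 C (shift2 C n u) (shift2 C n v)"
    and shift2_smult: "u \<in> Mor2 C \<Longrightarrow> shift2 C n (smult2 C r u) = smult2 C r (shift2 C n u)"
    and shift1_comp1: "f \<in> hom1 C a b \<Longrightarrow> g \<in> hom1 C b c \<Longrightarrow>
      comp1 C (shift1 C m g) (shift1 C n f) = shift1 C (m + n) (comp1 C g f)"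
    and shift2_hcomp: "f \<in> hom1 C a b \<Longrightarrow> f' \<in> hom1 C b c \<Longrightarrow>
      u \<in> hom2 C f g \<Longrightarrow> u' \<in> hom2 C f' g' \<Longrightarrow>
      hcomp C (shift2 C m u') (shift2 C n u) = shift2 C (m + n) (hcomp C u' u)"

locale graded_linear_2functor =
  fixes C :: "('o,'m,'t,'k::field) twocat" and D :: "('p,'n,'s,'k) twocat"
    and F0 :: "'o \<Rightarrow> 'p" and F1 :: "'m \<Rightarrow> 'n" and F2 :: "'t \<Rightarrow> 's"
  assumes F0_in: "a \<in> Obj C \<Longrightarrow> F0 a \<in> Obj D"
    and F1_in: "f \<in> hom1 C a b \<Longrightarrow> F1 f \<in> hom1 D (F0 a) (F0 b)"
    and F1_id1: "a \<in> Obj C \<Longrightarrow> F1 (id1 C a) = id1 D (F0 a)"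
    and F1_comp1: "f \<in> hom1 C a b \<Longrightarrow> g \<in> hom1 C b c \<Longrightarrow> F1 (comp1 C g f) = comp1 D (F1 g) (F1 f)"
    and F2_in: "u \<in> hom2 C f g \<Longrightarrow> F2 u \<in> hom2 D (F1 f) (F1 g)"
    and F2_id2: "f \<in> Mor1 C \<Longrightarrow> F2 (id2 C f) = id2 D (F1 f)"
    and F2_vcomp: "u \<in> hom2 C f g \<Longrightarrow> v \<in> hom2 C g h \<Longrightarrow> F2 (vcomp C v u) = vcomp D (F2 v) (F2 u)"
    and F2_hcomp: "f \<in> hom1 C a b \<Longrightarrow> f' \<in> hom1 C b c \<Longrightarrow> u \<in> hom2 C f g \<Longrightarrow> u' \<in> hom2 C f' g' \<Longrightarrow>
      F2 (hcomp C u' u) = hcomp D (F2 u') (F2 u)"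
    and F2_add2: "u \<in> hom2 C f g \<Longrightarrow> v \<in> hom2 C f g \<Longrightarrow> F2 (add2 C u v) = add2 D (F2 u) (F2 v)"
    and F2_smult2: "u \<in> Mor2 C \<Longrightarrow> F2 (smult2 C r u) = smult2 D r (F2 u)"
    and F1_shift1: "f \<in> Mor1 C \<Longrightarrow> F1 (shift1 C n f) = shift1 D n (F1 f)"
    and F2_shift2: "u \<in> Mor2 C \<Longrightarrow> F2 (shift2 C n u) = shift2 D n (F2 u)"

definition isomorphism_2categories ::
  "('o,'m,'t,'k::field) twocat \<Rightarrow> ('p,'n,'s,'k) twocat \<Rightarrow>
    ('o \<Rightarrow> 'p) \<Rightarrow> ('m \<Rightarrow> 'n) \<Rightarrow> ('t \<Rightarrow> 's) \<Rightarrow> bool" where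
  "isomorphism_2categories C D F0 F1 F2 \<longleftrightarrow>
    graded_additive_2category C \<and> graded_additive_2category D \<and>
    graded_linear_2functor C D F0 F1 F2 \<and>
    (\<exists>G0 G1 G2. graded_linear_2functor D C G0 G1 G2 \<and>
      (\<forall>a\<in>Obj C. G0 (F0 a) = a) \<and> (\<forall>f\<in>Mor1 C. G1 (F1 f) = f) \<and> (\<forall>u\<in>Mor2 C. G2 (F2 u) = u) \<and>
      (\<forall>a\<in>Obj D. F0 (G0 a) = a) \<and> (\<forall>f\<in>Mor1 D. F1 (G1 f) = f) \<and> (\<forall>u\<in>Mor2 D. F2 (G2 u) = u))"


section \<open>Cartan data and parameters\<close>

text \<open>The bilinear form may take values in any commutative ring of characteristic zero: already for
  the weight lattice of sl2 it is not integer valued.\<close>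

record ('i, 'x, 'r) cartan =
  alpha :: "'i \<Rightarrow> 'x"
  fundwt :: "'i \<Rightarrow> 'x"
  coroot :: "'i \<Rightarrow> 'x \<Rightarrow> int"
  form :: "'x \<Rightarrow> 'x \<Rightarrow> 'r"

text \<open>The Z-module structure on an abelian group is unique, so the existential quantifier over
  \<open>scale\<close> only names it.\<close>

definition free_abelian :: "'x::ab_group_add itself \<Rightarrow> bool" where
  "free_abelian _ \<longleftrightarrow> (\<exists>(scale :: int \<Rightarrow> 'x \<Rightarrow> 'x) B.
     module scale \<and> \<not> module.dependent scale B \<and> module.span scale B = UNIV)"

locale cartan_datum =
  fixes c :: "('i, 'x::ab_group_add, 'r::{comm_ring_1,ring_char_0}) cartan"
  assumes free: "free_abelian TYPE('x)"
    and coroot_hom: "additive (coroot c i)"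
    and form_left: "additive (\<lambda>v. form c v w)"
    and form_right: "additive (form c v)"
    and form_sym: "form c (alpha c i) (alpha c j) = form c (alpha c j) (alpha c i)"
    and form_diag: "form c (alpha c i) (alpha c i) = 2"
    and form_offdiag: "i \<noteq> j \<Longrightarrow> form c (alpha c i) (alpha c j) \<in> {0, - 1}"
    and coroot_form: "of_int (coroot c i v) = form c (alpha c i) v"
    and coroot_fundwt: "coroot c j (fundwt c i) = (if i = j then 1 else 0)"

text \<open>The Cartan integer \<open>a\<^sub>i\<^sub>j\<close>, which is also the integer \<open>i \<cdot> j\<close> given by the form (\<open>coroot_form\<close>).\<close>

definition cdot :: "('i,'x,'r) cartan \<Rightarrow> 'i \<Rightarrow> 'i \<Rightarrow> int" where
  "cdot c i j = coroot c i (alpha c j)"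

text \<open>A choice of scalars Q is a function \<open>t\<close>, of which only the values off the diagonal matter.
  The diagonal convention \<open>t\<^sub>i\<^sub>i = - \<beta>\<^sub>i\<close> is implemented by \<open>tfull\<close>.\<close>

definition choice_of_scalars :: "('i,'x,'r) cartan \<Rightarrow> ('i \<Rightarrow> 'i \<Rightarrow> 'k::field) \<Rightarrow> bool" where
  "choice_of_scalars c t \<longleftrightarrow>
    (\<forall>i j. i \<noteq> j \<longrightarrow> t i j \<noteq> 0 \<and> (cdot c i j = 0 \<longrightarrow> t i j = t j i))"

record ('i, 'x, 'k) bubble_params =
  beta :: "'i \<Rightarrow> 'k"
  cplus :: "'i \<Rightarrow> 'x \<Rightarrow> 'k"
  cminus :: "'i \<Rightarrow> 'x \<Rightarrow> 'k"

definition nonzero_params :: "('i,'x,'k::field) bubble_params \<Rightarrow> bool" where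
  "nonzero_params b \<longleftrightarrow>
    (\<forall>i. beta b i \<noteq> 0) \<and> (\<forall>i v. cplus b i v \<noteq> 0) \<and> (\<forall>i v. cminus b i v \<noteq> 0)"

definition tfull :: "('i \<Rightarrow> 'i \<Rightarrow> 'k::field) \<Rightarrow> ('i,'x,'k) bubble_params \<Rightarrow> 'i \<Rightarrow> 'i \<Rightarrow> 'k" where
  "tfull t b i j = (if i = j then - beta b i else t i j)"

definition compatible ::
  "('i,'x::ab_group_add,'r) cartan \<Rightarrow> ('i \<Rightarrow> 'i \<Rightarrow> 'k::field) \<Rightarrow> ('i,'x,'k) bubble_params \<Rightarrow> bool" where
  "compatible c t b \<longleftrightarrow> nonzero_params b \<and> (\<forall>i j v.
     cplus b i v * cminus b i v = - 1 / beta b i \<and>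
     cplus b i (v + alpha c j) = tfull t b i j * cplus b i v \<and>
     cminus b i (v - alpha c j) = tfull t b i j * cminus b i v)"

definition rescale_scalars ::
  "('i,'x,'r) cartan \<Rightarrow> ('i \<Rightarrow> 'k::field) \<Rightarrow> ('i \<Rightarrow> 'i \<Rightarrow> 'k) \<Rightarrow> ('i,'x,'k) bubble_params \<Rightarrow> 'i \<Rightarrow> 'i \<Rightarrow> 'k"
where
  "rescale_scalars c D t b i j =
     (if i = j then - (D i powi (- 2) * beta b i)
      else if cdot c i j = - 1 then D i * t i j
      else t i j)"

definition rescale_params ::
  "('i,'x,'r) cartan \<Rightarrow> ('i \<Rightarrow> 'k::field) \<Rightarrow> ('i,'x,'k) bubble_params \<Rightarrow> ('i,'x,'k) bubble_params" where
  "rescale_params c D b = \<lparr>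
     beta = (\<lambda>i. D i powi (- 2) * beta b i),
     cplus = (\<lambda>i v. D i powi (- coroot c i v + 1) * cplus b i v),
     cminus = (\<lambda>i v. D i powi (coroot c i v + 1) * cminus b i v)\<rparr>"


section \<open>Diagrammatic 2-morphisms\<close>

datatype 'i letter = EE 'i | FF 'i

type_synonym 'i word = "'i letter list"

fun lwt :: "('i,'x::ab_group_add,'r) cartan \<Rightarrow> 'i letter \<Rightarrow> 'x" where
  "lwt c (EE i) = alpha c i"
| "lwt c (FF i) = - alpha c i"

text \<open>The composite w with source v has target \<open>v + wwt c w\<close>.\<close>

definition wwt :: "('i,'x::ab_group_add,'r) cartan \<Rightarrow> 'i word \<Rightarrow> 'x" where
  "wwt c w = sum_list (map (lwt c) w)"

text \<open>\<open>CupFE\<close>, \<open>CupEF\<close>, \<open>CapFE\<close>, \<open>CapEF\<close> are \<open>\<eta>\<close>, \<open>\<eta>'\<close>, \<open>\<epsilon>'\<close>, \<open>\<epsilon>\<close> respectively.\<close>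

datatype 'i gen =
  Dot 'i | Cross 'i 'i | CupFE 'i | CupEF 'i | CapFE 'i | CapEF 'i

fun gdom :: "'i gen \<Rightarrow> 'i word" where
  "gdom (Dot i) = [EE i]"
| "gdom (Cross i j) = [EE i, EE j]"
| "gdom (CupFE i) = []"
| "gdom (CupEF i) = []"
| "gdom (CapFE i) = [FF i, EE i]"
| "gdom (CapEF i) = [EE i, FF i]"

fun gcod :: "'i gen \<Rightarrow> 'i word" where
  "gcod (Dot i) = [EE i]"
| "gcod (Cross i j) = [EE j, EE i]"
| "gcod (CupFE i) = [FF i, EE i]"
| "gcod (CupEF i) = [EE i, FF i]"
| "gcod (CapFE i) = []"
| "gcod (CapEF i) = []"

text \<open>Degree of the generator with rightmost weight v.\<close>

fun gdeg :: "('i,'x,'r) cartan \<Rightarrow> 'i gen \<Rightarrow> 'x \<Rightarrow> int" where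
  "gdeg c (Dot i) v = 2"
| "gdeg c (Cross i j) v = - cdot c i j"
| "gdeg c (CupFE i) v = 1 + coroot c i v"
| "gdeg c (CupEF i) v = 1 - coroot c i v"
| "gdeg c (CapFE i) v = 1 + coroot c i v"
| "gdeg c (CapEF i) v = 1 - coroot c i v"

text \<open>Formal expressions for homogeneous 2-morphisms between composites of the generating
  1-morphisms.  A weight argument is always the rightmost one.  The zero is annotated with
  domain, codomain, weight and degree.\<close>

datatype ('i, 'x, 'k) tm =
  TGen "'i gen" 'x
| TId "'i word" 'x
| TV "('i,'x,'k) tm" "('i,'x,'k) tm"
| TH "('i,'x,'k) tm" "('i,'x,'k) tm"
| TZero "'i word" "'i word" 'x int
| TAdd "('i,'x,'k) tm" "('i,'x,'k) tm"
| TScale 'k "('i,'x,'k) tm"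

text \<open>\<open>typed c s w w' v d\<close>: the expression s is a map of degree d from w to w', where w and w' have
  source v; in other words a map from w to the d-fold shift of w'.\<close>

inductive typed ::
  "('i,'x::ab_group_add,'r) cartan \<Rightarrow> ('i,'x,'k) tm \<Rightarrow> 'i word \<Rightarrow> 'i word \<Rightarrow> 'x \<Rightarrow> int \<Rightarrow> bool"
  for c where
  "typed c (TGen g v) (gdom g) (gcod g) v (gdeg c g v)"
| "typed c (TId w v) w w v 0"
| "typed c s w' w'' v d \<Longrightarrow> typed c s' w w' v d' \<Longrightarrow> typed c (TV s s') w w'' v (d + d')"
| "typed c s w w' (v + wwt c z) d \<Longrightarrow> typed c s' z z' v d' \<Longrightarrow>
     typed c (TH s s') (w @ z) (w' @ z') v (d + d')"
| "wwt c w = wwt c w' \<Longrightarrow> typed c (TZero w w' v d) w w' v d"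
| "typed c s w w' v d \<Longrightarrow> typed c s' w w' v d \<Longrightarrow> typed c (TAdd s s') w w' v d"
| "typed c s w w' v d \<Longrightarrow> typed c (TScale r s) w w' v d"

fun tsum :: "'i word \<Rightarrow> 'i word \<Rightarrow> 'x \<Rightarrow> int \<Rightarrow> ('i,'x,'k) tm list \<Rightarrow> ('i,'x,'k) tm" where
  "tsum w w' v d [] = TZero w w' v d"
| "tsum w w' v d (s # ss) = TAdd s (tsum w w' v d ss)"

text \<open>A layer \<open>(w, g, z)\<close> is the generator g with identities of w on its left and of z on its right.
  The expression \<open>diag c v w ls\<close> is the vertical composite of the layers ls, topmost layer first,
  with source the word w at rightmost weight v.\<close>

fun layer ::
  "('i,'x::ab_group_add,'r) cartan \<Rightarrow> 'x \<Rightarrow> 'i word \<times> 'i gen \<times> 'i word \<Rightarrow> ('i,'x,'k) tm" where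
  "layer c v (w, g, z) =
     TH (TId w (v + wwt c z + wwt c (gdom g))) (TH (TGen g (v + wwt c z)) (TId z v))"

fun diag ::
  "('i,'x::ab_group_add,'r) cartan \<Rightarrow> 'x \<Rightarrow> 'i word \<Rightarrow> ('i word \<times> 'i gen \<times> 'i word) list \<Rightarrow> ('i,'x,'k) tm"
where
  "diag c v w [] = TId w v"
| "diag c v w (l # ls) = TV (layer c v l) (diag c v w ls)"

text \<open>The sideways crossings \<open>\<sigma>\<^sub>i\<^sub>j\<close> from \<open>E\<^sub>i F\<^sub>j\<close> to \<open>F\<^sub>j E\<^sub>i\<close> and \<open>\<sigma>'\<^sub>i\<^sub>j\<close> from \<open>F\<^sub>i E\<^sub>j\<close> to \<open>E\<^sub>j F\<^sub>i\<close>.\<close>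

definition sig :: "'i \<Rightarrow> 'i \<Rightarrow> ('i word \<times> 'i gen \<times> 'i word) list" where
  "sig i j = [([FF j, EE i], CapEF j, []), ([FF j], Cross j i, [FF j]), ([], CupFE j, [EE i, FF j])]"

definition sig' :: "'i \<Rightarrow> 'i \<Rightarrow> ('i word \<times> 'i gen \<times> 'i word) list" where
  "sig' i j = [([], CapFE i, [EE j, FF i]), ([FF i], Cross j i, [FF i]), ([FF i, EE j], CupEF i, [])]"

definition real_cw ::
  "('i,'x::ab_group_add,'r) cartan \<Rightarrow> 'i \<Rightarrow> 'x \<Rightarrow> nat \<Rightarrow> ('i,'x,'k) tm" where
  "real_cw c i v m = diag c v []
     ([([], CapEF i, [])] @ replicate m ([], Dot i, [FF i]) @ [([], CupEF i, [])])"

definition real_ccw ::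
  "('i,'x::ab_group_add,'r) cartan \<Rightarrow> 'i \<Rightarrow> 'x \<Rightarrow> nat \<Rightarrow> ('i,'x,'k) tm" where
  "real_ccw c i v m = diag c v []
     ([([], CapFE i, [])] @ replicate m ([FF i], Dot i, []) @ [([], CupFE i, [])])"

text \<open>Fake bubbles, by recursion on the excess j of the number of dots over \<open>v\<^sub>i - 1\<close> (clockwise) or
  \<open>- v\<^sub>i - 1\<close> (counterclockwise), where \<open>v\<^sub>i = coroot c i v\<close>.  They are used only where that number of
  dots is negative; the bubbles of the opposite orientation in the recursion are then real.\<close>

fun fake_cw ::
  "('i,'x::ab_group_add,'r) cartan \<Rightarrow> ('i,'x,'k::field) bubble_params \<Rightarrow> 'i \<Rightarrow> 'x \<Rightarrow> nat \<Rightarrow> ('i,'x,'k) tm"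
where
  "fake_cw c b i v j =
     (if j = 0 then TScale (cplus b i v) (TId [] v)
      else TScale (- 1 / cminus b i v) (tsum [] [] v (2 * int j)
        (map (\<lambda>x. TV (fake_cw c b i v x) (real_ccw c i v (nat (- coroot c i v - 1 + int (j - x)))))
          [0..<j])))"

fun fake_ccw ::
  "('i,'x::ab_group_add,'r) cartan \<Rightarrow> ('i,'x,'k::field) bubble_params \<Rightarrow> 'i \<Rightarrow> 'x \<Rightarrow> nat \<Rightarrow> ('i,'x,'k) tm"
where
  "fake_ccw c b i v j =
     (if j = 0 then TScale (cminus b i v) (TId [] v)
      else TScale (- 1 / cplus b i v) (tsum [] [] v (2 * int j)
        (map (\<lambda>y. TV (real_cw c i v (nat (coroot c i v - 1 + int (j - y)))) (fake_ccw c b i v y))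
          [0..<j])))"

declare fake_cw.simps [simp del] fake_ccw.simps [simp del]

text \<open>Bubbles with m dots, m an arbitrary integer.\<close>

definition cw ::
  "('i,'x::ab_group_add,'r) cartan \<Rightarrow> ('i,'x,'k::field) bubble_params \<Rightarrow> 'i \<Rightarrow> 'x \<Rightarrow> int \<Rightarrow> ('i,'x,'k) tm"
where
  "cw c b i v m =
     (if 0 \<le> m then real_cw c i v (nat m)
      else if m < coroot c i v - 1 then TZero [] [] v (2 * (m + 1 - coroot c i v))
      else fake_cw c b i v (nat (m - (coroot c i v - 1))))"

definition ccw ::
  "('i,'x::ab_group_add,'r) cartan \<Rightarrow> ('i,'x,'k::field) bubble_params \<Rightarrow> 'i \<Rightarrow> 'x \<Rightarrow> int \<Rightarrow> ('i,'x,'k) tm"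
where
  "ccw c b i v m =
     (if 0 \<le> m then real_ccw c i v (nat m)
      else if m < - coroot c i v - 1 then TZero [] [] v (2 * (m + 1 + coroot c i v))
      else fake_ccw c b i v (nat (m - (- coroot c i v - 1))))"

definition triples :: "int \<Rightarrow> (nat \<times> nat \<times> nat) list" where
  "triples n = [(f1, f2, f3). f1 \<leftarrow> [0..<nat (n + 1)], f2 \<leftarrow> [0..<nat (n + 1)], f3 \<leftarrow> [0..<nat (n + 1)],
     int (f1 + f2 + f3) = n]"

inductive urel ::
  "('i,'x::ab_group_add,'r) cartan \<Rightarrow> ('i \<Rightarrow> 'i \<Rightarrow> 'k::field) \<Rightarrow> ('i,'x,'k) bubble_params \<Rightarrow>
    ('i,'x,'k) tm \<Rightarrow> ('i,'x,'k) tm \<Rightarrow> bool"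
  for c t b where
  biadj_E1: "urel c t b
     (diag c v [EE i] [([], CapEF i, [EE i]), ([EE i], CupFE i, [])]) (TId [EE i] v)"
| biadj_E2: "urel c t b
     (diag c v [EE i] [([EE i], CapFE i, []), ([], CupEF i, [EE i])]) (TId [EE i] v)"
| biadj_F1: "urel c t b
     (diag c v [FF i] [([FF i], CapEF i, []), ([], CupFE i, [FF i])]) (TId [FF i] v)"
| biadj_F2: "urel c t b
     (diag c v [FF i] [([], CapFE i, [FF i]), ([FF i], CupEF i, [])]) (TId [FF i] v)"
| cyclic_dot: "urel c t b
     (diag c v [FF i] [([], CapFE i, [FF i]), ([FF i], Dot i, [FF i]), ([FF i], CupEF i, [])])
     (diag c v [FF i] [([FF i], CapEF i, []), ([FF i], Dot i, [FF i]), ([], CupFE i, [FF i])])"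
| cyclic_cross: "urel c t b
     (diag c v [FF i, FF j]
       [([FF j, FF i], CapEF j, []),
        ([FF j, FF i, EE j], CapEF i, [FF j]),
        ([FF j, FF i], Cross i j, [FF i, FF j]),
        ([FF j], CupFE i, [EE j, FF i, FF j]),
        ([], CupFE j, [FF i, FF j])])
     (diag c v [FF i, FF j]
       [([], CapFE i, [FF j, FF i]),
        ([FF i], CapFE j, [EE i, FF j, FF i]),
        ([FF i, FF j], Cross i j, [FF j, FF i]),
        ([FF i, FF j, EE i], CupEF j, [FF i]),
        ([FF i, FF j], CupEF i, [])])"
| klr_same: "urel c t b
     (diag c v [EE i, EE i] [([], Cross i i, []), ([], Cross i i, [])])
     (TZero [EE i, EE i] [EE i, EE i] v (- 2 * cdot c i i))"
| klr_zero: "i \<noteq> j \<Longrightarrow> cdot c i j = 0 \<Longrightarrow> urel c t b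
     (diag c v [EE i, EE j] [([], Cross j i, []), ([], Cross i j, [])])
     (TScale (t i j) (TId [EE i, EE j] v))"
| klr_minus: "i \<noteq> j \<Longrightarrow> cdot c i j = - 1 \<Longrightarrow> urel c t b
     (diag c v [EE i, EE j] [([], Cross j i, []), ([], Cross i j, [])])
     (TAdd (TScale (t i j) (diag c v [EE i, EE j] [([], Dot i, [EE j])]))
           (TScale (t j i) (diag c v [EE i, EE j] [([EE i], Dot j, [])])))"
| nilhecke1: "urel c t b
     (TAdd (diag c v [EE i, EE i] [([], Cross i i, []), ([], Dot i, [EE i])])
           (TScale (- 1) (diag c v [EE i, EE i] [([EE i], Dot i, []), ([], Cross i i, [])])))
     (TId [EE i, EE i] v)"
| nilhecke2: "urel c t b
     (TAdd (diag c v [EE i, EE i] [([], Dot i, [EE i]), ([], Cross i i, [])])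
           (TScale (- 1) (diag c v [EE i, EE i] [([], Cross i i, []), ([EE i], Dot i, [])])))
     (TId [EE i, EE i] v)"
| dot_slide1: "i \<noteq> j \<Longrightarrow> urel c t b
     (diag c v [EE i, EE j] [([], Cross i j, []), ([], Dot i, [EE j])])
     (diag c v [EE i, EE j] [([EE j], Dot i, []), ([], Cross i j, [])])"
| dot_slide2: "i \<noteq> j \<Longrightarrow> urel c t b
     (diag c v [EE i, EE j] [([], Dot j, [EE i]), ([], Cross i j, [])])
     (diag c v [EE i, EE j] [([], Cross i j, []), ([EE i], Dot j, [])])"
| cubic: "urel c t b
     (TAdd
       (diag c v [EE i, EE j, EE k]
         [([], Cross j k, [EE i]), ([EE j], Cross i k, []), ([], Cross i j, [EE k])])
       (TScale (- 1) (diag c v [EE i, EE j, EE k]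
         [([EE k], Cross i j, []), ([], Cross i k, [EE j]), ([EE i], Cross j k, [])])))
     (if i = k \<and> cdot c i j = - 1 then TScale (t i j) (TId [EE i, EE j, EE k] v)
      else TZero [EE i, EE j, EE k] [EE k, EE j, EE i] v (- cdot c i j - cdot c i k - cdot c j k))"
| mixed1: "i \<noteq> j \<Longrightarrow> urel c t b (diag c v [FF j, EE i] (sig i j @ sig' j i)) (TId [FF j, EE i] v)"
| mixed2: "i \<noteq> j \<Longrightarrow> urel c t b (diag c v [EE i, FF j] (sig' j i @ sig i j)) (TId [EE i, FF j] v)"
| cw_neg: "int m < coroot c i v - 1 \<Longrightarrow> urel c t b
     (cw c b i v (int m)) (TZero [] [] v (2 * (int m + 1 - coroot c i v)))"
| ccw_neg: "int m < - coroot c i v - 1 \<Longrightarrow> urel c t b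
     (ccw c b i v (int m)) (TZero [] [] v (2 * (int m + 1 + coroot c i v)))"
| cw_deg0: "coroot c i v \<ge> 1 \<Longrightarrow> urel c t b
     (cw c b i v (coroot c i v - 1)) (TScale (cplus b i v) (TId [] v))"
| ccw_deg0: "coroot c i v \<le> - 1 \<Longrightarrow> urel c t b
     (ccw c b i v (- coroot c i v - 1)) (TScale (cminus b i v) (TId [] v))"
| sl2_EF: "urel c t b
     (TId [EE i, FF i] v)
     (TAdd (TScale (beta b i) (diag c v [EE i, FF i] (sig' i i @ sig i i)))
       (TScale (- beta b i) (tsum [EE i, FF i] [EE i, FF i] v 0
         [TV (diag c v [] (replicate f3 ([], Dot i, [FF i]) @ [([], CupEF i, [])]))
           (TV (ccw c b i v (- coroot c i v - 1 + int f2))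
             (diag c v [EE i, FF i] ([([], CapEF i, [])] @ replicate f1 ([], Dot i, [FF i])))).
           (f1, f2, f3) \<leftarrow> triples (coroot c i v - 1)])))"
| sl2_FE: "urel c t b
     (TId [FF i, EE i] v)
     (TAdd (TScale (beta b i) (diag c v [FF i, EE i] (sig i i @ sig' i i)))
       (TScale (- beta b i) (tsum [FF i, EE i] [FF i, EE i] v 0
         [TV (diag c v [] (replicate f3 ([FF i], Dot i, []) @ [([], CupFE i, [])]))
           (TV (cw c b i v (coroot c i v - 1 + int f2))
             (diag c v [FF i, EE i] ([([], CapFE i, [])] @ replicate f1 ([FF i], Dot i, [])))).
           (f1, f2, f3) \<leftarrow> triples (- coroot c i v - 1)])))"

text \<open>The congruence on typed expressions generated by the defining relations and the axioms of a
  strict linear 2-category.  Both sides always have the same type, so no relation can be derived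
  through an ill-typed expression.  For a Cartan datum both sides of every instance of \<open>urel\<close> do have
  a common type, so the typing premises of \<open>eqv_rel\<close> exclude no relation.\<close>

inductive eqv ::
  "('i,'x::ab_group_add,'r) cartan \<Rightarrow> ('i \<Rightarrow> 'i \<Rightarrow> 'k::field) \<Rightarrow> ('i,'x,'k) bubble_params \<Rightarrow>
    ('i,'x,'k) tm \<Rightarrow> ('i,'x,'k) tm \<Rightarrow> bool"
  for c t b where
  eqv_rel: "urel c t b s s' \<Longrightarrow> typed c s w w' v d \<Longrightarrow> typed c s' w w' v d \<Longrightarrow> eqv c t b s s'"
| eqv_refl: "typed c s w w' v d \<Longrightarrow> eqv c t b s s"
| eqv_sym: "eqv c t b s s' \<Longrightarrow> eqv c t b s' s"
| eqv_trans: "eqv c t b s s' \<Longrightarrow> eqv c t b s' s'' \<Longrightarrow> eqv c t b s s''"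
| eqv_V: "eqv c t b s s' \<Longrightarrow> eqv c t b u u' \<Longrightarrow> typed c (TV s u) w w' v d \<Longrightarrow>
    eqv c t b (TV s u) (TV s' u')"
| eqv_H: "eqv c t b s s' \<Longrightarrow> eqv c t b u u' \<Longrightarrow> typed c (TH s u) w w' v d \<Longrightarrow>
    eqv c t b (TH s u) (TH s' u')"
| eqv_Add: "eqv c t b s s' \<Longrightarrow> eqv c t b u u' \<Longrightarrow> typed c (TAdd s u) w w' v d \<Longrightarrow>
    eqv c t b (TAdd s u) (TAdd s' u')"
| eqv_Scale: "eqv c t b s s' \<Longrightarrow> eqv c t b (TScale r s) (TScale r s')"
| V_assoc: "typed c (TV (TV s s') s'') w w' v d \<Longrightarrow> eqv c t b (TV (TV s s') s'') (TV s (TV s' s''))"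
| V_id: "typed c s w w' v d \<Longrightarrow> eqv c t b (TV s (TId w v)) s"
| id_V: "typed c s w w' v d \<Longrightarrow> eqv c t b (TV (TId w' v) s) s"
| H_assoc: "typed c (TH (TH s s') s'') w w' v d \<Longrightarrow> eqv c t b (TH (TH s s') s'') (TH s (TH s' s''))"
| H_unit: "typed c s w w' v d \<Longrightarrow> eqv c t b (TH s (TId [] v)) s"
| unit_H: "typed c s w w' v d \<Longrightarrow> eqv c t b (TH (TId [] (v + wwt c w)) s) s"
| H_id: "eqv c t b (TH (TId w (v + wwt c w')) (TId w' v)) (TId (w @ w') v)"
| V_H: "typed c (TV s s') w1 w1' (v + wwt c w2) d1 \<Longrightarrow> typed c (TV u u') w2 w2' v d2 \<Longrightarrow>
    eqv c t b (TH (TV s s') (TV u u')) (TV (TH s u) (TH s' u'))"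
| Add_assoc: "typed c (TAdd (TAdd s s') s'') w w' v d \<Longrightarrow>
    eqv c t b (TAdd (TAdd s s') s'') (TAdd s (TAdd s' s''))"
| Add_commute: "typed c (TAdd s s') w w' v d \<Longrightarrow> eqv c t b (TAdd s s') (TAdd s' s)"
| Add_zero: "typed c s w w' v d \<Longrightarrow> eqv c t b (TAdd s (TZero w w' v d)) s"
| Add_neg: "typed c s w w' v d \<Longrightarrow> eqv c t b (TAdd s (TScale (- 1) s)) (TZero w w' v d)"
| Scale_one: "typed c s w w' v d \<Longrightarrow> eqv c t b (TScale 1 s) s"
| Scale_Scale: "typed c s w w' v d \<Longrightarrow> eqv c t b (TScale r (TScale r' s)) (TScale (r * r') s)"
| Scale_Add: "typed c (TAdd s s') w w' v d \<Longrightarrow>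
    eqv c t b (TScale r (TAdd s s')) (TAdd (TScale r s) (TScale r s'))"
| add_Scale: "typed c s w w' v d \<Longrightarrow>
    eqv c t b (TScale (r + r') s) (TAdd (TScale r s) (TScale r' s))"
| V_Add_left: "typed c (TV (TAdd s s') u) w w' v d \<Longrightarrow>
    eqv c t b (TV (TAdd s s') u) (TAdd (TV s u) (TV s' u))"
| V_Add_right: "typed c (TV s (TAdd u u')) w w' v d \<Longrightarrow>
    eqv c t b (TV s (TAdd u u')) (TAdd (TV s u) (TV s u'))"
| V_Scale_left: "typed c (TV s u) w w' v d \<Longrightarrow> eqv c t b (TV (TScale r s) u) (TScale r (TV s u))"
| V_Scale_right: "typed c (TV s u) w w' v d \<Longrightarrow> eqv c t b (TV s (TScale r u)) (TScale r (TV s u))"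
| H_Add_left: "typed c (TH (TAdd s s') u) w w' v d \<Longrightarrow>
    eqv c t b (TH (TAdd s s') u) (TAdd (TH s u) (TH s' u))"
| H_Add_right: "typed c (TH s (TAdd u u')) w w' v d \<Longrightarrow>
    eqv c t b (TH s (TAdd u u')) (TAdd (TH s u) (TH s u'))"
| H_Scale_left: "typed c (TH s u) w w' v d \<Longrightarrow> eqv c t b (TH (TScale r s) u) (TScale r (TH s u))"
| H_Scale_right: "typed c (TH s u) w w' v d \<Longrightarrow> eqv c t b (TH s (TScale r u)) (TScale r (TH s u))"

text \<open>Homogeneous 2-morphisms of degree d between composites are classes of expressions.\<close>

type_synonym ('i, 'x, 'k) cell = "('i,'x,'k) tm set"

context
  fixes c :: "('i,'x::ab_group_add,'r) cartan"
    and t :: "'i \<Rightarrow> 'i \<Rightarrow> 'k::field"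
    and b :: "('i,'x,'k) bubble_params"
begin

definition cls :: "('i,'x,'k) tm \<Rightarrow> ('i,'x,'k) cell" where
  "cls s = {s'. eqv c t b s s'}"

definition cells :: "'i word \<Rightarrow> 'i word \<Rightarrow> 'x \<Rightarrow> int \<Rightarrow> ('i,'x,'k) cell set" where
  "cells w w' v d = {cls s | s. typed c s w w' v d}"

definition vcell :: "('i,'x,'k) cell \<Rightarrow> ('i,'x,'k) cell \<Rightarrow> ('i,'x,'k) cell" where
  "vcell X Y = (\<Union>s\<in>X. \<Union>u\<in>Y. cls (TV s u))"

definition hcell :: "('i,'x,'k) cell \<Rightarrow> ('i,'x,'k) cell \<Rightarrow> ('i,'x,'k) cell" where
  "hcell X Y = (\<Union>s\<in>X. \<Union>u\<in>Y. cls (TH s u))"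

definition add_cell :: "('i,'x,'k) cell \<Rightarrow> ('i,'x,'k) cell \<Rightarrow> ('i,'x,'k) cell" where
  "add_cell X Y = (\<Union>s\<in>X. \<Union>u\<in>Y. cls (TAdd s u))"

definition smult_cell :: "'k \<Rightarrow> ('i,'x,'k) cell \<Rightarrow> ('i,'x,'k) cell" where
  "smult_cell r X = (\<Union>s\<in>X. cls (TScale r s))"

end


section \<open>The 2-category\<close>

text \<open>A 1-morphism is a formal direct sum of shifted composites, given by the list of its summands;
  \<open>(s, w)\<close> stands for the s-fold shift of w.  Source and target are recorded since the list may be
  empty.  A 2-morphism is a matrix of cells, where a map from the s-fold shift of w to the s'-fold
  shift of w' is a cell of degree \<open>s' - s\<close>.  Entries outside the matrix are the empty set, so that
  equality of 2-morphisms is equality of their entries.\<close>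

datatype ('i, 'x) mor1 = OneMor (dom1: 'x) (cod1: 'x) (summands: "(int \<times> 'i word) list")

datatype ('i, 'x, 'k) mor2 =
  TwoMor (dom2: "('i,'x) mor1") (cod2: "('i,'x) mor1") (entry: "nat \<Rightarrow> nat \<Rightarrow> ('i,'x,'k) cell")

definition nsum :: "('i,'x) mor1 \<Rightarrow> nat" where
  "nsum f = length (summands f)"

definition U1 :: "('i,'x::ab_group_add,'r) cartan \<Rightarrow> ('i,'x) mor1 set" where
  "U1 c = {f. \<forall>(s, w) \<in> set (summands f). cod1 f = dom1 f + wwt c w}"

fun Ucomp1 :: "('i,'x) mor1 \<Rightarrow> ('i,'x) mor1 \<Rightarrow> ('i,'x) mor1" where
  "Ucomp1 (OneMor v' v'' gs) (OneMor v w fs) = OneMor v v'' [(s' + s, z' @ z). (s', z') \<leftarrow> gs, (s, z) \<leftarrow> fs]"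

fun Ushift1 :: "int \<Rightarrow> ('i,'x) mor1 \<Rightarrow> ('i,'x) mor1" where
  "Ushift1 n (OneMor v v' fs) = OneMor v v' [(s + n, w). (s, w) \<leftarrow> fs]"

text \<open>The matrix with entries \<open>e k l\<close>, row k referring to the codomain and column l to the domain.\<close>

definition matrix2 ::
  "('i,'x) mor1 \<Rightarrow> ('i,'x) mor1 \<Rightarrow> (nat \<Rightarrow> nat \<Rightarrow> ('i,'x,'k) cell) \<Rightarrow> ('i,'x,'k) mor2" where
  "matrix2 f g e = TwoMor f g (\<lambda>k l. if k < nsum g \<and> l < nsum f then e k l else {})"

context
  fixes c :: "('i,'x::ab_group_add,'r) cartan"
    and t :: "'i \<Rightarrow> 'i \<Rightarrow> 'k::field"
    and b :: "('i,'x,'k) bubble_params"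
begin

definition entry_cells :: "('i,'x) mor1 \<Rightarrow> ('i,'x) mor1 \<Rightarrow> nat \<Rightarrow> nat \<Rightarrow> ('i,'x,'k) cell set" where
  "entry_cells f g k l =
     (case (summands f ! l, summands g ! k) of
       ((s, w), (s', w')) \<Rightarrow> cells c t b w w' (dom1 f) (s' - s))"

definition zero_entry :: "('i,'x) mor1 \<Rightarrow> ('i,'x) mor1 \<Rightarrow> nat \<Rightarrow> nat \<Rightarrow> ('i,'x,'k) cell" where
  "zero_entry f g k l =
     (case (summands f ! l, summands g ! k) of
       ((s, w), (s', w')) \<Rightarrow> cls c t b (TZero w w' (dom1 f) (s' - s)))"

definition id_entry :: "('i,'x) mor1 \<Rightarrow> nat \<Rightarrow> ('i,'x,'k) cell" where
  "id_entry f k = cls c t b (TId (snd (summands f ! k)) (dom1 f))"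

definition U2 :: "('i,'x,'k) mor2 set" where
  "U2 = {matrix2 f g e | f g e. f \<in> U1 c \<and> g \<in> U1 c \<and> dom1 f = dom1 g \<and> cod1 f = cod1 g \<and>
     (\<forall>k < nsum g. \<forall>l < nsum f. e k l \<in> entry_cells f g k l)}"

definition Uid2 :: "('i,'x) mor1 \<Rightarrow> ('i,'x,'k) mor2" where
  "Uid2 f = matrix2 f f (\<lambda>k l. if k = l then id_entry f k else zero_entry f f k l)"

definition Uvcomp :: "('i,'x,'k) mor2 \<Rightarrow> ('i,'x,'k) mor2 \<Rightarrow> ('i,'x,'k) mor2" where
  "Uvcomp A B = matrix2 (dom2 B) (cod2 A) (\<lambda>k l.
     foldr (add_cell c t b) (map (\<lambda>r. vcell c t b (entry A k r) (entry B r l)) [0..<nsum (dom2 A)])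
       (zero_entry (dom2 B) (cod2 A) k l))"

text \<open>The summands of \<open>Ucomp1 g f\<close> are ordered lexicographically: the one with number \<open>k * nsum f + l\<close> is
  the composite of summand k of g and summand l of f.\<close>

definition Uhcomp :: "('i,'x,'k) mor2 \<Rightarrow> ('i,'x,'k) mor2 \<Rightarrow> ('i,'x,'k) mor2" where
  "Uhcomp A B = matrix2 (Ucomp1 (dom2 A) (dom2 B)) (Ucomp1 (cod2 A) (cod2 B)) (\<lambda>k l.
     hcell c t b (entry A (k div nsum (cod2 B)) (l div nsum (dom2 B)))
                 (entry B (k mod nsum (cod2 B)) (l mod nsum (dom2 B))))"

definition Ucat :: "('x, ('i,'x) mor1, ('i,'x,'k) mor2, 'k) twocat" where
  "Ucat = \<lparr>
     Obj = UNIV,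
     Mor1 = U1 c, src1 = dom1, tgt1 = cod1,
     id1 = (\<lambda>v. OneMor v v [(0, [])]), comp1 = Ucomp1,
     Mor2 = U2, src2 = dom2, tgt2 = cod2,
     id2 = Uid2, vcomp = Uvcomp, hcomp = Uhcomp,
     zero2 = (\<lambda>f g. matrix2 f g (zero_entry f g)),
     add2 = (\<lambda>A B. matrix2 (dom2 A) (cod2 A) (\<lambda>k l. add_cell c t b (entry A k l) (entry B k l))),
     smult2 = (\<lambda>r A. matrix2 (dom2 A) (cod2 A) (\<lambda>k l. smult_cell c t b r (entry A k l))),
     shift1 = Ushift1,
     shift2 = (\<lambda>n A. TwoMor (Ushift1 n (dom2 A)) (Ushift1 n (cod2 A)) (entry A))\<rparr>"

text \<open>The generator g at weight v, as a 2-morphism with unshifted domain.\<close>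

definition Ugen :: "'i gen \<Rightarrow> 'x \<Rightarrow> ('i,'x,'k) mor2" where
  "Ugen g v = matrix2 (OneMor v (v + wwt c (gdom g)) [(0, gdom g)])
     (OneMor v (v + wwt c (gdom g)) [(gdeg c g v, gcod g)]) (\<lambda>_ _. cls c t b (TGen g v))"

text \<open>Inclusion of, and projection to, the n-th summand of a formal direct sum.\<close>

definition Uincl :: "('i,'x) mor1 \<Rightarrow> nat \<Rightarrow> ('i,'x,'k) mor2" where
  "Uincl f n = (let fn = OneMor (dom1 f) (cod1 f) [summands f ! n] in
     matrix2 fn f (\<lambda>k l. if k = n then id_entry f n else zero_entry fn f k l))"

definition Uproj :: "('i,'x) mor1 \<Rightarrow> nat \<Rightarrow> ('i,'x,'k) mor2" where
  "Uproj f n = (let fn = OneMor (dom1 f) (cod1 f) [summands f ! n] in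
     matrix2 f fn (\<lambda>k l. if l = n then id_entry f n else zero_entry f fn k l))"

end

end

theory Submission
  imports Defs
begin

text \<open>
  Rescaling the generators multiplies a diagram by the product of the scalars of its dots and
  crossings, so every defining relation for \<open>(t, b)\<close> goes to a multiple of the corresponding relation
  for \<open>(t', b')\<close> as soon as the parameters absorb the difference: a bubble with \<open>m\<close> dots scales by
  the \<open>m\<close>-th power of \<open>D i\<close>, also when it is fake, because the recursion defining fake bubbles is
  homogeneous.  The inverse functor is the rescaling by the inverses of the \<open>D i\<close>, which takes
  \<open>(t', b')\<close> back to \<open>(t, b)\<close> up to the irrelevant diagonal entries of \<open>t\<close>.
\<close>


section \<open>Typing\<close>

text \<open>The hatted parameters are forced by comparing factors. In the \<open>sl2\<close>
  relations the composite of two sideways crossings contains two crossings of equal colour, hence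
  the factor \<open>D i powi (- 2)\<close>, which moves into \<open>beta\<close>. The bubble terms
  then have to carry the same factor, and they do because their dots, fake ones counted negatively,
  always add up to -2. A bubble of degree 0 has \<open>coroot c i v - 1\<close> or
  \<open>- coroot c i v - 1\<close> dots, and \<open>cplus\<close> and \<open>cminus\<close> take
  the inverse powers. The quadratic relation for adjacent colours has unscaled crossings on one side
  and a single dot in each term on the other, which gives \<open>D i * t i j\<close>.

  The bulk of the work lies elsewhere. 2-morphisms are matrices of classes of raw expressions modulo
  a typed congruence, and an isomorphism of 2-categories includes all axioms of a graded additive
  2-category for such matrices. These hold for every \<open>t\<close> and \<open>b\<close>, since
  they rest on the structural rules of the congruence; the content of the defining relations enters
  only when rescaling is shown to respect classes.\<close>

inductive_cases typed_TGenE: "typed c (TGen g u) w w' v d"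
inductive_cases typed_TIdE: "typed c (TId z u) w w' v d"
inductive_cases typed_TVE: "typed c (TV s u) w w' v d"
inductive_cases typed_THE: "typed c (TH s u) w w' v d"
inductive_cases typed_TZeroE: "typed c (TZero z z' u e) w w' v d"
inductive_cases typed_TAddE: "typed c (TAdd s u) w w' v d"
inductive_cases typed_TScaleE: "typed c (TScale r s) w w' v d"

lemma typed_TGen [simp]:
  "typed c (TGen g u) w w' v d \<longleftrightarrow> w = gdom g \<and> w' = gcod g \<and> v = u \<and> d = gdeg c g u"
  by (auto elim: typed_TGenE intro: typed.intros)

lemma typed_TId [simp]: "typed c (TId z u) w w' v d \<longleftrightarrow> w = z \<and> w' = z \<and> v = u \<and> d = 0"
  by (auto elim: typed_TIdE intro: typed.intros)

lemma typed_TZero [simp]: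
  "typed c (TZero z z' u e) w w' v d \<longleftrightarrow> w = z \<and> w' = z' \<and> v = u \<and> d = e \<and> wwt c z = wwt c z'"
  by (auto elim: typed_TZeroE intro: typed.intros)

lemma typed_TAdd [simp]:
  "typed c (TAdd s u) w w' v d \<longleftrightarrow> typed c s w w' v d \<and> typed c u w w' v d"
  by (auto elim: typed_TAddE intro: typed.intros)

lemma typed_TScale [simp]: "typed c (TScale r s) w w' v d \<longleftrightarrow> typed c s w w' v d"
  by (auto elim: typed_TScaleE intro: typed.intros)

lemma typed_TV:
  "typed c (TV s u) w w' v d \<longleftrightarrow>
    (\<exists>z d1 d2. typed c s z w' v d1 \<and> typed c u w z v d2 \<and> d = d1 + d2)"
  by (blast elim: typed_TVE intro: typed.intros)

lemma typed_TH:
  "typed c (TH s u) w w' v d \<longleftrightarrow>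
    (\<exists>x x' z z' d1 d2. typed c s x x' (v + wwt c z) d1 \<and> typed c u z z' v d2 \<and>
      w = x @ z \<and> w' = x' @ z' \<and> d = d1 + d2)"
  by (blast elim: typed_THE intro: typed.intros)

lemma typed_TVI:
  "typed c s z w' v d1 \<Longrightarrow> typed c u w z v d2 \<Longrightarrow> d = d1 + d2 \<Longrightarrow> typed c (TV s u) w w' v d"
  by (auto simp: typed_TV)

lemma typed_THI:
  "typed c s x x' y d1 \<Longrightarrow> typed c u z z' v d2 \<Longrightarrow> y = v + wwt c z \<Longrightarrow> d = d1 + d2 \<Longrightarrow>
    typed c (TH s u) (x @ z) (x' @ z') v d"
  by (blast intro: typed.intros)

text \<open>Uniqueness is what lets a class of expressions have one type. In a horizontal composite
  the right factor comes first, because its word \<open>z\<close> determines the weight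
  \<open>v + wwt c z\<close> of the left one.\<close>

lemma typed_unique:
  "typed c s w w' v d \<Longrightarrow> typed c s x x' y e \<Longrightarrow> x = w \<and> x' = w' \<and> y = v \<and> e = d"
proof (induction arbitrary: x x' y e rule: typed.induct)
  case (3 s w' w'' v d s' w d')
  from 3(5) obtain z d1 d2 where *: "typed c s z x' y d1" "typed c s' x z y d2" "e = d1 + d2"
    unfolding typed_TV by blast
  with 3(3)[OF *(1)] 3(4)[OF *(2)] show ?case by simp
next
  case (4 s w w' v z d s' z' d')
  from 4(5) obtain p p' q q' d1 d2 where *: "typed c s p p' (y + wwt c q) d1" "typed c s' q q' y d2"
     "x = p @ q" "x' = p' @ q'" "e = d1 + d2"
    unfolding typed_TH by blast
  have **: "q = z \<and> q' = z' \<and> y = v \<and> d2 = d'" by (rule 4(4)[OF *(2)])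
  with 4(3)[of p p' _ d1] *(1) have "p = w \<and> p' = w' \<and> d1 = d" by simp
  with * ** show ?case by simp
next
  case (6 s w w' v d s')
  from 6(5) have "typed c s x x' y e" by simp
  then show ?case by (rule 6(3))
next
  case (7 s w w' v d r)
  from 7(3) have "typed c s x x' y e" by simp
  then show ?case by (rule 7(2))
qed simp_all

lemma wwt_Nil [simp]: "wwt c [] = 0"
  and wwt_Cons [simp]: "wwt c (a # w) = lwt c a + wwt c w"
  and wwt_append [simp]: "wwt c (w @ w') = wwt c w + wwt c w'"
  by (simp_all add: wwt_def)

text \<open>Dots and crossings keep the letters up to order, cups and caps create or remove a pair
  of opposite letters, and zeros carry the condition in their typing rule. Consequently replacing
  the word to the right of a factor by an equivalent one leaves the weight of that factor
  unchanged.\<close>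

lemma typed_wwt: "typed c s w w' v d \<Longrightarrow> wwt c w = wwt c w'"
proof (induction rule: typed.induct)
  case (1 g v)
  then show ?case by (cases g) (simp_all add: add.commute)
qed simp_all

lemma same_type_transfer:
  assumes "\<exists>w w' v d. typed c s w w' v d \<and> typed c s' w w' v d" "typed c s w w' v d"
  shows "typed c s' w w' v d"
proof -
  from assms(1) obtain x x' y e where "typed c s x x' y e" "typed c s' x x' y e" by blast
  with typed_unique[OF assms(2) this(1)] show ?thesis by simp
qed

text \<open>The congruence rules for composites and sums type only the left side; the type of the
  right side is obtained here, by transferring types through the premises.\<close>

lemma eqv_same_type: "eqv c t b s s' \<Longrightarrow> \<exists>w w' v d. typed c s w w' v d \<and> typed c s' w w' v d"
proof (induction rule: eqv.induct)
  case (eqv_trans s s' s'')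
  then show ?case using same_type_transfer[OF eqv_trans.IH(2)] by blast
next
  case (eqv_V s s' u u' w w' v d)
  from eqv_V.hyps(3) obtain z d1 d2 where
    *: "typed c s z w' v d1" "typed c u w z v d2" "d = d1 + d2"
    unfolding typed_TV by blast
  have "typed c (TV s' u') w w' v d"
    using same_type_transfer[OF eqv_V.IH(1) *(1)] same_type_transfer[OF eqv_V.IH(2) *(2)] *(3)
    by (rule typed_TVI)
  with eqv_V.hyps(3) show ?case by blast
next
  case (eqv_H s s' u u' w w' v d)
  from eqv_H.hyps(3) obtain x x' z z' d1 d2 where
    *: "typed c s x x' (v + wwt c z) d1" "typed c u z z' v d2" and
    eq: "w = x @ z" "w' = x' @ z'" "d = d1 + d2"
    unfolding typed_TH by blast
  have "typed c (TH s' u') w w' v d"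
    unfolding eq
    by (rule typed_THI[OF same_type_transfer[OF eqv_H.IH(1) *(1)] same_type_transfer[OF eqv_H.IH(2) *(2)]])
      simp_all
  with eqv_H.hyps(3) show ?case by blast
next
  case (eqv_Add s s' u u' w w' v d)
  from eqv_Add.hyps(3) have *: "typed c s w w' v d" "typed c u w w' v d" by simp_all
  have "typed c (TAdd s' u') w w' v d"
    using same_type_transfer[OF eqv_Add.IH(1) *(1)] same_type_transfer[OF eqv_Add.IH(2) *(2)]
    by simp
  with eqv_Add.hyps(3) show ?case by blast
next
  case (eqv_Scale s s' r)
  then show ?case by auto
next
  case (V_assoc s s' s'' w w' v d)
  then obtain z1 z2 d1 d2 d3 where "typed c s z2 w' v d1" "typed c s' z1 z2 v d2"
    "typed c s'' w z1 v d3" "d = d1 + d2 + d3"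
    unfolding typed_TV by blast
  then have "typed c (TV s (TV s' s'')) w w' v d"
    by (auto intro!: typed_TVI)
  with V_assoc show ?case by blast
next
  case (V_id s w w' v d)
  moreover then have "typed c (TV s (TId w v)) w w' v d" by (auto intro: typed_TVI)
  ultimately show ?case by blast
next
  case (id_V s w w' v d)
  moreover then have "typed c (TV (TId w' v) s) w w' v d" by (auto intro: typed_TVI)
  ultimately show ?case by blast
next
  case (H_assoc s s' s'' w w' v d)
  then obtain x1 y1 x2 y2 x3 y3 d1 d2 d3 where *:
    "typed c s x1 y1 (v + wwt c x3 + wwt c x2) d1" "typed c s' x2 y2 (v + wwt c x3) d2"
    "typed c s'' x3 y3 v d3" "w = (x1 @ x2) @ x3" "w' = (y1 @ y2) @ y3" "d = d1 + d2 + d3"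
    unfolding typed_TH by blast
  have "typed c (TH s (TH s' s'')) (x1 @ x2 @ x3) (y1 @ y2 @ y3) v (d1 + (d2 + d3))"
    by (rule typed_THI[OF *(1) typed_THI[OF *(2,3)]]) (simp_all add: algebra_simps)
  then have "typed c (TH s (TH s' s'')) w w' v d"
    using * by (simp add: add.assoc)
  with H_assoc show ?case by blast
next
  case (H_unit s w w' v d)
  then have "typed c (TH s (TId [] v)) (w @ []) (w' @ []) v d"
    by (intro typed_THI) (auto simp: typed_wwt)
  with H_unit show ?case by auto
next
  case (unit_H s w w' v d)
  then have "typed c (TH (TId [] (v + wwt c w)) s) ([] @ w) ([] @ w') v d"
    by (intro typed_THI) auto
  with unit_H show ?case by auto
next
  case (H_id w v w')
  have "typed c (TH (TId w (v + wwt c w')) (TId w' v)) (w @ w') (w @ w') v 0"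
    by (auto intro: typed_THI)
  then show ?case by (metis typed_TId)
next
  case (V_H s s' w1 w1' v w2 d1 u u' w2' d2)
  from V_H(1) obtain z1 e1 f1 where 1: "typed c s z1 w1' (v + wwt c w2) e1"
    "typed c s' w1 z1 (v + wwt c w2) f1" "d1 = e1 + f1" unfolding typed_TV by blast
  from V_H(2) obtain z2 e2 f2 where 2: "typed c u z2 w2' v e2"
    "typed c u' w2 z2 v f2" "d2 = e2 + f2" unfolding typed_TV by blast
  have "typed c (TH (TV s s') (TV u u')) (w1 @ w2) (w1' @ w2') v (d1 + d2)"
    by (rule typed_THI[OF V_H]) simp_all
  \<comment> \<open>\<open>u\<close> starts at \<open>z2\<close> rather than at \<open>w2\<close>;
    the weights agree because \<open>u'\<close> runs between these two words.\<close>
  moreover have "typed c (TH s u) (z1 @ z2) (w1' @ w2') v (e1 + e2)"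
    using 1 2 typed_wwt[OF 2(2)] by (intro typed_THI[of _ _ _ _ "v + wwt c w2"]) auto
  moreover have "typed c (TH s' u') (w1 @ w2) (z1 @ z2) v (f1 + f2)"
    using 1 2 by (intro typed_THI) auto
  then have "typed c (TV (TH s u) (TH s' u')) (w1 @ w2) (w1' @ w2') v (d1 + d2)"
    using calculation 1 2 by (intro typed_TVI[of _ _ "z1 @ z2" _ _ "e1 + e2" _ _ "f1 + f2"]) auto
  ultimately show ?case by blast
next
  case (Add_zero s w w' v d)
  then show ?case by (auto dest: typed_wwt)
next
  case (Add_neg s w w' v d)
  then show ?case by (auto dest: typed_wwt)
next
  case (V_Add_left s s' u w w' v d)
  then show ?case unfolding typed_TV typed_TAdd typed_TScale by blast
next
  case (V_Scale_left s u w w' v d r)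
  then show ?case unfolding typed_TV typed_TAdd typed_TScale by blast
next
  case (V_Add_right s u u' w w' v d)
  then show ?case unfolding typed_TV typed_TAdd typed_TScale by blast
next
  case (V_Scale_right s u w w' v d r)
  then show ?case unfolding typed_TV typed_TAdd typed_TScale by blast
next
  case (H_Add_left s s' u w w' v d)
  then show ?case unfolding typed_TH typed_TAdd typed_TScale by blast
next
  case (H_Scale_left s u w w' v d r)
  then show ?case unfolding typed_TH typed_TAdd typed_TScale by blast
next
  case (H_Add_right s u u' w w' v d)
  then show ?case unfolding typed_TH typed_TAdd typed_TScale by blast
next
  case (H_Scale_right s u w w' v d r)
  then show ?case unfolding typed_TH typed_TAdd typed_TScale by blast
next
  case (eqv_rel s s' w w' v d)
  then show ?case unfolding typed_TAdd typed_TScale by blast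
next
  case (eqv_refl s w w' v d)
  then show ?case by blast
next
  case (eqv_sym s s')
  then show ?case by blast
next
  case (Add_assoc s s' s'' w w' v d)
  then show ?case unfolding typed_TAdd typed_TScale by blast
next
  case (Add_commute s s' w w' v d)
  then show ?case unfolding typed_TAdd typed_TScale by blast
next
  case (Scale_one s w w' v d)
  then show ?case unfolding typed_TAdd typed_TScale by blast
next
  case (Scale_Scale s w w' v d r r')
  then show ?case unfolding typed_TAdd typed_TScale by blast
next
  case (Scale_Add s s' w w' v d r)
  then show ?case unfolding typed_TAdd typed_TScale by blast
next
  case (add_Scale s w w' v d r r')
  then show ?case unfolding typed_TAdd typed_TScale by blast
qed

lemma eqv_typed: "eqv c t b s s' \<Longrightarrow> typed c s w w' v d \<Longrightarrow> typed c s' w w' v d"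
  by (rule same_type_transfer[OF eqv_same_type])


section \<open>Finite sums in a commutative monoid on a carrier\<close>

lemma foldr_map_cong:
  "(\<And>x. x \<in> set xs \<Longrightarrow> f x = g x) \<Longrightarrow> foldr h (map f xs) z = foldr h (map g xs) z"
  by (metis map_cong)

text \<open>Cells of one type form a commutative monoid inside the set of all cells, with a zero
  that depends on the type. Finite sums are therefore folds over lists, relative to an explicit
  carrier and zero.\<close>

locale carrier_comm_monoid =
  fixes M :: "'a set" and add :: "'a \<Rightarrow> 'a \<Rightarrow> 'a" and zero :: 'a
  assumes zero_closed: "zero \<in> M"
    and add_closed: "x \<in> M \<Longrightarrow> y \<in> M \<Longrightarrow> add x y \<in> M"
    and assoc: "x \<in> M \<Longrightarrow> y \<in> M \<Longrightarrow> z \<in> M \<Longrightarrow> add (add x y) z = add x (add y z)"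
    and commute: "x \<in> M \<Longrightarrow> y \<in> M \<Longrightarrow> add x y = add y x"
    and right_zero: "x \<in> M \<Longrightarrow> add x zero = x"
begin

abbreviation lsum :: "('b \<Rightarrow> 'a) \<Rightarrow> 'b list \<Rightarrow> 'a" where
  "lsum f xs \<equiv> foldr add (map f xs) zero"

lemma left_zero: "x \<in> M \<Longrightarrow> add zero x = x"
  using commute right_zero zero_closed by metis

lemma interchange_add:
  assumes "x \<in> M" "y \<in> M" "z \<in> M" "w \<in> M"
  shows "add (add x y) (add z w) = add (add x z) (add y w)"
proof -
  have "add y (add z w) = add z (add y w)"
    using assms assoc commute by metis
  then show ?thesis using assms by (simp add: assoc add_closed)
qed

lemma lsum_closed: "(\<And>x. x \<in> set xs \<Longrightarrow> f x \<in> M) \<Longrightarrow> lsum f xs \<in> M"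
  by (induction xs) (simp_all add: zero_closed add_closed)

lemma lsum_append:
  "(\<And>x. x \<in> set xs \<union> set ys \<Longrightarrow> f x \<in> M) \<Longrightarrow> lsum f (xs @ ys) = add (lsum f xs) (lsum f ys)"
proof (induction xs)
  case Nil
  then show ?case using left_zero lsum_closed[of ys f] by simp
next
  case (Cons x xs)
  then have "lsum f xs \<in> M" "lsum f ys \<in> M" by (auto intro!: lsum_closed)
  with Cons show ?case by (simp add: assoc)
qed

lemma lsum_add:
  "(\<And>x. x \<in> set xs \<Longrightarrow> f x \<in> M) \<Longrightarrow> (\<And>x. x \<in> set xs \<Longrightarrow> g x \<in> M) \<Longrightarrow>
    lsum (\<lambda>x. add (f x) (g x)) xs = add (lsum f xs) (lsum g xs)"
proof (induction xs)
  case (Cons x xs)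
  then have "lsum f xs \<in> M" "lsum g xs \<in> M" by (auto intro!: lsum_closed)
  with Cons show ?case by (simp add: interchange_add)
qed (simp add: right_zero zero_closed)

lemma lsum_zero: "(\<And>x. x \<in> set xs \<Longrightarrow> f x = zero) \<Longrightarrow> lsum f xs = zero"
  by (induction xs) (simp_all add: zero_closed right_zero)

lemma lsum_swap:
  "(\<And>x y. x \<in> set xs \<Longrightarrow> y \<in> set ys \<Longrightarrow> f x y \<in> M) \<Longrightarrow>
    lsum (\<lambda>x. lsum (f x) ys) xs = lsum (\<lambda>y. lsum (\<lambda>x. f x y) xs) ys"
proof (induction xs)
  case Nil
  show ?case using lsum_zero[of ys "\<lambda>_. zero"] by simp
next
  case (Cons x xs)
  then have "lsum (\<lambda>y. add (f x y) (lsum (\<lambda>x. f x y) xs)) ys =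
      add (lsum (f x) ys) (lsum (\<lambda>y. lsum (\<lambda>x. f x y) xs) ys)"
    by (intro lsum_add lsum_closed) auto
  with Cons show ?case by simp
qed

text \<open>This is how a row or column with a single identity entry selects one term of a matrix
  product.\<close>

lemma lsum_single:
  assumes "distinct xs" "k \<in> set xs" "f k \<in> M" "\<And>x. x \<in> set xs \<Longrightarrow> x \<noteq> k \<Longrightarrow> f x = zero"
  shows "lsum f xs = f k"
  using assms
proof (induction xs)
  case (Cons x xs)
  show ?case
  proof (cases "x = k")
    case True
    with Cons have "lsum f xs = zero" by (intro lsum_zero) auto
    with True Cons show ?thesis by (simp add: right_zero)
  next
    case False
    with Cons show ?thesis by (simp add: left_zero)
  qed
qed simp

text \<open>A sum over the summands of a composite 1-morphism is a double sum, since these are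
  numbered lexicographically by \<open>r * n + s\<close>.\<close>

lemma lsum_div_mod:
  assumes "\<And>r s. r < m \<Longrightarrow> s < n \<Longrightarrow> f r s \<in> M"
  shows "lsum (\<lambda>p. f (p div n) (p mod n)) [0..<m * n] = lsum (\<lambda>r. lsum (f r) [0..<n]) [0..<m]"
  using assms
proof (induction m)
  case (Suc m)
  have *: "p div n < Suc m" "p mod n < n" if "p < Suc m * n" for p
    using that by (cases n; simp add: less_mult_imp_div_less del: mult_Suc)+
  \<comment> \<open>The last block of \<open>n\<close> indices is the row
    \<open>r = m\<close>.\<close>
  have "[0..<Suc m * n] = [0..<m * n] @ map (\<lambda>s. m * n + s) [0..<n]"
    using upt_add_eq_append[of 0 "m * n" n] map_add_upt[of "m * n" n] by (simp add: add.commute)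
  moreover have "lsum (\<lambda>p. f (p div n) (p mod n)) (map (\<lambda>s. m * n + s) [0..<n]) = lsum (f m) [0..<n]"
    unfolding map_map by (rule foldr_map_cong) auto
  moreover have "lsum (\<lambda>p. f (p div n) (p mod n)) ([0..<m * n] @ map (\<lambda>s. m * n + s) [0..<n]) =
      add (lsum (\<lambda>p. f (p div n) (p mod n)) [0..<m * n])
        (lsum (\<lambda>p. f (p div n) (p mod n)) (map (\<lambda>s. m * n + s) [0..<n]))"
    using * by (intro lsum_append) (auto intro!: Suc.prems)
  moreover have "add (lsum (\<lambda>r. lsum (f r) [0..<n]) [0..<m]) (lsum (f m) [0..<n]) =
      lsum (\<lambda>r. lsum (f r) [0..<n]) ([0..<m] @ [m])"
    using Suc.prems lsum_closed[of "[0..<n]" "f m"]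
    by (subst lsum_append) (auto intro!: lsum_closed simp: right_zero)
  ultimately show ?case
    using Suc by (simp del: map_map mult_Suc)
qed simp

text \<open>The target is given only by its operations, so that one lemma serves composition with a
  fixed cell, scalar multiplication and the passage to the cells of other parameters.\<close>

lemma lsum_hom:
  assumes "h zero = zero'" "\<And>x y. x \<in> M \<Longrightarrow> y \<in> M \<Longrightarrow> h (add x y) = add' (h x) (h y)"
    "\<And>x. x \<in> set xs \<Longrightarrow> f x \<in> M"
  shows "h (lsum f xs) = foldr add' (map (\<lambda>x. h (f x)) xs) zero'"
  using assms(3) by (induction xs) (simp_all add: assms(1,2) lsum_closed)

end


section \<open>Direct sums of 1-morphisms\<close>

lemma dom1_Ucomp1 [simp]: "dom1 (Ucomp1 g f) = dom1 f"
  and cod1_Ucomp1 [simp]: "cod1 (Ucomp1 g f) = cod1 g"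
  by (cases g; cases f; simp)+

lemma summands_Ucomp1:
  "summands (Ucomp1 g f) =
    map (\<lambda>((s', z'), (s, z)). (s' + s, z' @ z)) (List.product (summands g) (summands f))"
  by (cases g; cases f) (simp add: product_concat_map map_concat comp_def case_prod_unfold)

lemma nsum_Ucomp1 [simp]: "nsum (Ucomp1 g f) = nsum g * nsum f"
  by (simp add: nsum_def summands_Ucomp1)

text \<open>\<open>List.product\<close> enumerates pairs lexicographically, whence the quotient and
  the remainder by \<open>nsum f\<close>; the summand of \<open>g\<close> is the leading
  digit.\<close>

lemma nth_Ucomp1:
  assumes "p < nsum g * nsum f"
  shows "fst (summands (Ucomp1 g f) ! p) =
      fst (summands g ! (p div nsum f)) + fst (summands f ! (p mod nsum f))"
    and "snd (summands (Ucomp1 g f) ! p) =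
      snd (summands g ! (p div nsum f)) @ snd (summands f ! (p mod nsum f))"
  using assms by (simp_all add: summands_Ucomp1 nsum_def product_nth split_beta)

lemma dom1_Ushift1 [simp]: "dom1 (Ushift1 n f) = dom1 f"
  and cod1_Ushift1 [simp]: "cod1 (Ushift1 n f) = cod1 f"
  by (cases f; simp)+

lemma summands_Ushift1: "summands (Ushift1 n f) = map (\<lambda>(s, w). (s + n, w)) (summands f)"
  by (cases f) simp

lemma nsum_Ushift1 [simp]: "nsum (Ushift1 n f) = nsum f"
  by (simp add: nsum_def summands_Ushift1)

lemma nth_Ushift1:
  assumes "p < nsum f"
  shows "fst (summands (Ushift1 n f) ! p) = fst (summands f ! p) + n"
    and "snd (summands (Ushift1 n f) ! p) = snd (summands f ! p)"
  using assms by (simp_all add: summands_Ushift1 nsum_def split_beta)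

lemma Ushift1_0: "Ushift1 0 f = f"
  by (cases f) simp

lemma Ushift1_Ushift1: "Ushift1 m (Ushift1 n f) = Ushift1 (m + n) f"
  by (cases f) (auto simp: algebra_simps)

lemma Ucomp1_Ushift1: "Ucomp1 (Ushift1 m g) (Ushift1 n f) = Ushift1 (m + n) (Ucomp1 g f)"
  by (cases g; cases f) (simp add: map_concat comp_def case_prod_unfold algebra_simps)

lemma concat_map_concat_map:
  "concat (map F (concat (map G xs))) = concat (map (\<lambda>x. concat (map F (G x))) xs)"
  by (induction xs) simp_all

lemma concat_concat: "concat (concat xss) = concat (map concat xss)"
  by (induction xss) simp_all

text \<open>The lexicographic enumeration of triples does not depend on the bracketing, so
  composition of formal sums is strictly associative and not merely up to a permutation of
  summands.\<close>

lemma Ucomp1_assoc: "Ucomp1 (Ucomp1 h g) f = Ucomp1 h (Ucomp1 g f)"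
  by (cases h; cases g; cases f)
    (simp add: concat_map_concat_map concat_concat map_concat comp_def case_prod_unfold add.assoc)

lemma nth_split_div_mod:
  fixes p m n :: nat
  assumes "p < m * n"
  shows "p div n < m" "p mod n < n"
  using assms by (simp_all add: less_mult_imp_div_less) (cases n; simp)

lemma U1_cod: "f \<in> U1 c \<Longrightarrow> l < nsum f \<Longrightarrow> cod1 f = dom1 f + wwt c (snd (summands f ! l))"
  unfolding U1_def nsum_def using nth_mem by fastforce

lemma entry_matrix2 [simp]: "k < nsum g \<Longrightarrow> l < nsum f \<Longrightarrow> entry (matrix2 f g e) k l = e k l"
  and dom2_matrix2 [simp]: "dom2 (matrix2 f g e) = f"
  and cod2_matrix2 [simp]: "cod2 (matrix2 f g e) = g"
  by (simp_all add: matrix2_def)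

lemma entry_matrix2_outside: "\<not> (k < nsum g \<and> l < nsum f) \<Longrightarrow> entry (matrix2 f g e) k l = {}"
  by (auto simp add: matrix2_def)

lemma Ucomp1_in: "f \<in> U1 c \<Longrightarrow> g \<in> U1 c \<Longrightarrow> cod1 f = dom1 g \<Longrightarrow> Ucomp1 g f \<in> U1 c"
  by (fastforce simp: U1_def summands_Ucomp1 algebra_simps)

lemma Ushift1_in: "f \<in> U1 c \<Longrightarrow> Ushift1 n f \<in> U1 c"
  by (fastforce simp: U1_def summands_Ushift1)

lemma Ucomp1_unit: "Ucomp1 f (OneMor (dom1 f) (dom1 f) [(0, [])]) = f"
  and unit_Ucomp1: "Ucomp1 (OneMor (cod1 f) (cod1 f) [(0, [])]) f = f"
  by (cases f; simp add: case_prod_unfold concat_map_singleton)+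

text \<open>Middle and last digit of a three-digit number in mixed radix, as they occur in triple
  composites.\<close>

lemma mod_mult_div_mod:
  fixes k m n :: nat
  assumes "k < l * (m * n)"
  shows "k mod (m * n) div n = k div n mod m" "k mod (m * n) mod n = k mod n"
  using assms by (cases "n = 0"; simp add: mod_mult2_eq mult.commute[of m])+


section \<open>Calculus of cells\<close>

context
  fixes c :: "('i,'x::ab_group_add,'r) cartan"
    and t :: "'i \<Rightarrow> 'i \<Rightarrow> 'k::field"
    and b :: "('i,'x,'k) bubble_params"
begin

private abbreviation (input) "cl \<equiv> cls c t b"
private abbreviation (input) "hm \<equiv> cells c t b"
private abbreviation (input) "vc \<equiv> vcell c t b"
private abbreviation (input) "hc \<equiv> hcell c t b"
private abbreviation (input) "ad \<equiv> add_cell c t b"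
private abbreviation (input) "sm \<equiv> smult_cell c t b"
private abbreviation (input) "ze w w' v d \<equiv> cls c t b (TZero w w' v d)"
private abbreviation (input) "ec \<equiv> entry_cells c t b"
private abbreviation (input) "zee \<equiv> zero_entry c t b"
private abbreviation (input) "ide \<equiv> id_entry c t b"
private abbreviation (input) "H \<equiv> hom2 (Ucat c t b)"
private abbreviation (input) "Zr \<equiv> zero2 (Ucat c t b)"
private abbreviation (input) "Ad \<equiv> add2 (Ucat c t b)"
private abbreviation (input) "Sm \<equiv> smult2 (Ucat c t b)"
private abbreviation (input) "Vc \<equiv> Uvcomp c t b"
private abbreviation (input) "Hc \<equiv> Uhcomp c t b"
private abbreviation (input) "Sh \<equiv> shift2 (Ucat c t b)"

lemma cls_eqI: "eqv c t b s s' \<Longrightarrow> cl s = cl s'"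
  unfolding cls_def by (blast intro: eqv_sym eqv_trans)

lemma mem_cls: "typed c s w w' v d \<Longrightarrow> s \<in> cl s"
  unfolding cls_def by (simp add: eqv_refl)

lemma cls_eq_iff: "typed c s w w' v d \<Longrightarrow> cl s = cl s' \<longleftrightarrow> eqv c t b s s'"
  using cls_eqI mem_cls[of s w w' v d] unfolding cls_def by (blast intro: eqv_sym)

text \<open>\<open>eqv\<close> preserves types, so any representative decides the type of a class.
  An ill-typed expression is equivalent to nothing, so its class is empty, and the empty set is not
  a cell.\<close>

lemma cells_cls [simp]: "cl s \<in> hm w w' v d \<longleftrightarrow> typed c s w w' v d"
proof
  assume "cl s \<in> hm w w' v d"
  then obtain s' where s': "cl s = cl s'" "typed c s' w w' v d" unfolding cells_def by blast
  then have "eqv c t b s' s" using cls_eq_iff by metis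
  with s'(2) show "typed c s w w' v d" by (rule eqv_typed[rotated])
qed (auto simp: cells_def)

lemma cellsE:
  assumes "X \<in> hm w w' v d"
  obtains s where "X = cl s" "typed c s w w' v d"
  using assms unfolding cells_def by blast

text \<open>The operations on cells are unions over all representatives. When the resulting class
  does not depend on the choice, the union collapses to it; the typing premise ensures that there is
  a representative at all.\<close>

lemma UN_cls:
  assumes "\<And>s'. eqv c t b s s' \<Longrightarrow> F s' = Y" "typed c s w w' v d"
  shows "(\<Union>s'\<in>cl s. F s') = Y"
  using assms mem_cls[OF assms(2)] unfolding cls_def by auto

lemma vcell_cls:
  assumes "typed c s w' w'' v d" "typed c u w w' v d'"
  shows "vc (cl s) (cl u) = cl (TV s u)"
  unfolding vcell_def using assms
  by (intro UN_cls cls_eqI[OF eqv_sym] eqv_V) (auto intro: typed.intros)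

lemma hcell_cls:
  assumes "typed c s w w' (v + wwt c z) d" "typed c u z z' v d'"
  shows "hc (cl s) (cl u) = cl (TH s u)"
  unfolding hcell_def using assms
  by (intro UN_cls cls_eqI[OF eqv_sym] eqv_H) (auto intro: typed.intros)

lemma add_cell_cls:
  assumes "typed c s w w' v d" "typed c u w w' v d"
  shows "ad (cl s) (cl u) = cl (TAdd s u)"
  unfolding add_cell_def using assms
  by (intro UN_cls cls_eqI[OF eqv_sym] eqv_Add) auto

lemma smult_cell_cls:
  assumes "typed c s w w' v d"
  shows "sm r (cl s) = cl (TScale r s)"
  unfolding smult_cell_def using assms
  by (intro UN_cls cls_eqI[OF eqv_sym] eqv_Scale) auto

lemma vcell_in: "X \<in> hm w' w'' v d \<Longrightarrow> Y \<in> hm w w' v d' \<Longrightarrow> vc X Y \<in> hm w w'' v (d + d')"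
  by (auto elim!: cellsE simp: vcell_cls intro: typed.intros)

lemma hcell_in:
  "X \<in> hm w w' (v + wwt c z) d \<Longrightarrow> Y \<in> hm z z' v d' \<Longrightarrow> hc X Y \<in> hm (w @ z) (w' @ z') v (d + d')"
  by (auto elim!: cellsE simp: hcell_cls intro: typed.intros)

lemma add_cell_in: "X \<in> hm w w' v d \<Longrightarrow> Y \<in> hm w w' v d \<Longrightarrow> ad X Y \<in> hm w w' v d"
  by (auto elim!: cellsE simp: add_cell_cls)

lemma smult_cell_in: "X \<in> hm w w' v d \<Longrightarrow> sm r X \<in> hm w w' v d"
  by (auto elim!: cellsE simp: smult_cell_cls)

lemma zero_cell_in: "X \<in> hm w w' v d \<Longrightarrow> ze w w' v d \<in> hm w w' v d"
  by (auto elim!: cellsE dest: typed_wwt)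

lemma vcell_assoc:
  assumes "X \<in> hm w2 w3 v d" "Y \<in> hm w1 w2 v d'" "Z \<in> hm w0 w1 v d''"
  shows "vc (vc X Y) Z = vc X (vc Y Z)"
proof -
  from assms obtain x y z where *: "X = cl x" "Y = cl y" "Z = cl z"
    and ty: "typed c x w2 w3 v d" "typed c y w1 w2 v d'" "typed c z w0 w1 v d''"
    by (auto elim!: cellsE)
  have xyz: "typed c (TV (TV x y) z) w0 w3 v (d + d' + d'')"
    using ty by (auto intro: typed.intros)
  show ?thesis
    using ty typed.intros(3)[OF ty(1,2)] typed.intros(3)[OF ty(2,3)]
    by (simp add: * vcell_cls cls_eqI[OF eqv.V_assoc[OF xyz]])
qed

lemma vcell_id: "X \<in> hm w w' v d \<Longrightarrow> vc X (cl (TId w v)) = X"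
  by (auto elim!: cellsE simp: vcell_cls[where w = w and d' = 0] cls_eqI[OF eqv.V_id])

lemma id_vcell: "X \<in> hm w w' v d \<Longrightarrow> vc (cl (TId w' v)) X = X"
  by (auto elim!: cellsE simp: vcell_cls[where w'' = w' and d = 0] cls_eqI[OF eqv.id_V])

lemma hcell_assoc:
  assumes "X \<in> hm w0 w0' (v + wwt c w2 + wwt c w1) d" "Y \<in> hm w1 w1' (v + wwt c w2) d'"
    "Z \<in> hm w2 w2' v d''"
  shows "hc (hc X Y) Z = hc X (hc Y Z)"
proof -
  from assms obtain x y z where *: "X = cl x" "Y = cl y" "Z = cl z"
    and ty: "typed c x w0 w0' (v + wwt c w2 + wwt c w1) d" "typed c y w1 w1' (v + wwt c w2) d'"
      "typed c z w2 w2' v d''"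
    by (auto elim!: cellsE)
  have yz: "typed c (TH y z) (w1 @ w2) (w1' @ w2') v (d' + d'')"
    using ty by (auto intro: typed.intros)
  have x: "typed c x w0 w0' (v + wwt c (w1 @ w2)) d"
    using ty by (simp add: algebra_simps)
  have xy: "typed c (TH x y) (w0 @ w1) (w0' @ w1') (v + wwt c w2) (d + d')"
    using ty by (auto intro: typed.intros)
  have "typed c (TH (TH x y) z) ((w0 @ w1) @ w2) ((w0' @ w1') @ w2') v (d + d' + d'')"
    using xy ty by (auto simp del: append_assoc intro: typed.intros)
  then show ?thesis
    unfolding * hcell_cls[OF ty(1,2)] hcell_cls[OF ty(2,3)] hcell_cls[OF x yz] hcell_cls[OF xy ty(3)]
    by (intro cls_eqI eqv.H_assoc)
qed

lemma hcell_unit: "X \<in> hm w w' v d \<Longrightarrow> hc X (cl (TId [] v)) = X"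
  by (auto elim!: cellsE simp: hcell_cls[where z = "[]" and v = v and d' = 0] cls_eqI[OF eqv.H_unit])

lemma unit_hcell: "X \<in> hm w w' v d \<Longrightarrow> hc (cl (TId [] (v + wwt c w))) X = X"
  by (auto elim!: cellsE simp: hcell_cls[where w = "[]" and d = 0 and z = w] cls_eqI[OF eqv.unit_H])

lemma hcell_id: "hc (cl (TId w (v + wwt c w'))) (cl (TId w' v)) = cl (TId (w @ w') v)"
  by (subst hcell_cls) (auto simp: cls_eqI[OF eqv.H_id])

lemma cell_interchange:
  assumes "X \<in> hm w1 w1' (v + wwt c w2) d1" "X' \<in> hm w0 w1 (v + wwt c w2) d1'"
    "Y \<in> hm z2 z2' v d2" "Y' \<in> hm w2 z2 v d2'"
  shows "hc (vc X X') (vc Y Y') = vc (hc X Y) (hc X' Y')"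
proof -
  from assms obtain x x' y y' where *: "X = cl x" "X' = cl x'" "Y = cl y" "Y' = cl y'"
    and ty: "typed c x w1 w1' (v + wwt c w2) d1" "typed c x' w0 w1 (v + wwt c w2) d1'"
    "typed c y z2 z2' v d2" "typed c y' w2 z2 v d2'"
    by (auto elim!: cellsE)
  \<comment> \<open>\<open>hc X Y\<close> needs \<open>x\<close> over the weight of
    \<open>z2\<close> instead of \<open>w2\<close>; \<open>y'\<close> shows that the two words have
    equal weight.\<close>
  have ty1: "typed c x w1 w1' (v + wwt c z2) d1"
    using ty(1) typed_wwt[OF ty(4)] by simp
  show ?thesis
    unfolding * vcell_cls[OF ty(1,2)] vcell_cls[OF ty(3,4)] hcell_cls[OF ty1 ty(3)] hcell_cls[OF ty(2,4)]
      hcell_cls[OF typed.intros(3)[OF ty(1,2)] typed.intros(3)[OF ty(3,4)]]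
      vcell_cls[OF typed.intros(4)[OF ty1 ty(3)] typed.intros(4)[OF ty(2,4)]]
    by (intro cls_eqI eqv.V_H) (rule typed.intros(3)[OF ty(1,2)] typed.intros(3)[OF ty(3,4)])+
qed

lemma add_cell_assoc:
  "X \<in> hm w w' v d \<Longrightarrow> Y \<in> hm w w' v d \<Longrightarrow> Z \<in> hm w w' v d \<Longrightarrow> ad (ad X Y) Z = ad X (ad Y Z)"
  by (auto elim!: cellsE simp: add_cell_cls cls_eqI[OF eqv.Add_assoc])

lemma add_cell_commute: "X \<in> hm w w' v d \<Longrightarrow> Y \<in> hm w w' v d \<Longrightarrow> ad X Y = ad Y X"
  by (auto elim!: cellsE simp: add_cell_cls cls_eqI[OF eqv.Add_commute])

lemma add_cell_zero: "X \<in> hm w w' v d \<Longrightarrow> ad X (ze w w' v d) = X"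
  by (frule zero_cell_in) (auto elim!: cellsE simp: add_cell_cls cls_eqI[OF eqv.Add_zero])

lemma add_cell_neg: "X \<in> hm w w' v d \<Longrightarrow> ad X (sm (- 1) X) = ze w w' v d"
  by (auto elim!: cellsE simp: add_cell_cls smult_cell_cls cls_eqI[OF eqv.Add_neg])

lemma smult_cell_one: "X \<in> hm w w' v d \<Longrightarrow> sm 1 X = X"
  by (auto elim!: cellsE simp: smult_cell_cls cls_eqI[OF eqv.Scale_one])

lemma smult_cell_smult: "X \<in> hm w w' v d \<Longrightarrow> sm r (sm r' X) = sm (r * r') X"
  by (auto elim!: cellsE simp: smult_cell_cls cls_eqI[OF eqv.Scale_Scale])

lemma smult_cell_add:
  "X \<in> hm w w' v d \<Longrightarrow> Y \<in> hm w w' v d \<Longrightarrow> sm r (ad X Y) = ad (sm r X) (sm r Y)"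
  by (auto elim!: cellsE simp: smult_cell_cls add_cell_cls cls_eqI[OF eqv.Scale_Add])

lemma add_smult_cell: "X \<in> hm w w' v d \<Longrightarrow> sm (r + r') X = ad (sm r X) (sm r' X)"
  by (auto elim!: cellsE simp: smult_cell_cls add_cell_cls cls_eqI[OF eqv.add_Scale])

lemma vcell_add_left:
  assumes "X \<in> hm w' w'' v d" "X' \<in> hm w' w'' v d" "Y \<in> hm w w' v d'"
  shows "vc (ad X X') Y = ad (vc X Y) (vc X' Y)"
proof -
  from assms obtain x x' y where *: "X = cl x" "X' = cl x'" "Y = cl y"
    and ty: "typed c x w' w'' v d" "typed c x' w' w'' v d" "typed c y w w' v d'"
    by (auto elim!: cellsE)
  have "typed c (TV (TAdd x x') y) w w'' v (d + d')"
    using ty by (auto intro: typed.intros)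
  note [simp] = cls_eqI[OF eqv.V_Add_left[OF this]]
  with ty typed.intros(3)[OF ty(1,3)] typed.intros(3)[OF ty(2,3)] show ?thesis
    by (simp add: * vcell_cls add_cell_cls)
qed

lemma vcell_add_right:
  assumes "X \<in> hm w' w'' v d" "Y \<in> hm w w' v d'" "Y' \<in> hm w w' v d'"
  shows "vc X (ad Y Y') = ad (vc X Y) (vc X Y')"
proof -
  from assms obtain x y y' where *: "X = cl x" "Y = cl y" "Y' = cl y'"
    and ty: "typed c x w' w'' v d" "typed c y w w' v d'" "typed c y' w w' v d'"
    by (auto elim!: cellsE)
  have "typed c (TV x (TAdd y y')) w w'' v (d + d')"
    using ty by (auto intro: typed.intros)
  note [simp] = cls_eqI[OF eqv.V_Add_right[OF this]]
  with ty typed.intros(3)[OF ty(1,2)] typed.intros(3)[OF ty(1,3)] show ?thesis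
    by (simp add: * vcell_cls add_cell_cls)
qed

lemma vcell_smult_left:
  assumes "X \<in> hm w' w'' v d" "Y \<in> hm w w' v d'"
  shows "vc (sm r X) Y = sm r (vc X Y)"
proof -
  from assms obtain x y where *: "X = cl x" "Y = cl y"
    and ty: "typed c x w' w'' v d" "typed c y w w' v d'"
    by (auto elim!: cellsE)
  with ty typed.intros(3)[OF ty] show ?thesis
    by (auto simp: * vcell_cls smult_cell_cls cls_eqI[OF eqv.V_Scale_left])
qed

lemma vcell_smult_right:
  assumes "X \<in> hm w' w'' v d" "Y \<in> hm w w' v d'"
  shows "vc X (sm r Y) = sm r (vc X Y)"
proof -
  from assms obtain x y where *: "X = cl x" "Y = cl y"
    and ty: "typed c x w' w'' v d" "typed c y w w' v d'"
    by (auto elim!: cellsE)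
  with ty typed.intros(3)[OF ty] show ?thesis
    by (auto simp: * vcell_cls smult_cell_cls cls_eqI[OF eqv.V_Scale_right])
qed

lemma hcell_add_left:
  assumes "X \<in> hm w w' (v + wwt c z) d" "X' \<in> hm w w' (v + wwt c z) d" "Y \<in> hm z z' v d'"
  shows "hc (ad X X') Y = ad (hc X Y) (hc X' Y)"
proof -
  from assms obtain x x' y where *: "X = cl x" "X' = cl x'" "Y = cl y"
    and ty: "typed c x w w' (v + wwt c z) d" "typed c x' w w' (v + wwt c z) d" "typed c y z z' v d'"
    by (auto elim!: cellsE)
  have "typed c (TH (TAdd x x') y) (w @ z) (w' @ z') v (d + d')"
    using ty by (auto intro: typed.intros)
  note [simp] = cls_eqI[OF eqv.H_Add_left[OF this]]
  with ty typed.intros(4)[OF ty(1,3)] typed.intros(4)[OF ty(2,3)] show ?thesis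
    by (simp add: * hcell_cls add_cell_cls)
qed

lemma hcell_add_right:
  assumes "X \<in> hm w w' (v + wwt c z) d" "Y \<in> hm z z' v d'" "Y' \<in> hm z z' v d'"
  shows "hc X (ad Y Y') = ad (hc X Y) (hc X Y')"
proof -
  from assms obtain x y y' where *: "X = cl x" "Y = cl y" "Y' = cl y'"
    and ty: "typed c x w w' (v + wwt c z) d" "typed c y z z' v d'" "typed c y' z z' v d'"
    by (auto elim!: cellsE)
  have "typed c (TH x (TAdd y y')) (w @ z) (w' @ z') v (d + d')"
    using ty by (auto intro: typed.intros)
  note [simp] = cls_eqI[OF eqv.H_Add_right[OF this]]
  with ty typed.intros(4)[OF ty(1,2)] typed.intros(4)[OF ty(1,3)] show ?thesis
    by (simp add: * hcell_cls add_cell_cls)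
qed

lemma hcell_smult_left:
  assumes "X \<in> hm w w' (v + wwt c z) d" "Y \<in> hm z z' v d'"
  shows "hc (sm r X) Y = sm r (hc X Y)"
proof -
  from assms obtain x y where *: "X = cl x" "Y = cl y"
    and ty: "typed c x w w' (v + wwt c z) d" "typed c y z z' v d'"
    by (auto elim!: cellsE)
  with ty typed.intros(4)[OF ty] show ?thesis
    by (auto simp: * hcell_cls smult_cell_cls cls_eqI[OF eqv.H_Scale_left])
qed

lemma hcell_smult_right:
  assumes "X \<in> hm w w' (v + wwt c z) d" "Y \<in> hm z z' v d'"
  shows "hc X (sm r Y) = sm r (hc X Y)"
proof -
  from assms obtain x y where *: "X = cl x" "Y = cl y"
    and ty: "typed c x w w' (v + wwt c z) d" "typed c y z z' v d'"
    by (auto elim!: cellsE)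
  with ty typed.intros(4)[OF ty] show ?thesis
    by (auto simp: * hcell_cls smult_cell_cls cls_eqI[OF eqv.H_Scale_right])
qed

text \<open>The rules of the congruence do not mention the scalar 0; it is written as
  \<open>1 + (- 1)\<close>. Linearity of the compositions then shows that zero cells absorb.\<close>

lemma smult_cell_zero: "X \<in> hm w w' v d \<Longrightarrow> sm 0 X = ze w w' v d"
  using add_smult_cell[of X w w' v d 1 "- 1"] by (simp add: smult_cell_one add_cell_neg)

lemma vcell_zero_left:
  assumes "X \<in> hm w' w'' v d" "Y \<in> hm w w' v d'"
  shows "vc (ze w' w'' v d) Y = ze w w'' v (d + d')"
  using smult_cell_zero[OF assms(1)] smult_cell_zero[OF vcell_in[OF assms]]
    vcell_smult_left[OF assms] by metis

lemma vcell_zero_right: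
  assumes "X \<in> hm w' w'' v d" "Y \<in> hm w w' v d'"
  shows "vc X (ze w w' v d') = ze w w'' v (d + d')"
  using smult_cell_zero[OF assms(2)] smult_cell_zero[OF vcell_in[OF assms]]
    vcell_smult_right[OF assms] by metis

lemma hcell_zero_left:
  assumes "X \<in> hm w w' (v + wwt c z) d" "Y \<in> hm z z' v d'"
  shows "hc (ze w w' (v + wwt c z) d) Y = ze (w @ z) (w' @ z') v (d + d')"
  using smult_cell_zero[OF assms(1)] smult_cell_zero[OF hcell_in[OF assms]]
    hcell_smult_left[OF assms] by metis

lemma hcell_zero_right:
  assumes "X \<in> hm w w' (v + wwt c z) d" "Y \<in> hm z z' v d'"
  shows "hc X (ze z z' v d') = ze (w @ z) (w' @ z') v (d + d')"
  using smult_cell_zero[OF assms(2)] smult_cell_zero[OF hcell_in[OF assms]]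
    hcell_smult_right[OF assms] by metis

lemma smult_cell_of_zero:
  assumes "X \<in> hm w w' v d"
  shows "sm r (ze w w' v d) = ze w w' v d"
  using smult_cell_zero[OF assms] smult_cell_smult[OF assms, of r 0] by simp

text \<open>The equality of weights is exactly the typing condition of the zero expression, which
  puts the zero into the carrier.\<close>

lemma cells_comm_monoid:
  assumes "wwt c w = wwt c w'"
  shows "carrier_comm_monoid (hm w w' v d) ad (ze w w' v d)"
  using assms by unfold_locales
      (simp_all add: add_cell_in add_cell_assoc add_cell_zero, rule add_cell_commute)


section \<open>Matrices of cells\<close>

definition parallel :: "('i,'x) mor1 \<Rightarrow> ('i,'x) mor1 \<Rightarrow> bool" where
  "parallel f g \<longleftrightarrow> f \<in> U1 c \<and> g \<in> U1 c \<and> dom1 f = dom1 g \<and> cod1 f = cod1 g"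

lemma parallel_trans: "parallel f g \<Longrightarrow> parallel g h \<Longrightarrow> parallel f h"
  by (simp add: parallel_def)

lemma parallel_sym: "parallel f g \<Longrightarrow> parallel g f"
  by (simp add: parallel_def)

lemma parallel_dom: "parallel f g \<Longrightarrow> dom1 f = dom1 g"
  by (simp add: parallel_def)

lemma entry_cells_eq:
  "ec f g k l = cells c t b (snd (summands f ! l)) (snd (summands g ! k)) (dom1 f)
     (fst (summands g ! k) - fst (summands f ! l))"
  by (simp add: entry_cells_def split_beta)

lemma zero_entry_eq:
  "zee f g k l = cls c t b (TZero (snd (summands f ! l)) (snd (summands g ! k)) (dom1 f)
     (fst (summands g ! k) - fst (summands f ! l)))"
  by (simp add: zero_entry_def split_beta)

lemma parallel_wwt:
  "parallel f g \<Longrightarrow> k < nsum g \<Longrightarrow> l < nsum f \<Longrightarrow>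
    wwt c (snd (summands f ! l)) = wwt c (snd (summands g ! k))"
  using U1_cod[of f c l] U1_cod[of g c k] by (simp add: parallel_def)

lemma zero_entry_in: "parallel f g \<Longrightarrow> k < nsum g \<Longrightarrow> l < nsum f \<Longrightarrow> zee f g k l \<in> ec f g k l"
  by (simp add: entry_cells_eq zero_entry_eq parallel_wwt)

lemma entry_monoid:
  "parallel f g \<Longrightarrow> k < nsum g \<Longrightarrow> l < nsum f \<Longrightarrow> carrier_comm_monoid (ec f g k l) ad (zee f g k l)"
  unfolding entry_cells_eq zero_entry_eq by (intro cells_comm_monoid parallel_wwt)

lemma vcell_entry_in:
  assumes "X \<in> ec g h k r" "Y \<in> ec f g r l" "dom1 f = dom1 g"
  shows "vc X Y \<in> ec f h k l"
  using vcell_in[OF assms(1,2)[unfolded entry_cells_eq assms(3)]] assms(3)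
  by (simp add: entry_cells_eq)

lemma hom1_Ucat: "f \<in> hom1 (Ucat c t b) v w \<longleftrightarrow> f \<in> U1 c \<and> dom1 f = v \<and> cod1 f = w"
  by (simp add: hom1_def Ucat_def)

text \<open>Replaces the existential description of \<open>U2\<close> by conditions on the entries.
  Because entries outside the matrix are empty, a 2-morphism is determined by its two ends and the
  entries inside.\<close>

lemma hom2_Ucat:
  "u \<in> H f g \<longleftrightarrow> parallel f g \<and> dom2 u = f \<and> cod2 u = g \<and>
    (\<forall>k l. if k < nsum g \<and> l < nsum f then entry u k l \<in> ec f g k l else entry u k l = {})"
  (is "?L \<longleftrightarrow> ?R")
proof
  assume ?L
  then obtain e where "u = matrix2 f g e" "parallel f g"
     "\<forall>k < nsum g. \<forall>l < nsum f. e k l \<in> ec f g k l"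
    unfolding hom2_def Ucat_def U2_def parallel_def by auto
  then show ?R by (simp add: entry_matrix2_outside)
next
  assume R: ?R
  then have "u = matrix2 f g (entry u)"
    by (cases u) (auto simp: matrix2_def fun_eq_iff split: if_splits)
  with R show ?L
    unfolding hom2_def Ucat_def U2_def parallel_def by (auto intro!: exI[of _ "entry u"] split: if_splits)
qed

lemma hom2_entry: "u \<in> H f g \<Longrightarrow> k < nsum g \<Longrightarrow> l < nsum f \<Longrightarrow> entry u k l \<in> ec f g k l"
  and hom2_parallel: "u \<in> H f g \<Longrightarrow> parallel f g"
  and hom2_dom: "u \<in> H f g \<Longrightarrow> dom2 u = f"
  and hom2_cod: "u \<in> H f g \<Longrightarrow> cod2 u = g"
  by (auto simp: hom2_Ucat split: if_splits)

lemma hom2_eqI: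
  assumes "u \<in> H f g" "v \<in> H f g" "\<And>k l. k < nsum g \<Longrightarrow> l < nsum f \<Longrightarrow> entry u k l = entry v k l"
  shows "u = v"
proof -
  have "entry u k l = entry v k l" for k l
    using assms by (cases "k < nsum g \<and> l < nsum f") (auto simp: hom2_Ucat)
  then have "entry u = entry v" by (intro ext)
  with assms show ?thesis by (intro mor2.expand) (simp add: hom2_Ucat)
qed

lemma matrix2_in:
  "parallel f g \<Longrightarrow> (\<And>k l. k < nsum g \<Longrightarrow> l < nsum f \<Longrightarrow> e k l \<in> ec f g k l) \<Longrightarrow> matrix2 f g e \<in> H f g"
  by (simp add: hom2_Ucat entry_matrix2_outside)

lemma Ucat_sel:
  "Obj (Ucat c t b) = UNIV" "Mor1 (Ucat c t b) = U1 c" "src1 (Ucat c t b) = dom1"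
  "tgt1 (Ucat c t b) = cod1" "id1 (Ucat c t b) v = OneMor v v [(0, [])]"
  "comp1 (Ucat c t b) = Ucomp1" "src2 (Ucat c t b) = dom2"
  "tgt2 (Ucat c t b) = cod2" "shift1 (Ucat c t b) = Ushift1" "id2 (Ucat c t b) = Uid2 c t b"
  "vcomp (Ucat c t b) = Uvcomp c t b" "hcomp (Ucat c t b) = Uhcomp c t b"
  "zero2 (Ucat c t b) f g = matrix2 f g (zee f g)"
  "add2 (Ucat c t b) A B = matrix2 (dom2 A) (cod2 A) (\<lambda>k l. ad (entry A k l) (entry B k l))"
  "smult2 (Ucat c t b) r A = matrix2 (dom2 A) (cod2 A) (\<lambda>k l. sm r (entry A k l))"
  "shift2 (Ucat c t b) n A = TwoMor (Ushift1 n (dom2 A)) (Ushift1 n (cod2 A)) (entry A)"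
  by (simp_all add: Ucat_def)

lemma Mor2_Ucat: "u \<in> Mor2 (Ucat c t b) \<Longrightarrow> u \<in> H (dom2 u) (cod2 u)"
  by (simp add: hom2_def Ucat_def)

section \<open>Vertical composition of matrices\<close>

lemma Uvcomp_in:
  assumes "u \<in> H f g" "v \<in> H g h"
  shows "Uvcomp c t b v u \<in> H f h"
  unfolding Uvcomp_def hom2_dom[OF assms(1)] hom2_dom[OF assms(2)] hom2_cod[OF assms(2)]
proof (rule matrix2_in)
  show "parallel f h" using assms by (blast intro: parallel_trans hom2_parallel)
  fix k l assume kl: "k < nsum h" "l < nsum f"
  interpret carrier_comm_monoid "ec f h k l" ad "zee f h k l"
    by (rule entry_monoid) fact+
  have "dom1 f = dom1 g" using hom2_parallel[OF assms(1)] by (simp add: parallel_def)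
  with assms kl show "lsum (\<lambda>r. vc (entry v k r) (entry u r l)) [0..<nsum g] \<in> ec f h k l"
    by (intro lsum_closed) (auto intro!: vcell_entry_in hom2_entry)
qed

lemma entry_Uvcomp:
  assumes "u \<in> H f g" "v \<in> H g h" "k < nsum h" "l < nsum f"
  shows "entry (Uvcomp c t b v u) k l =
    foldr ad (map (\<lambda>r. vc (entry v k r) (entry u r l)) [0..<nsum g]) (zee f h k l)"
  using assms by (simp add: Uvcomp_def hom2_dom[OF assms(1)] hom2_dom[OF assms(2)] hom2_cod[OF assms(2)])

lemma vcell_zero_entry_left:
  assumes "parallel g h" "dom1 f = dom1 g" "k < nsum h" "r < nsum g" "Y \<in> ec f g r l"
  shows "vc (zee g h k r) Y = zee f h k l"
  using vcell_zero_left[OF zero_entry_in[OF assms(1,3,4), unfolded entry_cells_eq]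
      assms(5)[unfolded entry_cells_eq assms(2)]] assms(2)
  by (simp add: zero_entry_eq)

lemma vcell_zero_entry_right:
  assumes "parallel f g" "r < nsum g" "l < nsum f" "X \<in> ec g h k r"
  shows "vc X (zee f g r l) = zee f h k l"
proof -
  have dom: "dom1 g = dom1 f" using assms(1) by (simp add: parallel_def)
  show ?thesis
    using vcell_zero_right[OF assms(4)[unfolded entry_cells_eq dom]
        zero_entry_in[OF assms(1,2,3), unfolded entry_cells_eq]]
    by (simp add: zero_entry_eq)
qed

text \<open>Distributivity covers the empty sum, so the zero cell has to be absorbed too; the zero
  that results belongs to a different pair of 1-morphisms.\<close>

lemma vcell_sum_left:
  assumes "parallel g h" "dom1 f = dom1 g" "k < nsum h" "r < nsum g" "Y \<in> ec f g r l"
    and "\<And>q. q \<in> set qs \<Longrightarrow> F q \<in> ec g h k r"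
  shows "vc (foldr ad (map F qs) (zee g h k r)) Y = foldr ad (map (\<lambda>q. vc (F q) Y) qs) (zee f h k l)"
proof -
  interpret carrier_comm_monoid "ec g h k r" ad "zee g h k r"
    using assms by (intro entry_monoid)
  show ?thesis
  proof (rule lsum_hom)
    show "vc (zee g h k r) Y = zee f h k l" using assms(1-5) by (rule vcell_zero_entry_left)
    show "vc (ad X X') Y = ad (vc X Y) (vc X' Y)" if "X \<in> ec g h k r" "X' \<in> ec g h k r" for X X'
      using vcell_add_left that assms(5) unfolding entry_cells_eq assms(2) by metis
  qed fact
qed

lemma vcell_sum_right:
  assumes "parallel f g" "r < nsum g" "l < nsum f" "X \<in> ec g h k r"
    and "\<And>q. q \<in> set qs \<Longrightarrow> F q \<in> ec f g r l"
  shows "vc X (foldr ad (map F qs) (zee f g r l)) = foldr ad (map (\<lambda>q. vc X (F q)) qs) (zee f h k l)"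
proof -
  interpret carrier_comm_monoid "ec f g r l" ad "zee f g r l"
    using assms by (intro entry_monoid)
  show ?thesis
  proof (rule lsum_hom)
    show "vc X (zee f g r l) = zee f h k l" using assms(1-4) by (rule vcell_zero_entry_right)
    have dom: "dom1 g = dom1 f" using assms(1) by (simp add: parallel_def)
    show "vc X (ad Y Y') = ad (vc X Y) (vc X Y')" if "Y \<in> ec f g r l" "Y' \<in> ec f g r l" for Y Y'
      using vcell_add_right that assms(4) unfolding entry_cells_eq dom by metis
  qed fact
qed

text \<open>Associativity of the matrix product: distribute the outer factor over the inner sum, use
  associativity of cells in each term, exchange the two sums and collect again.\<close>

lemma Uvcomp_assoc:
  assumes u: "u \<in> H f g" and v: "v \<in> H g h" and w: "w \<in> H h m"
  shows "Uvcomp c t b (Uvcomp c t b w v) u = Uvcomp c t b w (Uvcomp c t b v u)"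
proof (rule hom2_eqI)
  show "Uvcomp c t b (Uvcomp c t b w v) u \<in> H f m" "Uvcomp c t b w (Uvcomp c t b v u) \<in> H f m"
    using assms by (auto intro: Uvcomp_in)
  fix k l assume k: "k < nsum m" and l: "l < nsum f"
  note par = hom2_parallel[OF u] hom2_parallel[OF v] hom2_parallel[OF w]
  have dom: "dom1 f = dom1 g" "dom1 g = dom1 h" using par by (auto simp: parallel_def)
  note vw = Uvcomp_in[OF v w] and uv = Uvcomp_in[OF u v]
  interpret carrier_comm_monoid "ec f m k l" ad "zee f m k l"
    using par k l by (intro entry_monoid) (blast intro: parallel_trans)
  have terms: "vc (entry w k q) (vc (entry v q r) (entry u r l)) \<in> ec f m k l"
    if "r < nsum g" "q < nsum h" for r q
    using that k l dom by (auto intro!: vcell_entry_in hom2_entry[OF u] hom2_entry[OF v] hom2_entry[OF w])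
  have assoc: "vc (vc (entry w k q) (entry v q r)) (entry u r l) = vc (entry w k q) (vc (entry v q r) (entry u r l))"
    if "r < nsum g" "q < nsum h" for r q
    using hom2_entry[OF w k that(2)] hom2_entry[OF v that(2,1)] hom2_entry[OF u that(1) l]
    unfolding entry_cells_eq dom by (rule vcell_assoc)
  have "entry (Uvcomp c t b (Uvcomp c t b w v) u) k l =
      lsum (\<lambda>r. vc (entry (Uvcomp c t b w v) k r) (entry u r l)) [0..<nsum g]"
    by (rule entry_Uvcomp[OF u vw k l])
  also have "\<dots> = lsum (\<lambda>r. lsum (\<lambda>q. vc (entry w k q) (vc (entry v q r) (entry u r l))) [0..<nsum h]) [0..<nsum g]"
  proof (rule foldr_map_cong)
    fix r assume "r \<in> set [0..<nsum g]"
    then have r: "r < nsum g" by simp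
    have "vc (entry (Uvcomp c t b w v) k r) (entry u r l) =
       lsum (\<lambda>q. vc (vc (entry w k q) (entry v q r)) (entry u r l)) [0..<nsum h]"
      unfolding entry_Uvcomp[OF v w k r]
      using r k l dom hom2_parallel[OF vw]
      by (intro vcell_sum_left) (auto intro!: vcell_entry_in hom2_entry[OF u] hom2_entry[OF v] hom2_entry[OF w])
    also have "\<dots> = lsum (\<lambda>q. vc (entry w k q) (vc (entry v q r) (entry u r l))) [0..<nsum h]"
      using r by (intro foldr_map_cong assoc) auto
    finally show "vc (entry (Uvcomp c t b w v) k r) (entry u r l) = \<dots>" .
  qed
  also have "\<dots> = lsum (\<lambda>q. lsum (\<lambda>r. vc (entry w k q) (vc (entry v q r) (entry u r l))) [0..<nsum g]) [0..<nsum h]"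
    by (intro lsum_swap terms) auto
  also have "\<dots> = lsum (\<lambda>q. vc (entry w k q) (entry (Uvcomp c t b v u) q l)) [0..<nsum h]"
  proof (rule foldr_map_cong)
    fix q assume "q \<in> set [0..<nsum h]"
    then have q: "q < nsum h" by simp
    show "lsum (\<lambda>r. vc (entry w k q) (vc (entry v q r) (entry u r l))) [0..<nsum g] =
        vc (entry w k q) (entry (Uvcomp c t b v u) q l)"
      unfolding entry_Uvcomp[OF u v q l]
      using q k l dom hom2_parallel[OF uv]
      by (intro vcell_sum_right[symmetric])
        (auto intro!: vcell_entry_in hom2_entry[OF u] hom2_entry[OF v] hom2_entry[OF w])
  qed
  also have "\<dots> = entry (Uvcomp c t b w (Uvcomp c t b v u)) k l"
    by (rule entry_Uvcomp[OF uv w k l, symmetric])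
  finally show "entry (Uvcomp c t b (Uvcomp c t b w v) u) k l = \<dots>" .
qed

section \<open>Inclusion and projection matrices\<close>

definition incl_matrix :: "(nat \<Rightarrow> nat) \<Rightarrow> ('i,'x) mor1 \<Rightarrow> ('i,'x) mor1 \<Rightarrow> ('i,'x,'k) mor2" where
  "incl_matrix \<phi> f s = matrix2 f s (\<lambda>k l. if k = \<phi> l then ide f l else zee f s k l)"

definition proj_matrix :: "(nat \<Rightarrow> nat) \<Rightarrow> ('i,'x) mor1 \<Rightarrow> ('i,'x) mor1 \<Rightarrow> ('i,'x,'k) mor2" where
  "proj_matrix \<phi> s f = matrix2 s f (\<lambda>k l. if l = \<phi> k then ide f k else zee s f k l)"

text \<open>A map of indices under which the summands agree, shifts included. For the identity map
  the two matrices are the identity 2-morphism, and for the two segments of a concatenation they are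
  the structure maps of a biproduct, so one computation serves both.\<close>

definition summand_map :: "(nat \<Rightarrow> nat) \<Rightarrow> ('i,'x) mor1 \<Rightarrow> ('i,'x) mor1 \<Rightarrow> bool" where
  "summand_map \<phi> f s \<longleftrightarrow> parallel f s \<and>
     (\<forall>l < nsum f. \<phi> l < nsum s \<and> summands s ! \<phi> l = summands f ! l)"

lemma vcell_id_entry: "X \<in> ec f g k l \<Longrightarrow> vc X (ide f l) = X"
  unfolding entry_cells_eq id_entry_def by (rule vcell_id)

lemma id_entry_vcell: "X \<in> ec f g k l \<Longrightarrow> dom1 f = dom1 g \<Longrightarrow> vc (ide g k) X = X"
  unfolding entry_cells_eq id_entry_def by (metis id_vcell)

lemma incl_matrix_in:
  assumes "summand_map \<phi> f s"
  shows "incl_matrix \<phi> f s \<in> H f s"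
  unfolding incl_matrix_def using assms
  by (intro matrix2_in) (auto simp: summand_map_def entry_cells_eq id_entry_def zero_entry_in[unfolded entry_cells_eq])

lemma proj_matrix_in:
  assumes "summand_map \<phi> f s"
  shows "proj_matrix \<phi> s f \<in> H s f"
proof -
  from assms have "parallel s f" by (simp add: summand_map_def parallel_sym)
  then show ?thesis
    unfolding proj_matrix_def
  proof (rule matrix2_in)
    fix k l assume "k < nsum f" "l < nsum s"
    with assms parallel_dom[OF \<open>parallel s f\<close>] zero_entry_in[OF \<open>parallel s f\<close>]
    show "(if l = \<phi> k then ide f k else zee s f k l) \<in> ec s f k l"
      by (simp add: summand_map_def) (simp add: entry_cells_eq id_entry_def)
  qed
qed

text \<open>Precomposition with an inclusion selects columns: in the sum over the middle summands
  only \<open>r = \<phi> l\<close> carries an identity, and every other term has a zero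
  factor.\<close>

lemma entry_vcomp_incl:
  assumes \<phi>: "summand_map \<phi> f s" and u: "u \<in> H s h" and k: "k < nsum h" and l: "l < nsum f"
  shows "entry (Uvcomp c t b u (incl_matrix \<phi> f s)) k l = entry u k (\<phi> l)"
proof -
  have par: "parallel f s" "parallel s h" and \<phi>l: "\<phi> l < nsum s" "summands s ! \<phi> l = summands f ! l"
    using \<phi> l hom2_parallel[OF u] by (auto simp: summand_map_def)
  then have par': "parallel f h" and dom: "dom1 f = dom1 s" by (auto simp: parallel_def)
  interpret carrier_comm_monoid "ec f h k l" ad "zee f h k l"
    using par' k l by (intro entry_monoid)
  have E: "entry u k (\<phi> l) \<in> ec f h k l"
    using hom2_entry[OF u k \<phi>l(1)] \<phi>l(2) dom by (simp add: entry_cells_eq)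
  have "entry (Uvcomp c t b u (incl_matrix \<phi> f s)) k l =
      lsum (\<lambda>r. vc (entry u k r) (if r = \<phi> l then ide f l else zee f s r l)) [0..<nsum s]"
    unfolding entry_Uvcomp[OF incl_matrix_in[OF \<phi>] u k l]
    using l by (intro foldr_map_cong) (simp add: incl_matrix_def)
  also have "\<dots> = vc (entry u k (\<phi> l)) (if \<phi> l = \<phi> l then ide f l else zee f s (\<phi> l) l)"
  proof (rule lsum_single)
    show "vc (entry u k r) (if r = \<phi> l then ide f l else zee f s r l) = zee f h k l"
      if "r \<in> set [0..<nsum s]" "r \<noteq> \<phi> l" for r
      using that vcell_zero_entry_right[OF par(1) _ l hom2_entry[OF u k]] by simp
  qed (use \<phi>l(1) E in \<open>simp_all add: vcell_id_entry\<close>)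
  finally show ?thesis using E by (simp add: vcell_id_entry)
qed

lemma entry_proj_vcomp:
  assumes \<phi>: "summand_map \<phi> f s" and u: "u \<in> H h s" and k: "k < nsum f" and l: "l < nsum h"
  shows "entry (Uvcomp c t b (proj_matrix \<phi> s f) u) k l = entry u (\<phi> k) l"
proof -
  have par: "parallel s f" "parallel h s" and \<phi>k: "\<phi> k < nsum s" "summands s ! \<phi> k = summands f ! k"
    using \<phi> k hom2_parallel[OF u] by (auto simp: summand_map_def parallel_sym)
  then have par': "parallel h f" and dom: "dom1 h = dom1 s" "dom1 h = dom1 f" by (auto simp: parallel_def)
  interpret carrier_comm_monoid "ec h f k l" ad "zee h f k l"
    using par' k l by (intro entry_monoid)
  have E: "entry u (\<phi> k) l \<in> ec h f k l"
    using hom2_entry[OF u \<phi>k(1) l] \<phi>k(2) by (simp add: entry_cells_eq)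
  have "entry (Uvcomp c t b (proj_matrix \<phi> s f) u) k l =
      lsum (\<lambda>r. vc (if r = \<phi> k then ide f k else zee s f k r) (entry u r l)) [0..<nsum s]"
    unfolding entry_Uvcomp[OF u proj_matrix_in[OF \<phi>] k l]
    using k by (intro foldr_map_cong) (simp add: proj_matrix_def)
  also have "\<dots> = vc (if \<phi> k = \<phi> k then ide f k else zee s f k (\<phi> k)) (entry u (\<phi> k) l)"
  proof (rule lsum_single)
    show "vc (if r = \<phi> k then ide f k else zee s f k r) (entry u r l) = zee h f k l"
      if "r \<in> set [0..<nsum s]" "r \<noteq> \<phi> k" for r
      using that vcell_zero_entry_left[OF par(1) dom(1) k _ hom2_entry[OF u _ l]] by simp
  qed (use \<phi>k(1) E dom in \<open>simp_all add: id_entry_vcell\<close>)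
  finally show ?thesis using E dom by (simp add: id_entry_vcell)
qed

text \<open>Postcomposition with an inclusion moves rows: row \<open>r\<close> becomes row
  \<open>\<phi> r\<close>, and rows outside the image vanish. Injectivity ensures that only one term
  of the sum reaches row \<open>k\<close>.\<close>

lemma entry_incl_vcomp:
  assumes \<phi>: "summand_map \<phi> f s" and u: "u \<in> H h f" and l: "l < nsum h" and k: "k < nsum s"
    and inj: "inj_on \<phi> {..<nsum f}"
  shows "r < nsum f \<Longrightarrow> k = \<phi> r \<Longrightarrow> entry (Uvcomp c t b (incl_matrix \<phi> f s) u) k l = entry u r l"
    and "k \<notin> \<phi> ` {..<nsum f} \<Longrightarrow> entry (Uvcomp c t b (incl_matrix \<phi> f s) u) k l = zee h s k l"
proof -
  have par: "parallel f s" "parallel h f"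
    using \<phi> hom2_parallel[OF u] by (auto simp: summand_map_def)
  then have par': "parallel h s" and dom: "dom1 h = dom1 f" by (auto simp: parallel_def)
  interpret carrier_comm_monoid "ec h s k l" ad "zee h s k l"
    using par' k l by (intro entry_monoid)
  have *: "entry (Uvcomp c t b (incl_matrix \<phi> f s) u) k l =
      lsum (\<lambda>r. vc (if k = \<phi> r then ide f r else zee f s k r) (entry u r l)) [0..<nsum f]"
    unfolding entry_Uvcomp[OF u incl_matrix_in[OF \<phi>] k l]
    using k by (intro foldr_map_cong) (simp add: incl_matrix_def)
  have zero: "vc (zee f s k r) (entry u r l) = zee h s k l" if "r < nsum f" for r
    using that par dom k l by (intro vcell_zero_entry_left) (auto intro!: hom2_entry[OF u])
  show "entry (Uvcomp c t b (incl_matrix \<phi> f s) u) k l = zee h s k l" if "k \<notin> \<phi> ` {..<nsum f}"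
    unfolding * using that zero by (intro lsum_zero) auto
  show "entry (Uvcomp c t b (incl_matrix \<phi> f s) u) k l = entry u r l" if r: "r < nsum f" "k = \<phi> r"
  proof -
    have u': "entry u r l \<in> ec h f r l" by (rule hom2_entry[OF u r(1) l])
    have E: "entry u r l \<in> ec h s k l"
      using u' \<phi> r by (simp add: entry_cells_eq summand_map_def)
    have "lsum (\<lambda>r. vc (if k = \<phi> r then ide f r else zee f s k r) (entry u r l)) [0..<nsum f] =
        vc (if k = \<phi> r then ide f r else zee f s k r) (entry u r l)"
    proof (rule lsum_single)
      show "vc (if k = \<phi> r' then ide f r' else zee f s k r') (entry u r' l) = zee h s k l"
        if "r' \<in> set [0..<nsum f]" "r' \<noteq> r" for r'
        using that r inj zero[of r'] by (auto dest: inj_onD)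
    qed (use r E id_entry_vcell[OF u' dom] in simp_all)
    with * r id_entry_vcell[OF u' dom] show ?thesis by simp
  qed
qed

lemma summand_map_id: "f \<in> U1 c \<Longrightarrow> summand_map (\<lambda>l. l) f f"
  by (simp add: summand_map_def parallel_def)

lemma Uid2_eq: "Uid2 c t b f = incl_matrix (\<lambda>l. l) f f" "Uid2 c t b f = proj_matrix (\<lambda>l. l) f f"
  unfolding Uid2_def incl_matrix_def proj_matrix_def by (rule arg_cong[of _ _ "matrix2 f f"]; auto simp: fun_eq_iff)+

lemma Uid2_in: "f \<in> U1 c \<Longrightarrow> Uid2 c t b f \<in> H f f"
  unfolding Uid2_eq(1) by (intro incl_matrix_in summand_map_id)

text \<open>Selecting all columns, or all rows, along the identity map changes nothing.\<close>

lemma Uvcomp_Uid2: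
  assumes "u \<in> H f g"
  shows "Uvcomp c t b u (Uid2 c t b f) = u" and "Uvcomp c t b (Uid2 c t b g) u = u"
proof -
  have fg: "f \<in> U1 c" "g \<in> U1 c" using hom2_parallel[OF assms] by (simp_all add: parallel_def)
  show "Uvcomp c t b u (Uid2 c t b f) = u"
  proof (rule hom2_eqI[OF Uvcomp_in[OF Uid2_in assms] assms])
    show "entry (Uvcomp c t b u (Uid2 c t b f)) k l = entry u k l" if "k < nsum g" "l < nsum f" for k l
      unfolding Uid2_eq(1) by (rule entry_vcomp_incl[OF summand_map_id assms that]) fact
  qed fact
  show "Uvcomp c t b (Uid2 c t b g) u = u"
  proof (rule hom2_eqI[OF Uvcomp_in[OF assms Uid2_in] assms])
    show "entry (Uvcomp c t b (Uid2 c t b g) u) k l = entry u k l" if "k < nsum g" "l < nsum f" for k l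
      unfolding Uid2_eq(2)[of g] by (rule entry_proj_vcomp[OF summand_map_id assms that]) fact
  qed fact
qed


section \<open>The 2-category axioms\<close>

lemma parallel_Ucomp1:
  "parallel f g \<Longrightarrow> parallel f' g' \<Longrightarrow> cod1 f = dom1 f' \<Longrightarrow> parallel (Ucomp1 f' f) (Ucomp1 g' g)"
  by (simp add: parallel_def Ucomp1_in)

text \<open>The standing situation for one entry of a horizontal composite: \<open>k\<close> and
  \<open>l\<close> number pairs of summands, the digit of the left factor leading.\<close>

private definition "hpar f g f' g' k l \<longleftrightarrow> parallel f g \<and> parallel f' g' \<and> cod1 f = dom1 f' \<and>
  k < nsum g' * nsum g \<and> l < nsum f' * nsum f"

text \<open>The left cell of \<open>hcell\<close> has to live over \<open>v + wwt c z\<close>, where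
  \<open>z\<close> is the word of the right one. All summands of \<open>f\<close> end at the same
  weight, so this is \<open>dom1 f'\<close> whichever summand \<open>l\<close> selects.\<close>

lemma hpar_wt: "hpar f g f' g' k l \<Longrightarrow> dom1 f' = dom1 f + wwt c (snd (summands f ! (l mod nsum f)))"
  unfolding hpar_def parallel_def using U1_cod[of f c "l mod nsum f"] nth_split_div_mod(2)[of l "nsum f'" "nsum f"]
  by auto

lemma hpar_bounds:
  assumes "hpar f g f' g' k l"
  shows "k div nsum g < nsum g'" "k mod nsum g < nsum g" "l div nsum f < nsum f'" "l mod nsum f < nsum f"
  using assms nth_split_div_mod unfolding hpar_def by blast+

lemma hcell_entry_in:
  assumes "hpar f g f' g' k l"
    and "X \<in> ec f' g' (k div nsum g) (l div nsum f)" "Y \<in> ec f g (k mod nsum g) (l mod nsum f)"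
  shows "hc X Y \<in> ec (Ucomp1 f' f) (Ucomp1 g' g) k l"
  using hcell_in[OF assms(2)[unfolded entry_cells_eq hpar_wt[OF assms(1)]] assms(3)[unfolded entry_cells_eq]]
    assms(1)
  by (simp add: entry_cells_eq nth_Ucomp1 hpar_def algebra_simps)

lemma hcell_zero_entry_left:
  assumes "hpar f g f' g' k l" "Y \<in> ec f g (k mod nsum g) (l mod nsum f)"
  shows "hc (zee f' g' (k div nsum g) (l div nsum f)) Y = zee (Ucomp1 f' f) (Ucomp1 g' g) k l"
proof -
  have "zee f' g' (k div nsum g) (l div nsum f) \<in> ec f' g' (k div nsum g) (l div nsum f)"
    using assms(1) hpar_bounds[OF assms(1)] by (intro zero_entry_in) (simp_all add: hpar_def)
  from hcell_zero_left[OF this[unfolded entry_cells_eq hpar_wt[OF assms(1)]] assms(2)[unfolded entry_cells_eq]]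
  show ?thesis
    using assms(1) hpar_wt[OF assms(1)]
    by (simp add: zero_entry_eq nth_Ucomp1 hpar_def algebra_simps)
qed

lemma hcell_zero_entry_right:
  assumes "hpar f g f' g' k l" "X \<in> ec f' g' (k div nsum g) (l div nsum f)"
  shows "hc X (zee f g (k mod nsum g) (l mod nsum f)) = zee (Ucomp1 f' f) (Ucomp1 g' g) k l"
proof -
  have "zee f g (k mod nsum g) (l mod nsum f) \<in> ec f g (k mod nsum g) (l mod nsum f)"
    using assms(1) hpar_bounds[OF assms(1)] by (intro zero_entry_in) (simp_all add: hpar_def)
  from hcell_zero_right[OF assms(2)[unfolded entry_cells_eq hpar_wt[OF assms(1)]] this[unfolded entry_cells_eq]]
  show ?thesis
    using assms(1) by (simp add: zero_entry_eq nth_Ucomp1 hpar_def algebra_simps)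
qed

lemma hcell_entry_add_left:
  assumes "hpar f g f' g' k l" "Y \<in> ec f g (k mod nsum g) (l mod nsum f)"
    and "X \<in> ec f' g' (k div nsum g) (l div nsum f)" "X' \<in> ec f' g' (k div nsum g) (l div nsum f)"
  shows "hc (ad X X') Y = ad (hc X Y) (hc X' Y)"
  using assms(3,4,2) unfolding entry_cells_eq hpar_wt[OF assms(1)] by (rule hcell_add_left)

lemma hcell_entry_add_right:
  assumes "hpar f g f' g' k l" "X \<in> ec f' g' (k div nsum g) (l div nsum f)"
    and "Y \<in> ec f g (k mod nsum g) (l mod nsum f)" "Y' \<in> ec f g (k mod nsum g) (l mod nsum f)"
  shows "hc X (ad Y Y') = ad (hc X Y) (hc X Y')"
  using assms(2-4) unfolding entry_cells_eq hpar_wt[OF assms(1)] by (rule hcell_add_right)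

lemma hcell_sum_left:
  assumes "hpar f g f' g' k l" "Y \<in> ec f g (k mod nsum g) (l mod nsum f)"
    and "\<And>q. q \<in> set qs \<Longrightarrow> F q \<in> ec f' g' (k div nsum g) (l div nsum f)"
  shows "hc (foldr ad (map F qs) (zee f' g' (k div nsum g) (l div nsum f))) Y =
    foldr ad (map (\<lambda>q. hc (F q) Y) qs) (zee (Ucomp1 f' f) (Ucomp1 g' g) k l)"
proof -
  interpret carrier_comm_monoid "ec f' g' (k div nsum g) (l div nsum f)" ad
      "zee f' g' (k div nsum g) (l div nsum f)"
    using assms(1) hpar_bounds[OF assms(1)] by (intro entry_monoid) (simp_all add: hpar_def)
  show ?thesis
    by (rule lsum_hom[OF hcell_zero_entry_left hcell_entry_add_left]) (assumption | rule assms)+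
qed

lemma hcell_sum_right:
  assumes "hpar f g f' g' k l" "X \<in> ec f' g' (k div nsum g) (l div nsum f)"
    and "\<And>q. q \<in> set qs \<Longrightarrow> F q \<in> ec f g (k mod nsum g) (l mod nsum f)"
  shows "hc X (foldr ad (map F qs) (zee f g (k mod nsum g) (l mod nsum f))) =
    foldr ad (map (\<lambda>q. hc X (F q)) qs) (zee (Ucomp1 f' f) (Ucomp1 g' g) k l)"
proof -
  interpret carrier_comm_monoid "ec f g (k mod nsum g) (l mod nsum f)" ad
      "zee f g (k mod nsum g) (l mod nsum f)"
    using assms(1) hpar_bounds[OF assms(1)] by (intro entry_monoid) (simp_all add: hpar_def)
  show ?thesis
    by (rule lsum_hom[OF hcell_zero_entry_right hcell_entry_add_right]) (assumption | rule assms)+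
qed

lemma hparI:
  assumes "u \<in> H f g" "u' \<in> H f' g'" "cod1 f = dom1 f'" "k < nsum (Ucomp1 g' g)" "l < nsum (Ucomp1 f' f)"
  shows "hpar f g f' g' k l"
  using assms hom2_parallel unfolding hpar_def by auto

lemma entry_Uhcomp:
  assumes "u \<in> H f g" "u' \<in> H f' g'" "k < nsum (Ucomp1 g' g)" "l < nsum (Ucomp1 f' f)"
  shows "entry (Uhcomp c t b u' u) k l =
    hc (entry u' (k div nsum g) (l div nsum f)) (entry u (k mod nsum g) (l mod nsum f))"
  using assms(3,4) hom2_dom[OF assms(1)] hom2_cod[OF assms(1)] hom2_dom[OF assms(2)] hom2_cod[OF assms(2)]
  by (simp add: Uhcomp_def)

lemma Uhcomp_in:
  assumes "u \<in> H f g" "u' \<in> H f' g'" "cod1 f = dom1 f'"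
  shows "Uhcomp c t b u' u \<in> H (Ucomp1 f' f) (Ucomp1 g' g)"
  unfolding Uhcomp_def hom2_dom[OF assms(1)] hom2_cod[OF assms(1)] hom2_dom[OF assms(2)] hom2_cod[OF assms(2)]
proof (rule matrix2_in)
  show "parallel (Ucomp1 f' f) (Ucomp1 g' g)"
    using assms hom2_parallel by (blast intro: parallel_Ucomp1)
  show "hc (entry u' (k div nsum g) (l div nsum f)) (entry u (k mod nsum g) (l mod nsum f)) \<in>
      ec (Ucomp1 f' f) (Ucomp1 g' g) k l"
    if "k < nsum (Ucomp1 g' g)" "l < nsum (Ucomp1 f' f)" for k l
    using hparI[OF assms that] hpar_bounds[OF hparI[OF assms that]]
    by (blast intro: hcell_entry_in hom2_entry[OF assms(1)] hom2_entry[OF assms(2)])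
qed

lemma hom2_cod1: "u \<in> H f g \<Longrightarrow> cod1 f = cod1 g" and hom2_dom1: "u \<in> H f g \<Longrightarrow> dom1 f = dom1 g"
  using hom2_parallel[of u f g] by (simp_all add: parallel_def)

lemma Uhcomp_assoc:
  assumes u: "u \<in> H f g" and u': "u' \<in> H f' g'" and u'': "u'' \<in> H f'' g''"
    and f: "cod1 f = dom1 f'" "cod1 f' = dom1 f''"
  shows "Uhcomp c t b (Uhcomp c t b u'' u') u = Uhcomp c t b u'' (Uhcomp c t b u' u)"
proof (rule hom2_eqI)
  have 21: "Uhcomp c t b u'' u' \<in> H (Ucomp1 f'' f') (Ucomp1 g'' g')"
    and 10: "Uhcomp c t b u' u \<in> H (Ucomp1 f' f) (Ucomp1 g' g)"
    using assms by (auto intro: Uhcomp_in)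
  show "Uhcomp c t b (Uhcomp c t b u'' u') u \<in> H (Ucomp1 f'' (Ucomp1 f' f)) (Ucomp1 g'' (Ucomp1 g' g))"
    using Uhcomp_in[OF u 21] f by (simp add: Ucomp1_assoc)
  show "Uhcomp c t b u'' (Uhcomp c t b u' u) \<in> H (Ucomp1 f'' (Ucomp1 f' f)) (Ucomp1 g'' (Ucomp1 g' g))"
    using Uhcomp_in[OF 10 u''] f by simp
  fix k l assume kl: "k < nsum (Ucomp1 g'' (Ucomp1 g' g))" "l < nsum (Ucomp1 f'' (Ucomp1 f' f))"
  then have kl': "k < nsum (Ucomp1 (Ucomp1 g'' g') g)" "l < nsum (Ucomp1 (Ucomp1 f'' f') f)"
    by (simp_all add: Ucomp1_assoc)
  have h: "hpar f g (Ucomp1 f'' f') (Ucomp1 g'' g') k l"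
    using hparI[OF u 21 _ kl'] f by simp
  note bd = hpar_bounds[OF h]
  have h': "hpar f' g' f'' g'' (k div nsum g) (l div nsum f)"
    using hparI[OF u' u'' f(2)] bd by simp
  note bd' = hpar_bounds[OF h']
  have "hc (hc (entry u'' (k div nsum g div nsum g') (l div nsum f div nsum f'))
        (entry u' (k div nsum g mod nsum g') (l div nsum f mod nsum f')))
        (entry u (k mod nsum g) (l mod nsum f)) =
      hc (entry u'' (k div nsum g div nsum g') (l div nsum f div nsum f'))
        (hc (entry u' (k div nsum g mod nsum g') (l div nsum f mod nsum f'))
        (entry u (k mod nsum g) (l mod nsum f)))"
    using hom2_entry[OF u'' bd'(1,3)] hom2_entry[OF u' bd'(2,4)] hom2_entry[OF u bd(2,4)]
      hpar_wt[OF h'] hpar_wt[OF h]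
    unfolding entry_cells_eq by (simp add: hcell_assoc)
  \<comment> \<open>Both bracketings read the same three digits off \<open>k\<close> and
    \<open>l\<close>. Entries of a horizontal composite involve no sums, so associativity of cells
    finishes the argument.\<close>
  moreover have "k div nsum g div nsum g' = k div (nsum g' * nsum g)"
      "l div nsum f div nsum f' = l div (nsum f' * nsum f)"
    by (simp_all add: div_mult2_eq mult.commute)
  moreover note mod_mult_div_mod[of k "nsum g''" "nsum g'" "nsum g"]
    mod_mult_div_mod[of l "nsum f''" "nsum f'" "nsum f"]
  moreover have "k mod (nsum g' * nsum g) < nsum (Ucomp1 g' g)" "l mod (nsum f' * nsum f) < nsum (Ucomp1 f' f)"
    using kl nth_split_div_mod(2)[of k "nsum g''" "nsum g' * nsum g"]
      nth_split_div_mod(2)[of l "nsum f''" "nsum f' * nsum f"] by simp_all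
  ultimately show "entry (Uhcomp c t b (Uhcomp c t b u'' u') u) k l =
      entry (Uhcomp c t b u'' (Uhcomp c t b u' u)) k l"
    using kl bd
    by (simp add: entry_Uhcomp[OF u 21 kl'] entry_Uhcomp[OF u' u''] entry_Uhcomp[OF 10 u'' kl]
        entry_Uhcomp[OF u u'])
qed

lemma entry_Uid2:
  "k < nsum f \<Longrightarrow> l < nsum f \<Longrightarrow> entry (Uid2 c t b f) k l = (if k = l then ide f k else zee f f k l)"
  by (simp add: Uid2_def)

lemma Uhcomp_unit:
  assumes u: "u \<in> H f g"
  shows "Uhcomp c t b u (Uid2 c t b (OneMor (dom1 f) (dom1 f) [(0, [])])) = u"
proof -
  let ?I = "OneMor (dom1 f) (dom1 f) [(0, [])]"
  have I: "Uid2 c t b ?I \<in> H ?I ?I" by (intro Uid2_in) (simp add: U1_def)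
  have fI: "Ucomp1 f ?I = f" "Ucomp1 g ?I = g"
    using Ucomp1_unit[of f] Ucomp1_unit[of g] hom2_dom1[OF u] by simp_all
  show ?thesis
  proof (rule hom2_eqI[OF _ u])
    show "Uhcomp c t b u (Uid2 c t b ?I) \<in> H f g"
      using Uhcomp_in[OF I u] fI by simp
    fix k l assume kl: "k < nsum g" "l < nsum f"
    have [simp]: "nsum ?I = 1" by (simp add: nsum_def)
    have "hc (entry u k l) (ide ?I 0) = entry u k l"
      using hom2_entry[OF u kl] unfolding entry_cells_eq id_entry_def by (auto simp: hcell_unit)
    then show "entry (Uhcomp c t b u (Uid2 c t b ?I)) k l = entry u k l"
      using entry_Uhcomp[OF I u, unfolded fI, OF kl] by (simp add: entry_Uid2)
  qed
qed

lemma unit_Uhcomp: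
  assumes u: "u \<in> H f g"
  shows "Uhcomp c t b (Uid2 c t b (OneMor (cod1 f) (cod1 f) [(0, [])])) u = u"
proof -
  let ?I = "OneMor (cod1 f) (cod1 f) [(0, [])]"
  have I: "Uid2 c t b ?I \<in> H ?I ?I" by (intro Uid2_in) (simp add: U1_def)
  have fI: "Ucomp1 ?I f = f" "Ucomp1 ?I g = g"
    using unit_Ucomp1[of f] unit_Ucomp1[of g] hom2_cod1[OF u] by simp_all
  show ?thesis
  proof (rule hom2_eqI[OF _ u])
    show "Uhcomp c t b (Uid2 c t b ?I) u \<in> H f g"
      using Uhcomp_in[OF u I] fI by simp
    fix k l assume kl: "k < nsum g" "l < nsum f"
    have [simp]: "nsum ?I = 1" by (simp add: nsum_def)
    have "f \<in> U1 c" using hom2_parallel[OF u] by (simp add: parallel_def)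
    then have "hc (ide ?I 0) (entry u k l) = entry u k l"
      using hom2_entry[OF u kl] U1_cod[of f c l] kl
      unfolding entry_cells_eq id_entry_def by (auto simp: unit_hcell)
    then show "entry (Uhcomp c t b (Uid2 c t b ?I) u) k l = entry u k l"
      using entry_Uhcomp[OF u I, unfolded fI, OF kl] kl by (simp add: entry_Uid2)
  qed
qed

lemma Uhcomp_Uid2:
  assumes f: "f \<in> U1 c" "g \<in> U1 c" "cod1 f = dom1 g"
  shows "Uhcomp c t b (Uid2 c t b g) (Uid2 c t b f) = Uid2 c t b (Ucomp1 g f)"
proof -
  note If = Uid2_in[OF f(1)] and Ig = Uid2_in[OF f(2)]
  show ?thesis
  proof (rule hom2_eqI[OF Uhcomp_in[OF If Ig f(3)] Uid2_in[OF Ucomp1_in[OF f]]])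
    fix k l assume kl: "k < nsum (Ucomp1 g f)" "l < nsum (Ucomp1 g f)"
    note h = hparI[OF If Ig f(3) kl]
    note bd = hpar_bounds[OF h]
    \<comment> \<open>Two pairs of summands coincide iff both digits do. If a digit differs, the
      corresponding factor is a zero cell and makes the composite zero.\<close>
    have kl_eq: "k = l \<longleftrightarrow> k div nsum f = l div nsum f \<and> k mod nsum f = l mod nsum f"
      by (metis div_mult_mod_eq)
    have e: "entry (Uid2 c t b f) (k mod nsum f) (l mod nsum f) \<in> ec f f (k mod nsum f) (l mod nsum f)"
        "entry (Uid2 c t b g) (k div nsum f) (l div nsum f) \<in> ec g g (k div nsum f) (l div nsum f)"
      using hom2_entry[OF If bd(2,4)] hom2_entry[OF Ig bd(1,3)] .
    have "hc (entry (Uid2 c t b g) (k div nsum f) (l div nsum f)) (entry (Uid2 c t b f) (k mod nsum f) (l mod nsum f)) =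
        (if k = l then ide (Ucomp1 g f) k else zee (Ucomp1 g f) (Ucomp1 g f) k l)"
    proof (cases "k div nsum f = l div nsum f")
      case False
      then have "entry (Uid2 c t b g) (k div nsum f) (l div nsum f) = zee g g (k div nsum f) (l div nsum f)"
        using bd by (simp add: entry_Uid2)
      with False hcell_zero_entry_left[OF h e(1)] show ?thesis by auto
    next
      case True
      show ?thesis
      proof (cases "k mod nsum f = l mod nsum f")
        case False
        then have "entry (Uid2 c t b f) (k mod nsum f) (l mod nsum f) = zee f f (k mod nsum f) (l mod nsum f)"
          using bd by (simp add: entry_Uid2)
        with False hcell_zero_entry_right[OF h e(2)] show ?thesis by auto
      next
        case eq: True
        with True kl_eq have "k = l" by blast
        with bd hpar_wt[OF h] kl hcell_id show ?thesis
          by (simp add: entry_Uid2 id_entry_def nth_Ucomp1 hcell_id)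
      qed
    qed
    with entry_Uhcomp[OF If Ig kl] kl
    show "entry (Uhcomp c t b (Uid2 c t b g) (Uid2 c t b f)) k l = entry (Uid2 c t b (Ucomp1 g f)) k l"
      by (simp add: entry_Uid2)
  qed
qed

text \<open>On the left both factors are sums, and bilinearity turns the entry into a double sum.
  The interchange law for cells applies to each term, and the double sum is the single sum over the
  summands of \<open>Ucomp1 g' g\<close> that the right side asks for.\<close>

lemma U_interchange:
  assumes u: "u \<in> H f g" and v: "v \<in> H g h" and u': "u' \<in> H f' g'" and v': "v' \<in> H g' h'"
    and f: "cod1 f = dom1 f'"
  shows "Uhcomp c t b (Uvcomp c t b v' u') (Uvcomp c t b v u) =
    Uvcomp c t b (Uhcomp c t b v' v) (Uhcomp c t b u' u)"
proof -
  have g: "cod1 g = dom1 g'" using f hom2_cod1[OF u] hom2_dom1[OF u'] by simp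
  note vu = Uvcomp_in[OF u v] and vu' = Uvcomp_in[OF u' v']
  note hu = Uhcomp_in[OF u u' f] and hv = Uhcomp_in[OF v v' g]
  show ?thesis
  proof (rule hom2_eqI[OF Uhcomp_in[OF vu vu' f] Uvcomp_in[OF hu hv]])
    fix k l assume kl: "k < nsum (Ucomp1 h' h)" "l < nsum (Ucomp1 f' f)"
    note hh = hparI[OF vu vu' f kl]
    note bd = hpar_bounds[OF hh]
    define k1 k2 l1 l2 where kl12: "k1 = k div nsum h" "k2 = k mod nsum h" "l1 = l div nsum f" "l2 = l mod nsum f"
    note bd' = bd[folded kl12]
    interpret carrier_comm_monoid "ec (Ucomp1 f' f) (Ucomp1 h' h) k l" ad "zee (Ucomp1 f' f) (Ucomp1 h' h) k l"
      using hom2_parallel[OF Uhcomp_in[OF vu vu' f]] kl by (rule entry_monoid)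
    have in': "vc (entry v' k1 r) (entry u' r l1) \<in> ec f' h' k1 l1" if "r < nsum g'" for r
      using that bd' by (auto intro!: vcell_entry_in hom2_entry[OF u'] hom2_entry[OF v'] hom2_dom1[OF u'])
    have in0: "vc (entry v k2 s) (entry u s l2) \<in> ec f h k2 l2" if "s < nsum g" for s
      using that bd' by (auto intro!: vcell_entry_in hom2_entry[OF u] hom2_entry[OF v] hom2_dom1[OF u])
    have swap: "hc (vc (entry v' k1 r) (entry u' r l1)) (vc (entry v k2 s) (entry u s l2)) =
        vc (hc (entry v' k1 r) (entry v k2 s)) (hc (entry u' r l1) (entry u s l2))"
      if "r < nsum g'" "s < nsum g" for r s
      using hom2_entry[OF v' bd'(1) that(1)] hom2_entry[OF u' that(1) bd'(3)]
        hom2_entry[OF v bd'(2) that(2)] hom2_entry[OF u that(2) bd'(4)]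
        hpar_wt[OF hh, folded kl12] hom2_dom1[OF u'] hom2_dom1[OF u]
      unfolding entry_cells_eq by (intro cell_interchange) simp_all
    have "entry (Uhcomp c t b (Uvcomp c t b v' u') (Uvcomp c t b v u)) k l =
        hc (foldr ad (map (\<lambda>r. vc (entry v' k1 r) (entry u' r l1)) [0..<nsum g']) (zee f' h' k1 l1))
          (foldr ad (map (\<lambda>s. vc (entry v k2 s) (entry u s l2)) [0..<nsum g]) (zee f h k2 l2))"
      unfolding entry_Uhcomp[OF vu vu' kl] kl12[symmetric]
        entry_Uvcomp[OF u v bd'(2,4)] entry_Uvcomp[OF u' v' bd'(1,3)] ..
    also have "\<dots> = lsum (\<lambda>r. hc (vc (entry v' k1 r) (entry u' r l1))
          (foldr ad (map (\<lambda>s. vc (entry v k2 s) (entry u s l2)) [0..<nsum g]) (zee f h k2 l2))) [0..<nsum g']"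
      unfolding kl12
    proof (rule hcell_sum_left[OF hh])
      show "foldr ad (map (\<lambda>s. vc (entry v (k mod nsum h) s) (entry u s (l mod nsum f))) [0..<nsum g])
          (zee f h (k mod nsum h) (l mod nsum f)) \<in> ec f h (k mod nsum h) (l mod nsum f)"
        using hom2_entry[OF vu bd(2,4)] unfolding entry_Uvcomp[OF u v bd(2,4)] .
    qed (use in' in \<open>auto simp: kl12\<close>)
    also have "\<dots> = lsum (\<lambda>r. lsum (\<lambda>s. hc (vc (entry v' k1 r) (entry u' r l1))
          (vc (entry v k2 s) (entry u s l2))) [0..<nsum g]) [0..<nsum g']"
      unfolding kl12 by (intro foldr_map_cong hcell_sum_right[OF hh]) (use in' in0 in \<open>auto simp: kl12\<close>)
    also have "\<dots> = lsum (\<lambda>r. lsum (\<lambda>s. vc (hc (entry v' k1 r) (entry v k2 s))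
          (hc (entry u' r l1) (entry u s l2))) [0..<nsum g]) [0..<nsum g']"
      by (intro foldr_map_cong swap) auto
    also have "\<dots> = lsum (\<lambda>p. vc (hc (entry v' k1 (p div nsum g)) (entry v k2 (p mod nsum g)))
          (hc (entry u' (p div nsum g) l1) (entry u (p mod nsum g) l2))) [0..<nsum g' * nsum g]"
    proof (rule lsum_div_mod[symmetric])
      fix r s assume rs: "r < nsum g'" "s < nsum g"
      show "vc (hc (entry v' k1 r) (entry v k2 s)) (hc (entry u' r l1) (entry u s l2)) \<in>
          ec (Ucomp1 f' f) (Ucomp1 h' h) k l"
        unfolding swap[OF rs, symmetric]
        using in'[OF rs(1)] in0[OF rs(2)] unfolding kl12 by (rule hcell_entry_in[OF hh])
    qed
    also have "\<dots> = entry (Uvcomp c t b (Uhcomp c t b v' v) (Uhcomp c t b u' u)) k l"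
      unfolding entry_Uvcomp[OF hu hv kl] nsum_Ucomp1
      using kl by (intro foldr_map_cong) (simp add: entry_Uhcomp[OF u u'] entry_Uhcomp[OF v v'] kl12)
    finally show "entry (Uhcomp c t b (Uvcomp c t b v' u') (Uvcomp c t b v u)) k l = \<dots>" .
  qed
qed

lemma strict_2category_Ucat: "strict_2category (Ucat c t b)"
proof
  let ?C = "Ucat c t b"
  fix f g h k f' g' h' f'' g'' u v w u' v' u'' a d e m
  note [simp] = Ucat_sel hom1_Ucat
  show "f \<in> Mor1 ?C \<Longrightarrow> src1 ?C f \<in> Obj ?C" "f \<in> Mor1 ?C \<Longrightarrow> tgt1 ?C f \<in> Obj ?C"
    "a \<in> Obj ?C \<Longrightarrow> id1 ?C a \<in> hom1 ?C a a"
    by (simp_all add: U1_def)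
  show "f \<in> hom1 ?C a d \<Longrightarrow> g \<in> hom1 ?C d e \<Longrightarrow> comp1 ?C g f \<in> hom1 ?C a e"
    "f \<in> hom1 ?C a d \<Longrightarrow> g \<in> hom1 ?C d e \<Longrightarrow> h \<in> hom1 ?C e m \<Longrightarrow>
      comp1 ?C (comp1 ?C h g) f = comp1 ?C h (comp1 ?C g f)"
    by (auto simp: Ucomp1_in Ucomp1_assoc)
  show "f \<in> hom1 ?C a d \<Longrightarrow> comp1 ?C f (id1 ?C a) = f" "f \<in> hom1 ?C a d \<Longrightarrow> comp1 ?C (id1 ?C d) f = f"
    by (auto simp: Ucomp1_unit unit_Ucomp1)
  show "u \<in> Mor2 ?C \<Longrightarrow> \<exists>a b. src2 ?C u \<in> hom1 ?C a b \<and> tgt2 ?C u \<in> hom1 ?C a b"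
    using hom2_parallel[OF Mor2_Ucat[of u]] by (simp add: parallel_def)
  show "f \<in> Mor1 ?C \<Longrightarrow> id2 ?C f \<in> hom2 ?C f f"
    by (simp add: Uid2_in)
  show "u \<in> hom2 ?C f g \<Longrightarrow> v \<in> hom2 ?C g h \<Longrightarrow> vcomp ?C v u \<in> hom2 ?C f h"
    by (simp add: Uvcomp_in)
  show "u \<in> hom2 ?C f g \<Longrightarrow> v \<in> hom2 ?C g h \<Longrightarrow> w \<in> hom2 ?C h k \<Longrightarrow>
      vcomp ?C (vcomp ?C w v) u = vcomp ?C w (vcomp ?C v u)"
    by (simp add: Uvcomp_assoc)
  show "u \<in> hom2 ?C f g \<Longrightarrow> vcomp ?C u (id2 ?C f) = u" "u \<in> hom2 ?C f g \<Longrightarrow> vcomp ?C (id2 ?C g) u = u"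
    by (simp_all add: Uvcomp_Uid2)
  show "f \<in> hom1 ?C a d \<Longrightarrow> f' \<in> hom1 ?C d e \<Longrightarrow> u \<in> hom2 ?C f g \<Longrightarrow> u' \<in> hom2 ?C f' g' \<Longrightarrow>
      hcomp ?C u' u \<in> hom2 ?C (comp1 ?C f' f) (comp1 ?C g' g)"
    by (simp add: Uhcomp_in)
  show "f \<in> hom1 ?C a d \<Longrightarrow> f' \<in> hom1 ?C d e \<Longrightarrow> f'' \<in> hom1 ?C e m \<Longrightarrow>
      u \<in> hom2 ?C f g \<Longrightarrow> u' \<in> hom2 ?C f' g' \<Longrightarrow> u'' \<in> hom2 ?C f'' g'' \<Longrightarrow>
      hcomp ?C (hcomp ?C u'' u') u = hcomp ?C u'' (hcomp ?C u' u)"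
    by (simp add: Uhcomp_assoc)
  show "f \<in> hom1 ?C a d \<Longrightarrow> u \<in> hom2 ?C f g \<Longrightarrow> hcomp ?C u (id2 ?C (id1 ?C a)) = u"
    "f \<in> hom1 ?C a d \<Longrightarrow> u \<in> hom2 ?C f g \<Longrightarrow> hcomp ?C (id2 ?C (id1 ?C d)) u = u"
    using Uhcomp_unit unit_Uhcomp by auto
  show "f \<in> hom1 ?C a d \<Longrightarrow> g \<in> hom1 ?C d e \<Longrightarrow>
      hcomp ?C (id2 ?C g) (id2 ?C f) = id2 ?C (comp1 ?C g f)"
    by (simp add: Uhcomp_Uid2)
  show "f \<in> hom1 ?C a d \<Longrightarrow> f' \<in> hom1 ?C d e \<Longrightarrow> u \<in> hom2 ?C f g \<Longrightarrow> v \<in> hom2 ?C g h \<Longrightarrow>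
      u' \<in> hom2 ?C f' g' \<Longrightarrow> v' \<in> hom2 ?C g' h' \<Longrightarrow>
      hcomp ?C (vcomp ?C v' u') (vcomp ?C v u) = vcomp ?C (hcomp ?C v' v) (hcomp ?C u' u)"
    by (simp add: U_interchange)
qed

section \<open>Linear structure on 2-morphisms\<close>

lemma add_entry_in: "X \<in> ec f g k l \<Longrightarrow> Y \<in> ec f g k l \<Longrightarrow> ad X Y \<in> ec f g k l"
  and smult_entry_in: "X \<in> ec f g k l \<Longrightarrow> sm r X \<in> ec f g k l"
  unfolding entry_cells_eq by (fact add_cell_in smult_cell_in)+

lemma zero2_in: "parallel f g \<Longrightarrow> Zr f g \<in> H f g"
  unfolding Ucat_sel by (intro matrix2_in zero_entry_in)

lemma add2_in: "u \<in> H f g \<Longrightarrow> v \<in> H f g \<Longrightarrow> Ad u v \<in> H f g"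
  unfolding Ucat_sel(14)
  by (simp add: hom2_dom hom2_cod) (intro matrix2_in add_entry_in hom2_entry hom2_parallel)

lemma smult2_in: "u \<in> H f g \<Longrightarrow> Sm r u \<in> H f g"
  unfolding Ucat_sel(15)
  by (simp add: hom2_dom hom2_cod) (intro matrix2_in smult_entry_in hom2_entry hom2_parallel)

lemma entry_zero2: "k < nsum g \<Longrightarrow> l < nsum f \<Longrightarrow> entry (Zr f g) k l = zee f g k l"
  by (simp add: Ucat_sel)

lemma entry_add2:
  "u \<in> H f g \<Longrightarrow> k < nsum g \<Longrightarrow> l < nsum f \<Longrightarrow> entry (Ad u v) k l = ad (entry u k l) (entry v k l)"
  by (simp add: Ucat_sel hom2_dom hom2_cod)

lemma entry_smult2:
  "u \<in> H f g \<Longrightarrow> k < nsum g \<Longrightarrow> l < nsum f \<Longrightarrow> entry (Sm r u) k l = sm r (entry u k l)"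
  by (simp add: Ucat_sel hom2_dom hom2_cod)

lemma add2_assoc:
  assumes "u \<in> H f g" "v \<in> H f g" "w \<in> H f g"
  shows "Ad (Ad u v) w = Ad u (Ad v w)"
proof (rule hom2_eqI)
  fix k l assume kl: "k < nsum g" "l < nsum f"
  show "entry (Ad (Ad u v) w) k l = entry (Ad u (Ad v w)) k l"
    using add_cell_assoc[OF assms[THEN hom2_entry, OF kl, unfolded entry_cells_eq]] kl
    by (simp add: entry_add2[OF add2_in[OF assms(1,2)]] entry_add2[OF assms(1)] entry_add2[OF assms(2)])
qed (rule assms add2_in)+

lemma add2_commute:
  assumes "u \<in> H f g" "v \<in> H f g"
  shows "Ad u v = Ad v u"
proof (rule hom2_eqI)
  fix k l assume kl: "k < nsum g" "l < nsum f"
  show "entry (Ad u v) k l = entry (Ad v u) k l"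
    using add_cell_commute[OF assms[THEN hom2_entry, OF kl, unfolded entry_cells_eq]] kl
    by (simp add: entry_add2[OF assms(1)] entry_add2[OF assms(2)])
qed (rule assms add2_in)+

lemma add2_zero:
  assumes "u \<in> H f g"
  shows "Ad u (Zr f g) = u"
proof (rule hom2_eqI)
  fix k l assume kl: "k < nsum g" "l < nsum f"
  show "entry (Ad u (Zr f g)) k l = entry u k l"
    using add_cell_zero[OF hom2_entry[OF assms kl, unfolded entry_cells_eq]] kl
    by (simp add: entry_add2[OF assms] entry_zero2 zero_entry_eq)
qed (rule assms add2_in zero2_in hom2_parallel[OF assms])+

lemma add2_neg:
  assumes "u \<in> H f g"
  shows "Ad u (Sm (- 1) u) = Zr f g"
proof (rule hom2_eqI)
  fix k l assume kl: "k < nsum g" "l < nsum f"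
  show "entry (Ad u (Sm (- 1) u)) k l = entry (Zr f g) k l"
    using add_cell_neg[OF hom2_entry[OF assms kl, unfolded entry_cells_eq]] kl
    by (simp add: entry_add2[OF assms] entry_smult2[OF assms] entry_zero2 zero_entry_eq)
qed (rule assms add2_in smult2_in zero2_in hom2_parallel[OF assms])+

lemma smult2_one:
  assumes "u \<in> H f g"
  shows "Sm 1 u = u"
proof (rule hom2_eqI)
  fix k l assume kl: "k < nsum g" "l < nsum f"
  show "entry (Sm 1 u) k l = entry u k l"
    using smult_cell_one[OF hom2_entry[OF assms kl, unfolded entry_cells_eq]] kl
    by (simp add: entry_smult2[OF assms])
qed (rule assms smult2_in)+

lemma smult2_smult2:
  assumes "u \<in> H f g"
  shows "Sm r (Sm s u) = Sm (r * s) u"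
proof (rule hom2_eqI)
  fix k l assume kl: "k < nsum g" "l < nsum f"
  show "entry (Sm r (Sm s u)) k l = entry (Sm (r * s) u) k l"
    using smult_cell_smult[OF hom2_entry[OF assms kl, unfolded entry_cells_eq]] kl
    by (simp add: entry_smult2[OF assms] entry_smult2[OF smult2_in[OF assms]])
qed (rule assms smult2_in)+

lemma smult2_add:
  assumes "u \<in> H f g" "v \<in> H f g"
  shows "Sm r (Ad u v) = Ad (Sm r u) (Sm r v)"
proof (rule hom2_eqI)
  fix k l assume kl: "k < nsum g" "l < nsum f"
  show "entry (Sm r (Ad u v)) k l = entry (Ad (Sm r u) (Sm r v)) k l"
    using smult_cell_add[OF assms[THEN hom2_entry, OF kl, unfolded entry_cells_eq]] kl
    by (simp add: entry_smult2[OF assms(1)] entry_smult2[OF assms(2)] entry_add2[OF assms(1)]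
        entry_smult2[OF add2_in[OF assms]] entry_add2[OF smult2_in[OF assms(1)]])
qed (rule assms smult2_in add2_in)+

lemma add_smult2:
  assumes "u \<in> H f g"
  shows "Sm (r + s) u = Ad (Sm r u) (Sm s u)"
proof (rule hom2_eqI)
  fix k l assume kl: "k < nsum g" "l < nsum f"
  show "entry (Sm (r + s) u) k l = entry (Ad (Sm r u) (Sm s u)) k l"
    using add_smult_cell[OF hom2_entry[OF assms kl, unfolded entry_cells_eq]] kl
    by (simp add: entry_smult2[OF assms] entry_add2[OF smult2_in[OF assms]])
qed (rule assms smult2_in add2_in)+

lemma smult_sum:
  assumes "parallel f g" "k < nsum g" "l < nsum f" "\<And>q. q \<in> set qs \<Longrightarrow> F q \<in> ec f g k l"
  shows "sm r (foldr ad (map F qs) (zee f g k l)) = foldr ad (map (\<lambda>q. sm r (F q)) qs) (zee f g k l)"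
proof -
  interpret carrier_comm_monoid "ec f g k l" ad "zee f g k l"
    using assms(1-3) by (rule entry_monoid)
  show ?thesis
  proof (rule lsum_hom)
    show "sm r (zee f g k l) = zee f g k l"
      using smult_cell_of_zero zero_closed unfolding entry_cells_eq zero_entry_eq by metis
    show "sm r (ad X Y) = ad (sm r X) (sm r Y)" if "X \<in> ec f g k l" "Y \<in> ec f g k l" for X Y
      using that unfolding entry_cells_eq by (rule smult_cell_add)
  qed fact
qed

lemma vcell_entry_linear:
  assumes "dom1 f = dom1 g"
  shows "X \<in> ec g h k r \<Longrightarrow> X' \<in> ec g h k r \<Longrightarrow> Y \<in> ec f g r l \<Longrightarrow> vc (ad X X') Y = ad (vc X Y) (vc X' Y)"
    and "X \<in> ec g h k r \<Longrightarrow> Y \<in> ec f g r l \<Longrightarrow> Y' \<in> ec f g r l \<Longrightarrow> vc X (ad Y Y') = ad (vc X Y) (vc X Y')"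
    and "X \<in> ec g h k r \<Longrightarrow> Y \<in> ec f g r l \<Longrightarrow> vc (sm a X) Y = sm a (vc X Y)"
    and "X \<in> ec g h k r \<Longrightarrow> Y \<in> ec f g r l \<Longrightarrow> vc X (sm a Y) = sm a (vc X Y)"
  unfolding entry_cells_eq assms
  by (fact vcell_add_left vcell_add_right vcell_smult_left vcell_smult_right)+

lemma Uvcomp_add_left:
  assumes u: "u \<in> H f g" and v: "v \<in> H g h" and w: "w \<in> H g h"
  shows "Vc (Ad v w) u = Ad (Vc v u) (Vc w u)"
proof (rule hom2_eqI)
  show "Vc (Ad v w) u \<in> H f h" "Ad (Vc v u) (Vc w u) \<in> H f h"
    using assms by (auto intro: Uvcomp_in add2_in)
  fix k l assume kl: "k < nsum h" "l < nsum f"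
  interpret carrier_comm_monoid "ec f h k l" ad "zee f h k l"
    using hom2_parallel[OF Uvcomp_in[OF u v]] kl by (rule entry_monoid)
  note e = hom2_entry[OF v kl(1)] hom2_entry[OF w kl(1)] hom2_entry[OF u _ kl(2)]
  note e' = vcell_entry_in[OF e(1) e(3) hom2_dom1[OF u]] vcell_entry_in[OF e(2) e(3) hom2_dom1[OF u]]
  have "entry (Vc (Ad v w) u) k l =
      lsum (\<lambda>r. ad (vc (entry v k r) (entry u r l)) (vc (entry w k r) (entry u r l))) [0..<nsum g]"
    unfolding entry_Uvcomp[OF u add2_in[OF v w] kl]
  proof (rule foldr_map_cong)
    fix r assume "r \<in> set [0..<nsum g]"
    then have r: "r < nsum g" by simp
    show "vc (entry (Ad v w) k r) (entry u r l) =
        ad (vc (entry v k r) (entry u r l)) (vc (entry w k r) (entry u r l))"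
      unfolding entry_add2[OF v kl(1) r]
      using e(1)[OF r] e(2)[OF r] e(3)[OF r] by (rule vcell_entry_linear(1)[OF hom2_dom1[OF u]])
  qed
  also have "\<dots> = ad (entry (Vc v u) k l) (entry (Vc w u) k l)"
    unfolding entry_Uvcomp[OF u v kl] entry_Uvcomp[OF u w kl]
    by (rule lsum_add) (simp_all add: e')
  finally show "entry (Vc (Ad v w) u) k l = entry (Ad (Vc v u) (Vc w u)) k l"
    by (simp add: entry_add2[OF Uvcomp_in[OF u v] kl])
qed

lemma Uvcomp_add_right:
  assumes u: "u \<in> H f g" and v: "v \<in> H f g" and w: "w \<in> H g h"
  shows "Vc w (Ad u v) = Ad (Vc w u) (Vc w v)"
proof (rule hom2_eqI)
  show "Vc w (Ad u v) \<in> H f h" "Ad (Vc w u) (Vc w v) \<in> H f h"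
    using assms by (auto intro: Uvcomp_in add2_in)
  fix k l assume kl: "k < nsum h" "l < nsum f"
  interpret carrier_comm_monoid "ec f h k l" ad "zee f h k l"
    using hom2_parallel[OF Uvcomp_in[OF u w]] kl by (rule entry_monoid)
  note e = hom2_entry[OF w kl(1)] hom2_entry[OF u _ kl(2)] hom2_entry[OF v _ kl(2)]
  note e' = vcell_entry_in[OF e(1) e(2) hom2_dom1[OF u]] vcell_entry_in[OF e(1) e(3) hom2_dom1[OF u]]
  have "entry (Vc w (Ad u v)) k l =
      lsum (\<lambda>r. ad (vc (entry w k r) (entry u r l)) (vc (entry w k r) (entry v r l))) [0..<nsum g]"
    unfolding entry_Uvcomp[OF add2_in[OF u v] w kl]
  proof (rule foldr_map_cong)
    fix r assume "r \<in> set [0..<nsum g]"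
    then have r: "r < nsum g" by simp
    show "vc (entry w k r) (entry (Ad u v) r l) =
        ad (vc (entry w k r) (entry u r l)) (vc (entry w k r) (entry v r l))"
      unfolding entry_add2[OF u r kl(2)]
      using e(1)[OF r] e(2)[OF r] e(3)[OF r] by (rule vcell_entry_linear(2)[OF hom2_dom1[OF u]])
  qed
  also have "\<dots> = ad (entry (Vc w u) k l) (entry (Vc w v) k l)"
    unfolding entry_Uvcomp[OF u w kl] entry_Uvcomp[OF v w kl]
    by (rule lsum_add) (simp_all add: e')
  finally show "entry (Vc w (Ad u v)) k l = entry (Ad (Vc w u) (Vc w v)) k l"
    by (simp add: entry_add2[OF Uvcomp_in[OF u w] kl])
qed

lemma Uvcomp_smult:
  assumes u: "u \<in> H f g" and v: "v \<in> H g h"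
  shows "Vc (Sm a v) u = Sm a (Vc v u)" and "Vc v (Sm a u) = Sm a (Vc v u)"
proof -
  have e: "vc (entry v k r) (entry u r l) \<in> ec f h k l"
      "vc (sm a (entry v k r)) (entry u r l) = sm a (vc (entry v k r) (entry u r l))"
      "vc (entry v k r) (sm a (entry u r l)) = sm a (vc (entry v k r) (entry u r l))"
    if "k < nsum h" "r < nsum g" "l < nsum f" for k l r
    using hom2_dom1[OF u] vcell_entry_in[OF hom2_entry[OF v that(1,2)] hom2_entry[OF u that(2,3)]]
      vcell_entry_linear(3,4)[OF _ hom2_entry[OF v that(1,2)] hom2_entry[OF u that(2,3)]] by blast+
  \<comment> \<open>Common form of the three composites: the scalar multiplies every term of the
    sum.\<close>
  have *: "entry (Sm a (Vc v u)) k l =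
      foldr ad (map (\<lambda>r. sm a (vc (entry v k r) (entry u r l))) [0..<nsum g]) (zee f h k l)"
    if "k < nsum h" "l < nsum f" for k l
    unfolding entry_smult2[OF Uvcomp_in[OF u v] that] entry_Uvcomp[OF u v that]
    using that e by (intro smult_sum hom2_parallel[OF Uvcomp_in[OF u v]]) auto
  show "Vc (Sm a v) u = Sm a (Vc v u)"
  proof (rule hom2_eqI[OF Uvcomp_in[OF u smult2_in[OF v]] smult2_in[OF Uvcomp_in[OF u v]]])
    fix k l assume kl: "k < nsum h" "l < nsum f"
    show "entry (Vc (Sm a v) u) k l = entry (Sm a (Vc v u)) k l"
      unfolding *[OF kl] entry_Uvcomp[OF u smult2_in[OF v] kl]
      using kl by (intro foldr_map_cong) (simp add: entry_smult2[OF v] e)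
  qed
  show "Vc v (Sm a u) = Sm a (Vc v u)"
  proof (rule hom2_eqI[OF Uvcomp_in[OF smult2_in[OF u] v] smult2_in[OF Uvcomp_in[OF u v]]])
    fix k l assume kl: "k < nsum h" "l < nsum f"
    show "entry (Vc v (Sm a u)) k l = entry (Sm a (Vc v u)) k l"
      unfolding *[OF kl] entry_Uvcomp[OF smult2_in[OF u] v kl]
      using kl by (intro foldr_map_cong) (simp add: entry_smult2[OF u] e)
  qed
qed

lemma Uhcomp_add_left:
  assumes u: "u \<in> H f g" and u': "u' \<in> H f' g'" and v': "v' \<in> H f' g'" and f: "cod1 f = dom1 f'"
  shows "Hc (Ad u' v') u = Ad (Hc u' u) (Hc v' u)"
proof (rule hom2_eqI)
  note in' = Uhcomp_in[OF u u' f] Uhcomp_in[OF u v' f] Uhcomp_in[OF u add2_in[OF u' v'] f]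
  show "Hc (Ad u' v') u \<in> H (Ucomp1 f' f) (Ucomp1 g' g)" "Ad (Hc u' u) (Hc v' u) \<in> H (Ucomp1 f' f) (Ucomp1 g' g)"
    by (intro add2_in in')+
  fix k l assume kl: "k < nsum (Ucomp1 g' g)" "l < nsum (Ucomp1 f' f)"
  note h = hparI[OF u u' f kl]
  note bd = hpar_bounds[OF h]
  show "entry (Hc (Ad u' v') u) k l = entry (Ad (Hc u' u) (Hc v' u)) k l"
    using hcell_entry_add_left[OF h hom2_entry[OF u] hom2_entry[OF u'] hom2_entry[OF v']] bd
    by (simp add: entry_Uhcomp[OF u add2_in[OF u' v'] kl] entry_add2[OF in'(1) kl] entry_add2[OF u']
        entry_Uhcomp[OF u u' kl] entry_Uhcomp[OF u v' kl])
qed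

lemma Uhcomp_add_right:
  assumes u: "u \<in> H f g" and v: "v \<in> H f g" and u': "u' \<in> H f' g'" and f: "cod1 f = dom1 f'"
  shows "Hc u' (Ad u v) = Ad (Hc u' u) (Hc u' v)"
proof (rule hom2_eqI)
  note in' = Uhcomp_in[OF u u' f] Uhcomp_in[OF v u' f] Uhcomp_in[OF add2_in[OF u v] u' f]
  show "Hc u' (Ad u v) \<in> H (Ucomp1 f' f) (Ucomp1 g' g)" "Ad (Hc u' u) (Hc u' v) \<in> H (Ucomp1 f' f) (Ucomp1 g' g)"
    by (intro add2_in in')+
  fix k l assume kl: "k < nsum (Ucomp1 g' g)" "l < nsum (Ucomp1 f' f)"
  note h = hparI[OF u u' f kl]
  note bd = hpar_bounds[OF h]
  show "entry (Hc u' (Ad u v)) k l = entry (Ad (Hc u' u) (Hc u' v)) k l"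
    using hcell_entry_add_right[OF h hom2_entry[OF u'] hom2_entry[OF u] hom2_entry[OF v]] bd
    by (simp add: entry_Uhcomp[OF add2_in[OF u v] u' kl] entry_add2[OF in'(1) kl] entry_add2[OF u]
        entry_Uhcomp[OF u u' kl] entry_Uhcomp[OF v u' kl])
qed

lemma Uhcomp_smult:
  assumes u: "u \<in> H f g" and u': "u' \<in> H f' g'" and f: "cod1 f = dom1 f'"
  shows "Hc (Sm a u') u = Sm a (Hc u' u)" and "Hc u' (Sm a u) = Sm a (Hc u' u)"
proof -
  note in' = Uhcomp_in[OF u u' f] Uhcomp_in[OF u smult2_in[OF u'] f] Uhcomp_in[OF smult2_in[OF u] u' f]
  have e: "hc (sm a (entry u' (k div nsum g) (l div nsum f))) (entry u (k mod nsum g) (l mod nsum f)) =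
      sm a (hc (entry u' (k div nsum g) (l div nsum f)) (entry u (k mod nsum g) (l mod nsum f)))"
    "hc (entry u' (k div nsum g) (l div nsum f)) (sm a (entry u (k mod nsum g) (l mod nsum f))) =
      sm a (hc (entry u' (k div nsum g) (l div nsum f)) (entry u (k mod nsum g) (l mod nsum f)))"
    and bd: "k div nsum g < nsum g'" "k mod nsum g < nsum g" "l div nsum f < nsum f'" "l mod nsum f < nsum f"
    if kl: "k < nsum (Ucomp1 g' g)" "l < nsum (Ucomp1 f' f)" for k l
  proof -
    note h = hparI[OF u u' f kl]
    show bd: "k div nsum g < nsum g'" "k mod nsum g < nsum g" "l div nsum f < nsum f'" "l mod nsum f < nsum f"
      using hpar_bounds[OF h] .
    note * = hom2_entry[OF u' bd(1,3), unfolded entry_cells_eq hpar_wt[OF h]]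
      hom2_entry[OF u bd(2,4), unfolded entry_cells_eq]
    show "hc (sm a (entry u' (k div nsum g) (l div nsum f))) (entry u (k mod nsum g) (l mod nsum f)) =
      sm a (hc (entry u' (k div nsum g) (l div nsum f)) (entry u (k mod nsum g) (l mod nsum f)))"
      by (rule hcell_smult_left[OF *])
    show "hc (entry u' (k div nsum g) (l div nsum f)) (sm a (entry u (k mod nsum g) (l mod nsum f))) =
      sm a (hc (entry u' (k div nsum g) (l div nsum f)) (entry u (k mod nsum g) (l mod nsum f)))"
      by (rule hcell_smult_right[OF *])
  qed
  show "Hc (Sm a u') u = Sm a (Hc u' u)"
  proof (rule hom2_eqI[OF in'(2) smult2_in[OF in'(1)]])
    fix k l assume kl: "k < nsum (Ucomp1 g' g)" "l < nsum (Ucomp1 f' f)"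
    show "entry (Hc (Sm a u') u) k l = entry (Sm a (Hc u' u)) k l"
      by (simp add: entry_Uhcomp[OF u smult2_in[OF u'] kl] entry_smult2[OF in'(1) kl]
          entry_Uhcomp[OF u u' kl] entry_smult2[OF u' bd(1,3)[OF kl]] e[OF kl])
  qed
  show "Hc u' (Sm a u) = Sm a (Hc u' u)"
  proof (rule hom2_eqI[OF in'(3) smult2_in[OF in'(1)]])
    fix k l assume kl: "k < nsum (Ucomp1 g' g)" "l < nsum (Ucomp1 f' f)"
    show "entry (Hc u' (Sm a u)) k l = entry (Sm a (Hc u' u)) k l"
      by (simp add: entry_Uhcomp[OF smult2_in[OF u] u' kl] entry_smult2[OF in'(1) kl]
          entry_Uhcomp[OF u u' kl] entry_smult2[OF u bd(2,4)[OF kl]] e[OF kl])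
  qed
qed

lemma linear_2category_Ucat: "linear_2category (Ucat c t b)"
proof -
  let ?C = "Ucat c t b"
  interpret strict_2category ?C by (rule strict_2category_Ucat)
  show ?thesis
  proof
    fix f g h f' g' u v w u' v' a d e r s
    note sel [simp] = Ucat_sel(1-12) hom1_Ucat
    show "f \<in> hom1 ?C a d \<Longrightarrow> g \<in> hom1 ?C a d \<Longrightarrow> Zr f g \<in> H f g"
      by (intro zero2_in) (simp add: parallel_def)
    show "u \<in> H f g \<Longrightarrow> v \<in> H f g \<Longrightarrow> Ad u v \<in> H f g" "u \<in> H f g \<Longrightarrow> Sm r u \<in> H f g"
      "u \<in> H f g \<Longrightarrow> v \<in> H f g \<Longrightarrow> w \<in> H f g \<Longrightarrow> Ad (Ad u v) w = Ad u (Ad v w)"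
      "u \<in> H f g \<Longrightarrow> v \<in> H f g \<Longrightarrow> Ad u v = Ad v u"
      "u \<in> H f g \<Longrightarrow> Ad u (Zr f g) = u"
      "u \<in> H f g \<Longrightarrow> Ad u (Sm (- 1) u) = Zr f g"
      "u \<in> H f g \<Longrightarrow> Sm 1 u = u"
      "u \<in> H f g \<Longrightarrow> Sm r (Sm s u) = Sm (r * s) u"
      "u \<in> H f g \<Longrightarrow> v \<in> H f g \<Longrightarrow> Sm r (Ad u v) = Ad (Sm r u) (Sm r v)"
      "u \<in> H f g \<Longrightarrow> Sm (r + s) u = Ad (Sm r u) (Sm s u)"
      by (fact add2_in smult2_in add2_assoc add2_commute add2_zero add2_neg smult2_one smult2_smult2
          smult2_add add_smult2)+
    show "u \<in> H f g \<Longrightarrow> v \<in> H g h \<Longrightarrow> w \<in> H g h \<Longrightarrow>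
        vcomp ?C (Ad v w) u = Ad (vcomp ?C v u) (vcomp ?C w u)"
      "u \<in> H f g \<Longrightarrow> v \<in> H f g \<Longrightarrow> w \<in> H g h \<Longrightarrow>
        vcomp ?C w (Ad u v) = Ad (vcomp ?C w u) (vcomp ?C w v)"
      "u \<in> H f g \<Longrightarrow> v \<in> H g h \<Longrightarrow> vcomp ?C (Sm r v) u = Sm r (vcomp ?C v u)"
      "u \<in> H f g \<Longrightarrow> v \<in> H g h \<Longrightarrow> vcomp ?C v (Sm r u) = Sm r (vcomp ?C v u)"
      unfolding sel by (fact Uvcomp_add_left Uvcomp_add_right Uvcomp_smult)+
    show "f \<in> hom1 ?C a d \<Longrightarrow> f' \<in> hom1 ?C d e \<Longrightarrow> u \<in> H f g \<Longrightarrow> u' \<in> H f' g' \<Longrightarrow> v' \<in> H f' g' \<Longrightarrow>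
        hcomp ?C (Ad u' v') u = Ad (hcomp ?C u' u) (hcomp ?C v' u)"
      "f \<in> hom1 ?C a d \<Longrightarrow> f' \<in> hom1 ?C d e \<Longrightarrow> u \<in> H f g \<Longrightarrow> v \<in> H f g \<Longrightarrow> u' \<in> H f' g' \<Longrightarrow>
        hcomp ?C u' (Ad u v) = Ad (hcomp ?C u' u) (hcomp ?C u' v)"
      "f \<in> hom1 ?C a d \<Longrightarrow> f' \<in> hom1 ?C d e \<Longrightarrow> u \<in> H f g \<Longrightarrow> u' \<in> H f' g' \<Longrightarrow>
        hcomp ?C (Sm r u') u = Sm r (hcomp ?C u' u)"
      "f \<in> hom1 ?C a d \<Longrightarrow> f' \<in> hom1 ?C d e \<Longrightarrow> u \<in> H f g \<Longrightarrow> u' \<in> H f' g' \<Longrightarrow>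
        hcomp ?C u' (Sm r u) = Sm r (hcomp ?C u' u)"
      by (simp_all add: Uhcomp_add_left Uhcomp_add_right Uhcomp_smult)
  qed
qed

section \<open>Grading shifts\<close>

lemma parallel_Ushift1: "parallel f g \<Longrightarrow> parallel (Ushift1 n f) (Ushift1 n g)"
  by (simp add: parallel_def Ushift1_in)

text \<open>The degree of an entry is a difference of shifts, so a common shift leaves the cells in
  place. This is why \<open>shift2\<close> keeps the matrix and changes only its two ends.\<close>

lemma entry_cells_Ushift1:
  "k < nsum g \<Longrightarrow> l < nsum f \<Longrightarrow> ec (Ushift1 n f) (Ushift1 n g) k l = ec f g k l"
  and zero_entry_Ushift1:
  "k < nsum g \<Longrightarrow> l < nsum f \<Longrightarrow> zee (Ushift1 n f) (Ushift1 n g) k l = zee f g k l"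
  and id_entry_Ushift1: "k < nsum f \<Longrightarrow> ide (Ushift1 n f) k = ide f k"
  by (simp_all add: entry_cells_eq zero_entry_eq id_entry_def nth_Ushift1)

lemma entry_shift2 [simp]: "entry (Sh n u) k l = entry u k l"
  by (simp add: Ucat_sel)

lemma shift2_in:
  assumes "u \<in> H f g"
  shows "Sh n u \<in> H (Ushift1 n f) (Ushift1 n g)"
  using assms by (simp add: hom2_Ucat parallel_Ushift1 entry_cells_Ushift1) (simp add: Ucat_sel)

lemma shift2_Uid2:
  assumes "f \<in> U1 c"
  shows "Sh n (Uid2 c t b f) = Uid2 c t b (Ushift1 n f)"
  by (rule hom2_eqI[OF shift2_in[OF Uid2_in[OF assms]] Uid2_in[OF Ushift1_in[OF assms]]])
    (simp add: entry_Uid2 zero_entry_Ushift1 id_entry_Ushift1)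

lemma shift2_Uvcomp:
  assumes u: "u \<in> H f g" and v: "v \<in> H g h"
  shows "Sh n (Vc v u) = Vc (Sh n v) (Sh n u)"
  by (rule hom2_eqI[OF shift2_in[OF Uvcomp_in[OF u v]] Uvcomp_in[OF shift2_in[OF u] shift2_in[OF v]]])
    (simp add: entry_Uvcomp[OF u v] entry_Uvcomp[OF shift2_in[OF u] shift2_in[OF v]] zero_entry_Ushift1)

lemma shift2_Uhcomp:
  assumes u: "u \<in> H f g" and u': "u' \<in> H f' g'" and f: "cod1 f = dom1 f'"
  shows "Hc (Sh m u') (Sh n u) = Sh (m + n) (Hc u' u)"
proof (rule hom2_eqI)
  show in1: "Hc (Sh m u') (Sh n u) \<in> H (Ushift1 (m + n) (Ucomp1 f' f)) (Ushift1 (m + n) (Ucomp1 g' g))"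
    using Uhcomp_in[OF shift2_in[OF u, of n] shift2_in[OF u', of m]] f by (simp add: Ucomp1_Ushift1)
  show "Sh (m + n) (Hc u' u) \<in> H (Ushift1 (m + n) (Ucomp1 f' f)) (Ushift1 (m + n) (Ucomp1 g' g))"
    by (rule shift2_in[OF Uhcomp_in[OF u u' f]])
  show "entry (Hc (Sh m u') (Sh n u)) k l = entry (Sh (m + n) (Hc u' u)) k l"
    if "k < nsum (Ushift1 (m + n) (Ucomp1 g' g))" "l < nsum (Ushift1 (m + n) (Ucomp1 f' f))" for k l
    using that by (simp add: entry_Uhcomp[OF shift2_in[OF u] shift2_in[OF u']] entry_Uhcomp[OF u u'])
qed

lemma shift2_add2:
  assumes u: "u \<in> H f g" and v: "v \<in> H f g"
  shows "Sh n (Ad u v) = Ad (Sh n u) (Sh n v)"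
  by (rule hom2_eqI[OF shift2_in[OF add2_in[OF u v]] add2_in[OF shift2_in[OF u] shift2_in[OF v]]])
    (simp add: entry_add2[OF u] entry_add2[OF shift2_in[OF u]])

lemma shift2_smult2:
  assumes u: "u \<in> H f g"
  shows "Sh n (Sm r u) = Sm r (Sh n u)"
  by (rule hom2_eqI[OF shift2_in[OF smult2_in[OF u]] smult2_in[OF shift2_in[OF u]]])
    (simp add: entry_smult2[OF u] entry_smult2[OF shift2_in[OF u]])

section \<open>Direct sums\<close>

lemma Ucat_biproduct:
  assumes f: "f \<in> U1 c" "g \<in> U1 c" "dom1 f = dom1 g" "cod1 f = cod1 g"
  shows "\<exists>s \<in> U1 c. dom1 s = dom1 f \<and> cod1 s = cod1 f \<and>
    (\<exists>i \<in> H f s. \<exists>j \<in> H g s. \<exists>p \<in> H s f. \<exists>q \<in> H s g.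
      Vc p i = Uid2 c t b f \<and> Vc q j = Uid2 c t b g \<and> Vc p j = Zr g f \<and> Vc q i = Zr f g \<and>
      Ad (Vc i p) (Vc j q) = Uid2 c t b s)"
proof -
  \<comment> \<open>The direct sum is the concatenation of the lists of summands;
    \<open>\<phi>\<close> and \<open>\<psi>\<close> number its two segments.\<close>
  define s where "s = OneMor (dom1 f) (cod1 f) (summands f @ summands g)"
  define \<phi> \<psi> where "\<phi> = (\<lambda>l::nat. l)" and "\<psi> = (\<lambda>l. nsum f + l)"
  have s: "s \<in> U1 c" "nsum s = nsum f + nsum g" "dom1 s = dom1 f" "cod1 s = cod1 f"
    using f by (auto simp: s_def U1_def nsum_def)
  have \<phi>: "summand_map \<phi> f s" and \<psi>: "summand_map \<psi> g s"
    using f s by (auto simp: summand_map_def parallel_def \<phi>_def \<psi>_def s_def nsum_def nth_append)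
  have inj: "inj_on \<phi> {..<nsum f}" "inj_on \<psi> {..<nsum g}"
    by (simp_all add: \<phi>_def \<psi>_def inj_on_def)
  let ?i = "incl_matrix \<phi> f s" and ?j = "incl_matrix \<psi> g s"
    and ?p = "proj_matrix \<phi> s f" and ?q = "proj_matrix \<psi> s g"
  note i = incl_matrix_in[OF \<phi>] and j = incl_matrix_in[OF \<psi>]
    and p = proj_matrix_in[OF \<phi>] and q = proj_matrix_in[OF \<psi>]
  note entries = zero_entry_eq id_entry_def s_def nsum_def nth_append
  have ze: "zee f s k l = zee f f k l" if "k < nsum f" for k l
    using that by (simp add: entries)
  have "Vc ?p ?i = Uid2 c t b f"
  proof (rule hom2_eqI[OF Uvcomp_in[OF i p] Uid2_in[OF f(1)]])
    fix k l assume "k < nsum f" "l < nsum f"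
    then show "entry (Vc ?p ?i) k l = entry (Uid2 c t b f) k l"
      by (simp add: entry_proj_vcomp[OF \<phi> i] entry_Uid2) (simp add: incl_matrix_def \<phi>_def s(2), simp add: entries)
  qed
  moreover have "Vc ?q ?j = Uid2 c t b g"
  proof (rule hom2_eqI[OF Uvcomp_in[OF j q] Uid2_in[OF f(2)]])
    fix k l assume "k < nsum g" "l < nsum g"
    then show "entry (Vc ?q ?j) k l = entry (Uid2 c t b g) k l"
      by (simp add: entry_proj_vcomp[OF \<psi> j] entry_Uid2) (simp add: incl_matrix_def \<psi>_def s(2), simp add: entries)
  qed
  moreover have "Vc ?p ?j = Zr g f"
  proof (rule hom2_eqI[OF Uvcomp_in[OF j p] zero2_in])
    fix k l assume "k < nsum f" "l < nsum g"
    then show "entry (Vc ?p ?j) k l = entry (Zr g f) k l"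
      by (simp add: entry_proj_vcomp[OF \<phi> j] entry_zero2)
        (simp add: incl_matrix_def \<phi>_def \<psi>_def s(2), simp add: entries)
  qed (use f in \<open>simp add: parallel_def\<close>)
  moreover have "Vc ?q ?i = Zr f g"
  proof (rule hom2_eqI[OF Uvcomp_in[OF i q] zero2_in])
    fix k l assume "k < nsum g" "l < nsum f"
    then show "entry (Vc ?q ?i) k l = entry (Zr f g) k l"
      by (simp add: entry_proj_vcomp[OF \<psi> i] entry_zero2)
        (simp add: incl_matrix_def \<phi>_def \<psi>_def s(2), simp add: entries)
  qed (use f in \<open>simp add: parallel_def\<close>)
  moreover have "Ad (Vc ?i ?p) (Vc ?j ?q) = Uid2 c t b s"
  proof (rule hom2_eqI[OF add2_in[OF Uvcomp_in[OF p i] Uvcomp_in[OF q j]] Uid2_in[OF s(1)]])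
    fix k l assume kl: "k < nsum s" "l < nsum s"
    interpret carrier_comm_monoid "ec s s k l" ad "zee s s k l"
      using s(1) kl by (intro entry_monoid) (simp_all add: parallel_def)
    have in': "entry (Uid2 c t b s) k l \<in> ec s s k l"
      by (rule hom2_entry[OF Uid2_in[OF s(1)] kl])
    \<comment> \<open>Row \<open>k\<close> lies in exactly one of the two segments. The term of that
      segment is row \<open>k\<close> of the identity, the other term is zero.\<close>
    have "ad (entry (Vc ?i ?p) k l) (entry (Vc ?j ?q) k l) = entry (Uid2 c t b s) k l"
    proof (cases "k < nsum f")
      case True
      have "entry (Vc ?i ?p) k l = entry ?p k l"
        by (rule entry_incl_vcomp(1)[OF \<phi> p kl(2,1) inj(1) True]) (simp add: \<phi>_def)
      also have "\<dots> = entry (Uid2 c t b s) k l"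
        using kl True by (simp add: \<phi>_def entry_Uid2 proj_matrix_def) (simp add: entries)
      finally have "entry (Vc ?i ?p) k l = entry (Uid2 c t b s) k l" .
      moreover from True have "k \<notin> \<psi> ` {..<nsum g}" by (auto simp: \<psi>_def)
      ultimately show ?thesis
        using in' by (simp add: entry_incl_vcomp(2)[OF \<psi> q kl(2,1) inj(2)] right_zero)
    next
      case False
      then have k: "k - nsum f < nsum g" "k = \<psi> (k - nsum f)" using kl s(2) by (auto simp: \<psi>_def)
      have "entry (Vc ?j ?q) k l = entry ?q (k - nsum f) l"
        by (rule entry_incl_vcomp(1)[OF \<psi> q kl(2,1) inj(2) k])
      also have "\<dots> = entry (Uid2 c t b s) k l"
        using kl k False by (simp add: \<psi>_def entry_Uid2 proj_matrix_def) (simp add: entries f(3))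
      finally have "entry (Vc ?j ?q) k l = entry (Uid2 c t b s) k l" .
      moreover from False have "k \<notin> \<phi> ` {..<nsum f}" by (auto simp: \<phi>_def)
      ultimately show ?thesis
        using in' by (simp add: entry_incl_vcomp(2)[OF \<phi> p kl(2,1) inj(1)] left_zero)
    qed
    then show "entry (Ad (Vc ?i ?p) (Vc ?j ?q)) k l = entry (Uid2 c t b s) k l"
      by (simp add: entry_add2[OF Uvcomp_in[OF p i] kl])
  qed
  ultimately show ?thesis using s i j p q by blast
qed

theorem graded_additive_2category_Ucat: "graded_additive_2category (Ucat c t b)"
proof -
  let ?C = "Ucat c t b"
  interpret linear_2category ?C by (rule linear_2category_Ucat)
  show ?thesis
  proof
    fix f g h f' g' u v u' a d e r m n
    note sel = Ucat_sel(1-12) hom1_Ucat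
    show "\<exists>z \<in> hom1 ?C a d. id2 ?C z = Zr z z"
    proof
      \<comment> \<open>The empty direct sum is a zero object: a matrix from or to it has no
        entries.\<close>
      show "OneMor a d [] \<in> hom1 ?C a d" by (simp add: sel U1_def)
      then show "id2 ?C (OneMor a d []) = Zr (OneMor a d []) (OneMor a d [])"
        by (intro hom2_eqI[OF _ zero2_in]) (auto simp: sel Uid2_in parallel_def nsum_def)
    qed
    show "f \<in> hom1 ?C a d \<Longrightarrow> g \<in> hom1 ?C a d \<Longrightarrow>
      \<exists>s \<in> hom1 ?C a d. \<exists>i \<in> H f s. \<exists>j \<in> H g s. \<exists>p \<in> H s f. \<exists>q \<in> H s g.
        vcomp ?C p i = id2 ?C f \<and> vcomp ?C q j = id2 ?C g \<and>
        vcomp ?C p j = Zr g f \<and> vcomp ?C q i = Zr f g \<and>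
        Ad (vcomp ?C i p) (vcomp ?C j q) = id2 ?C s"
      using Ucat_biproduct[of f g] unfolding sel Bex_def[of "hom1 ?C a d"] Bex_def[of "U1 c"] by metis
    show "f \<in> hom1 ?C a d \<Longrightarrow> shift1 ?C n f \<in> hom1 ?C a d"
      "u \<in> H f g \<Longrightarrow> Sh n u \<in> H (shift1 ?C n f) (shift1 ?C n g)"
      "f \<in> Mor1 ?C \<Longrightarrow> shift1 ?C 0 f = f"
      "f \<in> Mor1 ?C \<Longrightarrow> shift1 ?C m (shift1 ?C n f) = shift1 ?C (m + n) f"
      by (simp_all add: sel Ushift1_in shift2_in Ushift1_0 Ushift1_Ushift1)
    show "u \<in> Mor2 ?C \<Longrightarrow> Sh 0 u = u" "u \<in> Mor2 ?C \<Longrightarrow> Sh m (Sh n u) = Sh (m + n) u"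
      by (simp_all add: Ucat_sel(16) Ushift1_0 Ushift1_Ushift1)
    show "f \<in> Mor1 ?C \<Longrightarrow> Sh n (id2 ?C f) = id2 ?C (shift1 ?C n f)"
      "u \<in> H f g \<Longrightarrow> v \<in> H g h \<Longrightarrow> Sh n (vcomp ?C v u) = vcomp ?C (Sh n v) (Sh n u)"
      "u \<in> H f g \<Longrightarrow> v \<in> H f g \<Longrightarrow> Sh n (Ad u v) = Ad (Sh n u) (Sh n v)"
      by (simp_all add: sel shift2_Uid2 shift2_Uvcomp shift2_add2)
    show "u \<in> Mor2 ?C \<Longrightarrow> Sh n (Sm r u) = Sm r (Sh n u)"
      by (rule shift2_smult2[OF Mor2_Ucat])
    show "f \<in> hom1 ?C a d \<Longrightarrow> g \<in> hom1 ?C d e \<Longrightarrow>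
        comp1 ?C (shift1 ?C m g) (shift1 ?C n f) = shift1 ?C (m + n) (comp1 ?C g f)"
      "f \<in> hom1 ?C a d \<Longrightarrow> f' \<in> hom1 ?C d e \<Longrightarrow> u \<in> H f g \<Longrightarrow> u' \<in> H f' g' \<Longrightarrow>
        hcomp ?C (Sh m u') (Sh n u) = Sh (m + n) (hcomp ?C u' u)"
      by (simp_all add: sel Ucomp1_Ushift1 shift2_Uhcomp)
  qed
qed

end


section \<open>Rescaling\<close>

context cartan_datum
begin

text \<open>The form sees the Cartan integers only through \<open>of_int\<close>, which is injective
  because \<open>'r\<close> has characteristic zero.\<close>

lemma cdot_sym: "cdot c i j = cdot c j i"
proof -
  have "(of_int (cdot c i j) :: 'r) = of_int (cdot c j i)"
    unfolding cdot_def coroot_form by (rule form_sym)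
  then show ?thesis by simp
qed

lemma cdot_diag: "cdot c i i = 2"
proof -
  have "(of_int (cdot c i i) :: 'r) = of_int 2"
    unfolding cdot_def coroot_form form_diag by simp
  then show ?thesis by (simp only: of_int_eq_iff)
qed

lemma cdot_offdiag: "i \<noteq> j \<Longrightarrow> cdot c i j \<in> {0, - 1}"
proof -
  assume "i \<noteq> j"
  then have "(of_int (cdot c i j) :: 'r) = of_int 0 \<or> (of_int (cdot c i j) :: 'r) = of_int (- 1)"
    unfolding cdot_def coroot_form using form_offdiag by simp
  then show ?thesis by (simp only: of_int_eq_iff) simp
qed

lemma choice_of_scalars_rescale:
  assumes "choice_of_scalars c t" "\<And>i. D i \<noteq> 0"
  shows "choice_of_scalars c (rescale_scalars c D t b)"
  using assms cdot_sym by (auto simp: choice_of_scalars_def rescale_scalars_def)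

text \<open>The three cases of the rescaled scalars are the single factor
  \<open>D i powi (- cdot c i j)\<close>, with Cartan integer 2, -1 or 0. It is also the change of
  the power in \<open>cplus\<close> when \<open>v\<close> moves by \<open>alpha c j\<close>, and of
  the power in \<open>cminus\<close> when \<open>v\<close> moves by the opposite root.\<close>

lemma compatible_rescale:
  assumes "compatible c t b" "\<And>i. D i \<noteq> 0"
  shows "compatible c (rescale_scalars c D t b) (rescale_params c D b)"
proof -
  have nz: "nonzero_params b" and
    comp: "cplus b i v * cminus b i v = - 1 / beta b i"
      "cplus b i (v + alpha c j) = tfull t b i j * cplus b i v"
      "cminus b i (v - alpha c j) = tfull t b i j * cminus b i v" for i j v
    using assms(1) unfolding compatible_def by blast+
  have root: "coroot c i (v + alpha c j) = coroot c i v + cdot c i j"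
    "coroot c i (v - alpha c j) = coroot c i v - cdot c i j" for i j v
    using coroot_hom[of i] unfolding cdot_def by (simp_all add: additive.add additive.diff)
  have tf: "tfull (rescale_scalars c D t b) (rescale_params c D b) i j =
      D i powi (- cdot c i j) * tfull t b i j" for i j
    using cdot_offdiag[of i j]
    by (auto simp: tfull_def rescale_scalars_def rescale_params_def cdot_diag)
  show ?thesis
    unfolding compatible_def tf
  proof (intro conjI allI)
    show "nonzero_params (rescale_params c D b)"
      using nz assms(2) by (simp add: nonzero_params_def rescale_params_def)
    fix i j v
    \<comment> \<open>The weight cancels from the exponents, so the product of the two constants
      changes by a factor independent of \<open>v\<close>; the power \<open>D i powi (- 2)\<close>
      in \<open>beta\<close> compensates it.\<close>
    have "D i powi (- coroot c i v + 1) * D i powi (coroot c i v + 1) = D i powi 2"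
      using assms(2) by (simp add: power_int_add[symmetric])
    then have "cplus (rescale_params c D b) i v * cminus (rescale_params c D b) i v =
        D i powi 2 * (cplus b i v * cminus b i v)"
      by (simp add: rescale_params_def algebra_simps)
    also have "\<dots> = - 1 / beta (rescale_params c D b) i"
      using assms(2) unfolding comp(1) by (simp add: rescale_params_def power_int_minus divide_simps)
    finally show "cplus (rescale_params c D b) i v * cminus (rescale_params c D b) i v =
        - 1 / beta (rescale_params c D b) i" .
    show "cplus (rescale_params c D b) i (v + alpha c j) =
        D i powi - cdot c i j * tfull t b i j * cplus (rescale_params c D b) i v"
      using assms(2) power_int_add[of "D i" "- cdot c i j" "- coroot c i v + 1"]
      by (simp add: rescale_params_def comp root algebra_simps)
    show "cminus (rescale_params c D b) i (v - alpha c j) =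
        D i powi - cdot c i j * tfull t b i j * cminus (rescale_params c D b) i v"
      using assms(2) power_int_add[of "D i" "- cdot c i j" "coroot c i v + 1"]
      by (simp add: rescale_params_def comp root algebra_simps)
  qed
qed

end

section \<open>Rescaling formal expressions\<close>

fun gen_scale :: "('i \<Rightarrow> 'k::field) \<Rightarrow> 'i gen \<Rightarrow> 'k" where
  "gen_scale D (Dot i) = D i"
| "gen_scale D (Cross i j) = (if i = j then inverse (D i) else 1)"
| "gen_scale D _ = 1"

definition diag_scale :: "('i \<Rightarrow> 'k::field) \<Rightarrow> ('i word \<times> 'i gen \<times> 'i word) list \<Rightarrow> 'k" where
  "diag_scale D ls = (\<Prod>(w, g, z)\<leftarrow>ls. gen_scale D g)"

lemma diag_scale_simps [simp]:
  "diag_scale D [] = 1"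
  "diag_scale D ((w, g, z) # ls) = gen_scale D g * diag_scale D ls"
  "diag_scale D (ls @ ls') = diag_scale D ls * diag_scale D ls'"
  "diag_scale D (replicate m (w, g, z)) = gen_scale D g ^ m"
  by (simp_all add: diag_scale_def map_replicate)

text \<open>Defined on raw expressions, it commutes with all operations by definition; what has to
  be proved is that it descends to classes.\<close>

primrec rescale_tm :: "('i \<Rightarrow> 'k::field) \<Rightarrow> ('i,'x,'k) tm \<Rightarrow> ('i,'x,'k) tm" where
  "rescale_tm D (TGen g v) = TScale (gen_scale D g) (TGen g v)"
| "rescale_tm D (TId w v) = TId w v"
| "rescale_tm D (TV s u) = TV (rescale_tm D s) (rescale_tm D u)"
| "rescale_tm D (TH s u) = TH (rescale_tm D s) (rescale_tm D u)"
| "rescale_tm D (TZero w w' v d) = TZero w w' v d"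
| "rescale_tm D (TAdd s u) = TAdd (rescale_tm D s) (rescale_tm D u)"
| "rescale_tm D (TScale r s) = TScale r (rescale_tm D s)"

lemma typed_rescale_tm [simp]: "typed c (rescale_tm D s) w w' v d \<longleftrightarrow> typed c s w w' v d"
  by (induction s arbitrary: w w' v d) (simp_all add: typed_TV typed_TH)

text \<open>Each generator ends up under two nested scalars with product 1, which
  \<open>Scale_Scale\<close> and \<open>Scale_one\<close> remove. The result is an equivalence
  rather than an equality, valid for arbitrary \<open>t\<close> and \<open>b\<close>.\<close>

lemma rescale_tm_inverse:
  assumes D: "\<And>i. D i \<noteq> (0::'k::field)"
  shows "typed c s w w' v d \<Longrightarrow> eqv c t b (rescale_tm (\<lambda>i. inverse (D i)) (rescale_tm D s)) s"
proof (induction s arbitrary: w w' v d)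
  case (TGen g u)
  have "gen_scale D g * gen_scale (\<lambda>i. inverse (D i)) g = 1"
    using D by (cases g) auto
  moreover have "typed c (TGen g u) (gdom g) (gcod g) u (gdeg c g u)" by simp
  ultimately show ?case
    by (metis eqv.Scale_Scale eqv.Scale_one eqv_trans rescale_tm.simps(1,7))
next
  case (TV s u)
  then obtain z d1 d2 where *: "typed c s z w' v d1" "typed c u w z v d2"
    unfolding typed_TV by blast
  have "typed c (TV (rescale_tm (\<lambda>i. inverse (D i)) (rescale_tm D s))
      (rescale_tm (\<lambda>i. inverse (D i)) (rescale_tm D u))) w w' v d"
    using TV.prems unfolding typed_TV by simp
  with TV.IH(1)[OF *(1)] TV.IH(2)[OF *(2)] show ?case by (auto intro: eqv_V)
next
  case (TH s u)
  then obtain x x' z z' d1 d2 where *: "typed c s x x' (v + wwt c z) d1" "typed c u z z' v d2"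
    unfolding typed_TH by blast
  have "typed c (TH (rescale_tm (\<lambda>i. inverse (D i)) (rescale_tm D s))
      (rescale_tm (\<lambda>i. inverse (D i)) (rescale_tm D u))) w w' v d"
    using TH.prems unfolding typed_TH by simp
  with TH.IH(1)[OF *(1)] TH.IH(2)[OF *(2)] show ?case by (auto intro: eqv_H)
next
  case (TAdd s u)
  then show ?case by (auto intro!: eqv_Add[of _ _ _ _ _ _ _ w w' v d])
next
  case (TScale r s)
  then show ?case by (auto intro: eqv_Scale)
qed (auto intro!: eqv_refl)

text \<open>The conditions concern \<open>t'\<close> off the diagonal only, which makes them
  reversible: \<open>t\<close> arises from \<open>t'\<close> through the inverses of the
  \<open>D i\<close> in the same sense. The locale can therefore be interpreted backwards to provide
  the inverse functor.\<close>

locale rescaling = cartan_datum c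
  for c :: "('i, 'x::ab_group_add, 'r::{comm_ring_1,ring_char_0}) cartan" +
  fixes D :: "'i \<Rightarrow> 'k::field"
    and t t' :: "'i \<Rightarrow> 'i \<Rightarrow> 'k" and b b' :: "('i,'x,'k) bubble_params"
  assumes D_nonzero: "D i \<noteq> 0"
    and t'_minus: "i \<noteq> j \<Longrightarrow> cdot c i j = - 1 \<Longrightarrow> t' i j = D i * t i j"
    and t'_zero: "i \<noteq> j \<Longrightarrow> cdot c i j = 0 \<Longrightarrow> t' i j = t i j"
    and b'_eq: "b' = rescale_params c D b"
begin

section \<open>Homogeneity of expressions\<close>

abbreviation "resc \<equiv> rescale_tm D"

lemma beta': "beta b' i = D i powi (- 2) * beta b i"
  and cplus': "cplus b' i v = D i powi (- coroot c i v + 1) * cplus b i v"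
  and cminus': "cminus b' i v = D i powi (coroot c i v + 1) * cminus b i v"
  by (simp_all add: b'_eq rescale_params_def)

text \<open>The rescaling multiplies \<open>s\<close> by \<open>r\<close>, except that scalars depending on the parameters change
  from their values in \<open>s\<close> to those in \<open>s'\<close>.  The condition is only imposed on well-typed
  expressions, so that it can be established without typing side conditions.\<close>

definition scales :: "'k \<Rightarrow> ('i,'x,'k) tm \<Rightarrow> ('i,'x,'k) tm \<Rightarrow> bool" where
  "scales r s s' \<longleftrightarrow> (\<forall>w w' v d. typed c s w w' v d \<longrightarrow>
     typed c s' w w' v d \<and> cls c t' b' (resc s) = smult_cell c t' b' r (cls c t' b' s'))"

lemma scalesI:
  "(\<And>w w' v d. typed c s w w' v d \<Longrightarrow> typed c s' w w' v d) \<Longrightarrow>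
   (\<And>w w' v d. typed c s w w' v d \<Longrightarrow> typed c s' w w' v d \<Longrightarrow>
      cls c t' b' (resc s) = smult_cell c t' b' r (cls c t' b' s')) \<Longrightarrow> scales r s s'"
  unfolding scales_def by blast

lemma scales_gen: "scales (gen_scale D g) (TGen g v) (TGen g v)"
  by (rule scalesI) (simp_all add: smult_cell_cls)

lemma scales_id: "scales 1 (TId w v) (TId w v)"
  by (rule scalesI) (simp_all add: smult_cell_one)

text \<open>Zero scales by every factor, so a relation that equates a diagram with zero imposes no
  condition on the factor of the diagram.\<close>

lemma scales_zero: "scales r (TZero w w' v d) (TZero w w' v d)"
  by (rule scalesI) (simp_all add: smult_cell_of_zero[of "cls c t' b' (TZero w w' v d)"])

lemma scales_V:
  assumes "scales r s s'" "scales q u u'"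
  shows "scales (r * q) (TV s u) (TV s' u')"
  unfolding scales_def
proof (intro allI impI)
  fix w w' v d assume "typed c (TV s u) w w' v d"
  then obtain z d1 d2 where ty: "typed c s z w' v d1" "typed c u w z v d2" and d: "d = d1 + d2"
    unfolding typed_TV by blast
  with assms have ty': "typed c s' z w' v d1" "typed c u' w z v d2" and
    eq: "cls c t' b' (resc s) = smult_cell c t' b' r (cls c t' b' s')"
      "cls c t' b' (resc u) = smult_cell c t' b' q (cls c t' b' u')"
    unfolding scales_def by blast+
  from ty have "typed c (resc s) z w' v d1" "typed c (resc u) w z v d2" by simp_all
  note vr = vcell_cls[OF this, of t' b']
  have X: "cls c t' b' s' \<in> cells c t' b' z w' v d1" and Y: "cls c t' b' u' \<in> cells c t' b' w z v d2"
    using ty' by simp_all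
  have "cls c t' b' (resc (TV s u)) = smult_cell c t' b' (r * q) (vcell c t' b' (cls c t' b' s') (cls c t' b' u'))"
    using vr unfolding eq rescale_tm.simps
    by (simp add: vcell_smult_left[OF X smult_cell_in[OF Y]] vcell_smult_right[OF X Y]
        smult_cell_smult[OF vcell_in[OF X Y]])
  with vcell_cls[OF ty', of t' b'] typed_TVI[OF ty' d]
  show "typed c (TV s' u') w w' v d \<and>
      cls c t' b' (resc (TV s u)) = smult_cell c t' b' (r * q) (cls c t' b' (TV s' u'))"
    by simp
qed

lemma scales_H:
  assumes "scales r s s'" "scales q u u'"
  shows "scales (r * q) (TH s u) (TH s' u')"
  unfolding scales_def
proof (intro allI impI)
  fix w w' v d assume "typed c (TH s u) w w' v d"
  then obtain x x' z z' d1 d2 where ty: "typed c s x x' (v + wwt c z) d1" "typed c u z z' v d2"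
    and d: "w = x @ z" "w' = x' @ z'" "d = d1 + d2"
    unfolding typed_TH by blast
  with assms have ty': "typed c s' x x' (v + wwt c z) d1" "typed c u' z z' v d2" and
    eq: "cls c t' b' (resc s) = smult_cell c t' b' r (cls c t' b' s')"
      "cls c t' b' (resc u) = smult_cell c t' b' q (cls c t' b' u')"
    unfolding scales_def by blast+
  from ty have "typed c (resc s) x x' (v + wwt c z) d1" "typed c (resc u) z z' v d2" by simp_all
  note hr = hcell_cls[OF this, of t' b']
  have X: "cls c t' b' s' \<in> cells c t' b' x x' (v + wwt c z) d1"
    and Y: "cls c t' b' u' \<in> cells c t' b' z z' v d2"
    using ty' by simp_all
  have "cls c t' b' (resc (TH s u)) = smult_cell c t' b' (r * q) (hcell c t' b' (cls c t' b' s') (cls c t' b' u'))"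
    using hr unfolding eq rescale_tm.simps
    by (simp add: hcell_smult_left[OF X smult_cell_in[OF Y]] hcell_smult_right[OF X Y]
        smult_cell_smult[OF hcell_in[OF X Y]])
  with hcell_cls[OF ty', of t' b'] typed.intros(4)[OF ty'] d
  show "typed c (TH s' u') w w' v d \<and>
      cls c t' b' (resc (TH s u)) = smult_cell c t' b' (r * q) (cls c t' b' (TH s' u'))"
    by simp
qed

text \<open>Both summands need the same factor; this is the homogeneity that each
  inhomogeneous-looking relation has to satisfy once its coefficients have changed.\<close>

lemma scales_Add:
  assumes "scales r s s'" "scales r u u'"
  shows "scales r (TAdd s u) (TAdd s' u')"
  unfolding scales_def
proof (intro allI impI)
  fix w w' v d assume "typed c (TAdd s u) w w' v d"
  then have ty: "typed c s w w' v d" "typed c u w w' v d" by simp_all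
  with assms have ty': "typed c s' w w' v d" "typed c u' w w' v d" and
    eq: "cls c t' b' (resc s) = smult_cell c t' b' r (cls c t' b' s')"
      "cls c t' b' (resc u) = smult_cell c t' b' r (cls c t' b' u')"
    unfolding scales_def by blast+
  from ty have "typed c (resc s) w w' v d" "typed c (resc u) w w' v d" by simp_all
  note ar = add_cell_cls[OF this, of t' b']
  have X: "cls c t' b' s' \<in> cells c t' b' w w' v d" and Y: "cls c t' b' u' \<in> cells c t' b' w w' v d"
    using ty' by simp_all
  show "typed c (TAdd s' u') w w' v d \<and>
      cls c t' b' (resc (TAdd s u)) = smult_cell c t' b' r (cls c t' b' (TAdd s' u'))"
    using ar ty' unfolding eq rescale_tm.simps
    by (simp add: add_cell_cls[OF ty', symmetric] smult_cell_add[OF X Y])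
qed

text \<open>The equation \<open>a * r = r' * a'\<close> is where the parameters absorb a factor: the
  coefficient passes from \<open>a\<close> to \<open>a'\<close> while the factor of the expression
  passes from \<open>r\<close> to \<open>r'\<close>.\<close>

lemma scales_Scale:
  assumes "scales r s s'" "a * r = r' * a'"
  shows "scales r' (TScale a s) (TScale a' s')"
  unfolding scales_def
proof (intro allI impI)
  fix w w' v d assume "typed c (TScale a s) w w' v d"
  then have ty: "typed c s w w' v d" by simp
  with assms have ty': "typed c s' w w' v d" and
    eq: "cls c t' b' (resc s) = smult_cell c t' b' r (cls c t' b' s')"
    unfolding scales_def by blast+
  from ty have "typed c (resc s) w w' v d" by simp
  note sr = smult_cell_cls[OF this, of t' b']
  have X: "cls c t' b' s' \<in> cells c t' b' w w' v d" using ty' by simp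
  show "typed c (TScale a' s') w w' v d \<and>
      cls c t' b' (resc (TScale a s)) = smult_cell c t' b' r' (cls c t' b' (TScale a' s'))"
    using sr[symmetric, of a] ty' unfolding eq rescale_tm.simps
    by (simp add: smult_cell_cls[OF ty', symmetric] smult_cell_smult[OF X] assms(2))
qed

lemma scales_Scale_id: "a = r * a' \<Longrightarrow> scales r (TScale a (TId w v)) (TScale a' (TId w v))"
  using scales_Scale[OF scales_id, of a r a'] by simp

lemma scales_tsum:
  "(\<And>x. x \<in> set xs \<Longrightarrow> scales r (F x) (F' x)) \<Longrightarrow>
    scales r (tsum w w' v d (map F xs)) (tsum w w' v d (map F' xs))"
  by (induction xs) (simp_all add: scales_zero scales_Add)

lemma scales_diag: "diag_scale D ls = r \<Longrightarrow> scales r (diag c v w ls) (diag c v w ls)"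
proof (induction ls arbitrary: r)
  case (Cons l ls)
  obtain w g z where l: "l = (w, g, z)" by (cases l)
  have "scales (1 * (gen_scale D g * 1)) (layer c v l) (layer c v l)"
    unfolding l layer.simps by (intro scales_H scales_id scales_gen)
  from scales_V[OF this Cons.IH[OF refl]] show ?case
    using Cons.prems by (simp add: l)
qed (simp add: scales_id)

section \<open>Real and fake bubbles\<close>

lemma scales_real_cw: "scales (D i ^ m) (real_cw c i v m) (real_cw c i v m)"
  and scales_real_ccw: "scales (D i ^ m) (real_ccw c i v m) (real_ccw c i v m)"
  unfolding real_cw_def real_ccw_def by (rule scales_diag; simp)+

lemma powi_nat: "0 \<le> m \<Longrightarrow> D i ^ nat m = D i powi m"
  by (simp add: power_int_def)

text \<open>Trades the factor \<open>q\<close> of a denominator against the factor of the sum behind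
  it. For \<open>x = 0\<close> both sides vanish, as division by 0 yields 0.\<close>

lemma minus_divide_rescale:
  "p * q = s \<Longrightarrow> q \<noteq> 0 \<Longrightarrow> - 1 / x * p = s * (- 1 / (q * x))" for p :: 'k
  by (cases "x = 0") (auto simp: field_simps)

text \<open>A fake bubble scales as if it had \<open>coroot c i v - 1 + int j\<close> dots, a
  negative number. In the recursion the exponents \<open>coroot c i v - 1 + int x\<close> and
  \<open>- coroot c i v - 1 + int (j - x)\<close> add up to \<open>int j - 2\<close> for every
  \<open>x\<close>, so the sum is homogeneous; the division by \<open>cminus\<close> supplies the
  remaining \<open>coroot c i v + 1\<close>.\<close>

lemma scales_fake_cw:
  "coroot c i v - 1 + int j < 0 \<Longrightarrow>
    scales (D i powi (coroot c i v - 1 + int j)) (fake_cw c b i v j) (fake_cw c b' i v j)"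
proof (induction j rule: less_induct)
  case (less j)
  show ?case
  proof (cases "j = 0")
    case True
    have "D i powi (coroot c i v - 1) * D i powi (- coroot c i v + 1) = 1"
      using D_nonzero by (simp add: power_int_add[symmetric])
    then have "cplus b i v = D i powi (coroot c i v - 1 + int j) * cplus b' i v"
      using True by (simp add: cplus' mult.assoc[symmetric])
    then show ?thesis
      using True by (simp add: fake_cw.simps[of _ _ _ _ 0] scales_Scale_id)
  next
    case False
    let ?F = "\<lambda>b x. TV (fake_cw c b i v x) (real_ccw c i v (nat (- coroot c i v - 1 + int (j - x))))"
    have "scales (D i powi (int j - 2)) (?F b x) (?F b' x)" if "x \<in> set [0..<j]" for x
    proof -
      \<comment> \<open>The weight is negative here, so the opposite bubbles of the recursion are
        real and \<open>nat\<close> does not truncate their number of dots.\<close>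
      from that less.prems have x: "x < j" "0 \<le> - coroot c i v - 1 + int (j - x)" by auto
      have "D i powi (int j - 2) =
          D i powi (coroot c i v - 1 + int x) * D i powi (- coroot c i v - 1 + int (j - x))"
        using x D_nonzero by (simp add: power_int_add[symmetric])
      then show ?thesis
        using scales_V[OF less.IH[OF x(1)] scales_real_ccw[of i "nat (- coroot c i v - 1 + int (j - x))"]] x less.prems
        by (simp add: powi_nat)
    qed
    then have "scales (D i powi (int j - 2)) (tsum [] [] v (2 * int j) (map (?F b) [0..<j]))
        (tsum [] [] v (2 * int j) (map (?F b') [0..<j]))"
      by (rule scales_tsum)
    moreover have "D i powi (int j - 2) * D i powi (coroot c i v + 1) = D i powi (coroot c i v - 1 + int j)"
      using D_nonzero by (simp add: power_int_add[symmetric] algebra_simps)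
    then have "- 1 / cminus b i v * D i powi (int j - 2) =
        D i powi (coroot c i v - 1 + int j) * (- 1 / cminus b' i v)"
      unfolding cminus' using D_nonzero by (intro minus_divide_rescale) simp_all
    ultimately show ?thesis
      using False by (subst (1 2) fake_cw.simps) (simp add: scales_Scale)
  qed
qed

text \<open>The mirror image under a change of sign of the weight: each term of the recursion again
  has exponent \<open>int j - 2\<close>, and now \<open>cplus\<close> supplies
  \<open>- coroot c i v + 1\<close>.\<close>

lemma scales_fake_ccw:
  "- coroot c i v - 1 + int j < 0 \<Longrightarrow>
    scales (D i powi (- coroot c i v - 1 + int j)) (fake_ccw c b i v j) (fake_ccw c b' i v j)"
proof (induction j rule: less_induct)
  case (less j)
  show ?case
  proof (cases "j = 0")
    case True
    have "D i powi (- coroot c i v - 1) * D i powi (coroot c i v + 1) = 1"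
      using D_nonzero by (simp add: power_int_add[symmetric])
    then have "cminus b i v = D i powi (- coroot c i v - 1 + int j) * cminus b' i v"
      using True by (simp add: cminus' mult.assoc[symmetric])
    then show ?thesis
      using True by (simp add: fake_ccw.simps[of _ _ _ _ 0] scales_Scale_id)
  next
    case False
    let ?F = "\<lambda>b y. TV (real_cw c i v (nat (coroot c i v - 1 + int (j - y)))) (fake_ccw c b i v y)"
    have "scales (D i powi (int j - 2)) (?F b y) (?F b' y)" if "y \<in> set [0..<j]" for y
    proof -
      from that less.prems have y: "y < j" "0 \<le> coroot c i v - 1 + int (j - y)" by auto
      have "D i powi (int j - 2) =
          D i powi (coroot c i v - 1 + int (j - y)) * D i powi (- coroot c i v - 1 + int y)"
        using y D_nonzero by (simp add: power_int_add[symmetric])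
      then show ?thesis
        using scales_V[OF scales_real_cw[of i "nat (coroot c i v - 1 + int (j - y))"] less.IH[OF y(1)]] y less.prems
        by (simp add: powi_nat)
    qed
    then have "scales (D i powi (int j - 2)) (tsum [] [] v (2 * int j) (map (?F b) [0..<j]))
        (tsum [] [] v (2 * int j) (map (?F b') [0..<j]))"
      by (rule scales_tsum)
    moreover have "D i powi (int j - 2) * D i powi (- coroot c i v + 1) = D i powi (- coroot c i v - 1 + int j)"
      using D_nonzero by (simp add: power_int_add[symmetric] algebra_simps)
    then have "- 1 / cplus b i v * D i powi (int j - 2) =
        D i powi (- coroot c i v - 1 + int j) * (- 1 / cplus b' i v)"
      unfolding cplus' using D_nonzero by (intro minus_divide_rescale) simp_all
    ultimately show ?thesis
      using False by (subst (1 2) fake_ccw.simps) (simp add: scales_Scale)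
  qed
qed

text \<open>Real, fake and vanishing bubbles obey one formula in the integer \<open>m\<close>, so
  the relations need no distinction by the sign of the weight.\<close>

lemma scales_cw: "scales (D i powi m) (cw c b i v m) (cw c b' i v m)"
proof -
  have "scales (D i powi m) (real_cw c i v (nat m)) (real_cw c i v (nat m))" if "0 \<le> m"
    using scales_real_cw[of i "nat m" v] that by (simp add: powi_nat)
  moreover have "scales (D i powi m) (fake_cw c b i v (nat (m - (coroot c i v - 1))))
      (fake_cw c b' i v (nat (m - (coroot c i v - 1))))" if "m < 0" "\<not> m < coroot c i v - 1"
  proof -
    from that(2) have eq: "coroot c i v - 1 + int (nat (m - (coroot c i v - 1))) = m" by simp
    show ?thesis using scales_fake_cw[of i v "nat (m - (coroot c i v - 1))"] that(1) unfolding eq by blast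
  qed
  ultimately show ?thesis by (simp add: cw_def scales_zero)
qed

lemma scales_ccw: "scales (D i powi m) (ccw c b i v m) (ccw c b' i v m)"
proof -
  have "scales (D i powi m) (real_ccw c i v (nat m)) (real_ccw c i v (nat m))" if "0 \<le> m"
    using scales_real_ccw[of i "nat m" v] that by (simp add: powi_nat)
  moreover have "scales (D i powi m) (fake_ccw c b i v (nat (m - (- coroot c i v - 1))))
      (fake_ccw c b' i v (nat (m - (- coroot c i v - 1))))" if "m < 0" "\<not> m < - coroot c i v - 1"
  proof -
    from that(2) have eq: "- coroot c i v - 1 + int (nat (m - (- coroot c i v - 1))) = m" by simp
    show ?thesis using scales_fake_ccw[of i v "nat (m - (- coroot c i v - 1))"] that(1) unfolding eq by blast
  qed
  ultimately show ?thesis by (simp add: ccw_def scales_zero)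
qed

lemma triples_sum: "(f1, f2, f3) \<in> set (triples n) \<Longrightarrow> int f1 + int f2 + int f3 = n"
  by (auto simp: triples_def)

text \<open>The dots \<open>f1\<close>, \<open>f3\<close> and those of the bubble add up to -2 for
  every triple, matching the two crossings in the other term of the \<open>sl2\<close> relations.
  Here \<open>n\<close> is the weight \<open>coroot c i v\<close> for \<open>sl2_EF\<close> and its
  negative for \<open>sl2_FE\<close>.\<close>

lemma powi_triples:
  assumes "(f1, f2, f3) \<in> set (triples (n - 1))"
  shows "D i ^ f3 * (D i powi (- n - 1 + int f2) * D i ^ f1) = D i powi (- 2)"
proof -
  have "D i ^ f3 * (D i powi (- n - 1 + int f2) * D i ^ f1) =
      D i powi (int f3 + ((- n - 1 + int f2) + int f1))"
    using D_nonzero by (simp add: power_int_add)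
  also have "int f3 + ((- n - 1 + int f2) + int f1) = - 2"
    using triples_sum[OF assms] by simp
  finally show ?thesis .
qed

section \<open>The defining relations\<close>

lemma scales_id_eq: "r = 1 \<Longrightarrow> scales r (TId w v) (TId w v)"
  using scales_id by simp

lemma urel_rescaleI:
  "urel c t' b' s' u' \<Longrightarrow> scales r s s' \<Longrightarrow> scales r u u' \<Longrightarrow>
    \<exists>r s' u'. urel c t' b' s' u' \<and> scales r s s' \<and> scales r u u'"
  by blast

text \<open>The factor \<open>r\<close> may vary from relation to relation and only has to agree on
  the two sides of one. \<open>s'\<close> and \<open>u'\<close> are the same combinations of
  diagrams with the coefficients of \<open>t'\<close> and \<open>b'\<close>.\<close>

lemma urel_rescale:
  assumes "urel c t b s u"
  shows "\<exists>r s' u'. urel c t' b' s' u' \<and> scales r s s' \<and> scales r u u'"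
  using assms
proof cases
  case (biadj_E1 v i)
  \<comment> \<open>No dots or crossings occur, so the common factor is 1; the same holds for the
    next three relations.\<close>
  show ?thesis
    unfolding biadj_E1
    by (rule urel_rescaleI, rule urel.biadj_E1, rule scales_diag, rule refl, rule scales_id_eq, simp)
next
  case (biadj_E2 v i)
  show ?thesis
    unfolding biadj_E2
    by (rule urel_rescaleI, rule urel.biadj_E2, rule scales_diag, rule refl, rule scales_id_eq, simp)
next
  case (biadj_F1 v i)
  show ?thesis
    unfolding biadj_F1
    by (rule urel_rescaleI, rule urel.biadj_F1, rule scales_diag, rule refl, rule scales_id_eq, simp)
next
  case (biadj_F2 v i)
  show ?thesis
    unfolding biadj_F2
    by (rule urel_rescaleI, rule urel.biadj_F2, rule scales_diag, rule refl, rule scales_id_eq, simp)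
next
  case (cyclic_dot v i)
  show ?thesis
    unfolding cyclic_dot
    by (rule urel_rescaleI, rule urel.cyclic_dot, rule scales_diag, rule refl, rule scales_diag, simp)
next
  case (cyclic_cross v i j)
  show ?thesis
    unfolding cyclic_cross
    by (rule urel_rescaleI, rule urel.cyclic_cross, rule scales_diag, rule refl, rule scales_diag, simp)
next
  case (klr_same v i)
  \<comment> \<open>The two crossings contribute a factor, but the other side is zero and scales by
    any factor.\<close>
  show ?thesis
    unfolding klr_same
    by (rule urel_rescaleI, rule urel.klr_same, rule scales_diag, rule refl, rule scales_zero)
next
  case (klr_zero i j v)
  show ?thesis
    unfolding klr_zero(1,2)
    by (rule urel_rescaleI, rule urel.klr_zero, fact, fact, rule scales_diag, rule refl, rule scales_Scale_id,
        use klr_zero(3,4) t'_zero in simp)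
next
  case (klr_minus i j v)
  \<comment> \<open>Crossings of distinct colours do not scale, so the factor is 1. The dot of
    colour \<open>i\<close> contributes \<open>D i\<close>, which turns \<open>t i j\<close> into
    \<open>t' i j\<close>; symmetry of the Cartan integers gives the same for
    \<open>j\<close>.\<close>
  show ?thesis
    unfolding klr_minus(1,2)
    by (rule urel_rescaleI, rule urel.klr_minus, fact, fact, rule scales_diag, rule refl, rule scales_Add;
        rule scales_Scale[OF scales_diag[OF refl]],
        use klr_minus(3,4) t'_minus[of i j] t'_minus[of j i] cdot_sym[of i j] in simp)
next
  case (nilhecke1 v i)
  \<comment> \<open>Every term has one dot and one crossing of colour \<open>i\<close>, whose
    factors cancel, as the identity on the right requires.\<close>
  show ?thesis
    unfolding nilhecke1
    by (rule urel_rescaleI, rule urel.nilhecke1, rule scales_Add, rule scales_diag, rule refl, rule scales_Scale[OF scales_diag[OF refl]],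
        simp, rule scales_id_eq, simp add: D_nonzero)
next
  case (nilhecke2 v i)
  show ?thesis
    unfolding nilhecke2
    by (rule urel_rescaleI, rule urel.nilhecke2, rule scales_Add, rule scales_diag, rule refl, rule scales_Scale[OF scales_diag[OF refl]],
        simp, rule scales_id_eq, simp add: D_nonzero)
next
  case (dot_slide1 i j v)
  show ?thesis
    unfolding dot_slide1(1,2)
    by (rule urel_rescaleI, rule urel.dot_slide1, fact, rule scales_diag, rule refl, rule scales_diag, simp)
next
  case (dot_slide2 i j v)
  show ?thesis
    unfolding dot_slide2(1,2)
    by (rule urel_rescaleI, rule urel.dot_slide2, fact, rule scales_diag, rule refl, rule scales_diag, simp)
next
  case (cubic v i j k)
  let ?r = "gen_scale D (Cross j k) * (gen_scale D (Cross i k) * gen_scale D (Cross i j))"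
  let ?R = "\<lambda>t. if i = k \<and> cdot c i j = - 1 then TScale (t i j) (TId [EE i, EE j, EE k] v)
      else TZero [EE i, EE j, EE k] [EE k, EE j, EE i] v (- cdot c i j - cdot c i k - cdot c j k)"
  have R: "scales ?r (?R t) (?R t')"
  proof (cases "i = k \<and> cdot c i j = - 1")
    case True
    \<comment> \<open>For \<open>i = k\<close> only the crossing of the two outer strands joins
      equal colours. Its factor \<open>inverse (D i)\<close> cancels the \<open>D i\<close> in
      \<open>t' i j\<close>.\<close>
    then have "i \<noteq> j" using cdot_diag[of i] by auto
    with True D_nonzero[of i] t'_minus[of i j] have "t i j = ?r * t' i j" by (auto simp: field_simps)
    then show ?thesis unfolding if_P[OF True] by (rule scales_Scale_id)
  next
    case False
    then show ?thesis by (simp only: if_False scales_zero)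
  qed
  show ?thesis
    unfolding cubic
    by (rule urel_rescaleI[OF _ _ R], rule urel.cubic, rule scales_Add, rule scales_diag, simp,
        rule scales_Scale[OF scales_diag[OF refl]], simp)
next
  case (mixed1 i j v)
  \<comment> \<open>\<open>sig i j\<close> and \<open>sig' j i\<close> contain only crossings of
    distinct colours, so no factor arises.\<close>
  show ?thesis
    unfolding mixed1(1,2)
    by (rule urel_rescaleI, rule urel.mixed1, fact, rule scales_diag, rule refl, rule scales_id_eq,
        use mixed1(3) in \<open>simp add: sig_def sig'_def\<close>)
next
  case (mixed2 i j v)
  show ?thesis
    unfolding mixed2(1,2)
    by (rule urel_rescaleI, rule urel.mixed2, fact, rule scales_diag, rule refl, rule scales_id_eq,
        use mixed2(3) in \<open>simp add: sig_def sig'_def\<close>)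
next
  case (cw_neg m i v)
  show ?thesis
    unfolding cw_neg(1,2)
    by (rule urel_rescaleI, rule urel.cw_neg, fact, rule scales_cw, rule scales_zero)
next
  case (ccw_neg m i v)
  show ?thesis
    unfolding ccw_neg(1,2)
    by (rule urel_rescaleI, rule urel.ccw_neg, fact, rule scales_ccw, rule scales_zero)
next
  case (cw_deg0 i v)
  \<comment> \<open>The power in \<open>cplus'\<close> is the inverse of the factor of a bubble with
    \<open>coroot c i v - 1\<close> dots.\<close>
  have "D i powi (coroot c i v - 1) * D i powi (- coroot c i v + 1) = 1"
    using D_nonzero by (simp add: power_int_add[symmetric])
  then have "cplus b i v = D i powi (coroot c i v - 1) * cplus b' i v"
    by (simp add: cplus' mult.assoc[symmetric])
  then show ?thesis
    unfolding cw_deg0(1,2)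
    by (intro urel_rescaleI[OF urel.cw_deg0 scales_cw scales_Scale_id] cw_deg0(3))
next
  case (ccw_deg0 i v)
  have "D i powi (- coroot c i v - 1) * D i powi (coroot c i v + 1) = 1"
    using D_nonzero by (simp add: power_int_add[symmetric])
  then have "cminus b i v = D i powi (- coroot c i v - 1) * cminus b' i v"
    by (simp add: cminus' mult.assoc[symmetric])
  then show ?thesis
    unfolding ccw_deg0(1,2)
    by (intro urel_rescaleI[OF urel.ccw_deg0 scales_ccw scales_Scale_id] ccw_deg0(3))
next
  case (sl2_EF i v)
  let ?F = "\<lambda>b (f1, f2, f3).
    TV (diag c v [] (replicate f3 ([], Dot i, [FF i]) @ [([], CupEF i, [])]))
      (TV (ccw c b i v (- coroot c i v - 1 + int f2))
        (diag c v [EE i, FF i] ([([], CapEF i, [])] @ replicate f1 ([], Dot i, [FF i]))))"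
  \<comment> \<open>The common factor of the relation is 1. Both the crossing term and each bubble
    term scale by \<open>D i powi (- 2)\<close>, which is the quotient of the two values of
    \<open>beta\<close>.\<close>
  have terms: "scales (D i powi (- 2)) (?F b x) (?F b' x)" if x: "x \<in> set (triples (coroot c i v - 1))" for x
  proof -
    obtain f1 f2 f3 where f: "x = (f1, f2, f3)" by (cases x)
    have "scales (D i ^ f3 * (D i powi (- coroot c i v - 1 + int f2) * D i ^ f1)) (?F b x) (?F b' x)"
      unfolding f prod.case by (intro scales_V scales_diag scales_ccw) simp_all
    with powi_triples[OF x[unfolded f]] show ?thesis by simp
  qed
  show ?thesis
    unfolding sl2_EF
    by (rule urel_rescaleI, rule urel.sl2_EF, rule scales_id, rule scales_Add,
        rule scales_Scale[OF scales_diag[OF refl]], simp add: sig_def sig'_def beta' power_int_minus power2_eq_square,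
        rule scales_Scale[OF scales_tsum[OF terms]], assumption, simp add: beta')
next
  case (sl2_FE i v)
  let ?F = "\<lambda>b (f1, f2, f3).
    TV (diag c v [] (replicate f3 ([FF i], Dot i, []) @ [([], CupFE i, [])]))
      (TV (cw c b i v (coroot c i v - 1 + int f2))
        (diag c v [FF i, EE i] ([([], CapFE i, [])] @ replicate f1 ([FF i], Dot i, []))))"
  have terms: "scales (D i powi (- 2)) (?F b x) (?F b' x)" if x: "x \<in> set (triples (- coroot c i v - 1))" for x
  proof -
    obtain f1 f2 f3 where f: "x = (f1, f2, f3)" by (cases x)
    have "scales (D i ^ f3 * (D i powi (coroot c i v - 1 + int f2) * D i ^ f1)) (?F b x) (?F b' x)"
      unfolding f prod.case by (intro scales_V scales_diag scales_cw) simp_all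
    with powi_triples[OF x[unfolded f]] show ?thesis by simp
  qed
  show ?thesis
    unfolding sl2_FE
    by (rule urel_rescaleI, rule urel.sl2_FE, rule scales_id, rule scales_Add,
        rule scales_Scale[OF scales_diag[OF refl]], simp add: sig_def sig'_def beta' power_int_minus power2_eq_square,
        rule scales_Scale[OF scales_tsum[OF terms]], assumption, simp add: beta')
qed

end

section \<open>The rescaling 2-functor\<close>

context rescaling
begin

text \<open>Structural rules are preserved because \<open>rescale_tm\<close> commutes with the
  constructors and keeps types. The case with content is a defining relation, whose two sides become
  equal multiples of the sides of a relation for the target parameters.\<close>

lemma eqv_rescale: "eqv c t b s u \<Longrightarrow> eqv c t' b' (resc s) (resc u)"
proof (induction rule: eqv.induct)
  case (eqv_rel s u w w' v d)
  from urel_rescale[OF eqv_rel(1)] obtain r s' u' where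
    *: "urel c t' b' s' u'" "scales r s s'" "scales r u u'" by blast
  have "typed c s' w w' v d" "typed c u' w w' v d"
    using * eqv_rel(2,3) unfolding scales_def by blast+
  then have "cls c t' b' s' = cls c t' b' u'"
    by (intro cls_eqI eqv.eqv_rel[OF *(1)])
  \<comment> \<open>The equality of cells is only multiplied by \<open>r\<close>, never divided by
    it.\<close>
  then have "cls c t' b' (resc s) = cls c t' b' (resc u)"
    using * eqv_rel(2,3) unfolding scales_def by metis
  then show ?case
    using cls_eq_iff[of c "resc s" w w' v d t' b' "resc u"] eqv_rel(2) by simp
next
  case (eqv_trans s s' s'')
  then show ?case by (blast intro: eqv.eqv_trans)
next
  case (eqv_V s s' u u' w w' v d)
  then have "typed c (resc (TV s u)) w w' v d" by (simp only: typed_rescale_tm)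
  with eqv_V show ?case by (auto intro: eqv.eqv_V)
next
  case (eqv_H s s' u u' w w' v d)
  then have "typed c (resc (TH s u)) w w' v d" by (simp only: typed_rescale_tm)
  with eqv_H show ?case by (auto intro: eqv.eqv_H)
next
  case (V_assoc s s' s'' w w' v d)
  then have "typed c (resc (TV (TV s s') s'')) w w' v d" by (simp only: typed_rescale_tm)
  then show ?case by (auto intro: eqv.V_assoc)
next
  case (H_assoc s s' s'' w w' v d)
  then have "typed c (resc (TH (TH s s') s'')) w w' v d" by (simp only: typed_rescale_tm)
  then show ?case by (auto intro: eqv.H_assoc)
next
  case (V_H s s' w1 w1' v w2 d1 u u' w2' d2)
  then have "typed c (resc (TV s s')) w1 w1' (v + wwt c w2) d1" "typed c (resc (TV u u')) w2 w2' v d2"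
    by (simp_all only: typed_rescale_tm)
  then show ?case by (auto intro: eqv.V_H)
next
  case (V_Add_left s s' u w w' v d)
  then have "typed c (resc (TV (TAdd s s') u)) w w' v d" by (simp only: typed_rescale_tm)
  then show ?case by (auto intro: eqv.V_Add_left)
next
  case (V_Add_right s u u' w w' v d)
  then have "typed c (resc (TV s (TAdd u u'))) w w' v d" by (simp only: typed_rescale_tm)
  then show ?case by (auto intro: eqv.V_Add_right)
next
  case (V_Scale_left s u w w' v d r)
  then have "typed c (resc (TV s u)) w w' v d" by (simp only: typed_rescale_tm)
  then show ?case by (auto intro: eqv.V_Scale_left)
next
  case (V_Scale_right s u w w' v d r)
  then have "typed c (resc (TV s u)) w w' v d" by (simp only: typed_rescale_tm)
  then show ?case by (auto intro: eqv.V_Scale_right)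
next
  case (H_Add_left s s' u w w' v d)
  then have "typed c (resc (TH (TAdd s s') u)) w w' v d" by (simp only: typed_rescale_tm)
  then show ?case by (auto intro: eqv.H_Add_left)
next
  case (H_Add_right s u u' w w' v d)
  then have "typed c (resc (TH s (TAdd u u'))) w w' v d" by (simp only: typed_rescale_tm)
  then show ?case by (auto intro: eqv.H_Add_right)
next
  case (H_Scale_left s u w w' v d r)
  then have "typed c (resc (TH s u)) w w' v d" by (simp only: typed_rescale_tm)
  then show ?case by (auto intro: eqv.H_Scale_left)
next
  case (H_Scale_right s u w w' v d r)
  then have "typed c (resc (TH s u)) w w' v d" by (simp only: typed_rescale_tm)
  then show ?case by (auto intro: eqv.H_Scale_right)
qed (auto intro: eqv.intros)

definition rescale_cell :: "('i,'x,'k) cell \<Rightarrow> ('i,'x,'k) cell" where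
  "rescale_cell X = (\<Union>s\<in>X. cls c t' b' (resc s))"

lemma rescale_cell_cls: "typed c s w w' v d \<Longrightarrow> rescale_cell (cls c t b s) = cls c t' b' (resc s)"
  unfolding rescale_cell_def by (rule UN_cls, rule cls_eqI[OF eqv_rescale[OF eqv_sym]])

lemma rescale_cell_empty [simp]: "rescale_cell {} = {}"
  by (simp add: rescale_cell_def)

lemma rescale_cell_in: "X \<in> cells c t b w w' v d \<Longrightarrow> rescale_cell X \<in> cells c t' b' w w' v d"
  by (auto elim!: cellsE simp: rescale_cell_cls)

lemma rescale_cell_vcell:
  assumes "X \<in> cells c t b w' w'' v d" "Y \<in> cells c t b w w' v d'"
  shows "rescale_cell (vcell c t b X Y) = vcell c t' b' (rescale_cell X) (rescale_cell Y)"
proof -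
  from assms obtain x y where *: "X = cls c t b x" "Y = cls c t b y"
    and ty: "typed c x w' w'' v d" "typed c y w w' v d'"
    by (auto elim!: cellsE)
  have "typed c (resc x) w' w'' v d" "typed c (resc y) w w' v d'" using ty by simp_all
  from vcell_cls[OF this] show ?thesis
    by (simp add: * vcell_cls[OF ty] rescale_cell_cls[OF ty(1)] rescale_cell_cls[OF ty(2)]
        rescale_cell_cls[OF typed.intros(3)[OF ty]])
qed

lemma rescale_cell_hcell:
  assumes "X \<in> cells c t b w w' (v + wwt c z) d" "Y \<in> cells c t b z z' v d'"
  shows "rescale_cell (hcell c t b X Y) = hcell c t' b' (rescale_cell X) (rescale_cell Y)"
proof -
  from assms obtain x y where *: "X = cls c t b x" "Y = cls c t b y"
    and ty: "typed c x w w' (v + wwt c z) d" "typed c y z z' v d'"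
    by (auto elim!: cellsE)
  have "typed c (resc x) w w' (v + wwt c z) d" "typed c (resc y) z z' v d'" using ty by simp_all
  from hcell_cls[OF this] show ?thesis
    by (simp add: * hcell_cls[OF ty] rescale_cell_cls[OF ty(1)] rescale_cell_cls[OF ty(2)]
        rescale_cell_cls[OF typed.intros(4)[OF ty]])
qed

lemma rescale_cell_add:
  assumes "X \<in> cells c t b w w' v d" "Y \<in> cells c t b w w' v d"
  shows "rescale_cell (add_cell c t b X Y) = add_cell c t' b' (rescale_cell X) (rescale_cell Y)"
proof -
  from assms obtain x y where *: "X = cls c t b x" "Y = cls c t b y"
    and ty: "typed c x w w' v d" "typed c y w w' v d"
    by (auto elim!: cellsE)
  have "typed c (resc x) w w' v d" "typed c (resc y) w w' v d" using ty by simp_all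
  from add_cell_cls[OF this] show ?thesis
    by (simp add: * add_cell_cls[OF ty] rescale_cell_cls[OF ty(1)] rescale_cell_cls[OF ty(2)]
        rescale_cell_cls[OF typed.intros(6)[OF ty]])
qed

lemma rescale_cell_smult:
  assumes "X \<in> cells c t b w w' v d"
  shows "rescale_cell (smult_cell c t b r X) = smult_cell c t' b' r (rescale_cell X)"
proof -
  from assms obtain x where *: "X = cls c t b x" and ty: "typed c x w w' v d"
    by (auto elim!: cellsE)
  have "typed c (resc x) w w' v d" using ty by simp
  from smult_cell_cls[OF this] show ?thesis
    by (simp add: * smult_cell_cls[OF ty] rescale_cell_cls[OF ty] rescale_cell_cls[OF typed.intros(7)[OF ty]])
qed

definition rescale_mor2 :: "('i,'x,'k) mor2 \<Rightarrow> ('i,'x,'k) mor2" where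
  "rescale_mor2 A = TwoMor (dom2 A) (cod2 A) (\<lambda>k l. rescale_cell (entry A k l))"

lemma entry_rescale [simp]: "entry (rescale_mor2 A) k l = rescale_cell (entry A k l)"
  and dom2_rescale [simp]: "dom2 (rescale_mor2 A) = dom2 A"
  and cod2_rescale [simp]: "cod2 (rescale_mor2 A) = cod2 A"
  by (simp_all add: rescale_mor2_def)

lemma rescale_zero_entry:
  assumes "parallel c f g" "k < nsum g" "l < nsum f"
  shows "rescale_cell (zero_entry c t b f g k l) = zero_entry c t' b' f g k l"
  using parallel_wwt[OF assms] unfolding zero_entry_eq by (subst rescale_cell_cls) auto

lemma rescale_id_entry: "rescale_cell (id_entry c t b f k) = id_entry c t' b' f k"
  unfolding id_entry_def by (subst rescale_cell_cls) auto

lemma rescale_mor2_in: "u \<in> hom2 (Ucat c t b) f g \<Longrightarrow> rescale_mor2 u \<in> hom2 (Ucat c t' b') f g"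
  unfolding hom2_Ucat entry_cells_eq using rescale_cell_in by simp

lemma rescale_Uid2:
  assumes "f \<in> U1 c"
  shows "rescale_mor2 (Uid2 c t b f) = Uid2 c t' b' f"
proof (rule hom2_eqI[OF rescale_mor2_in[OF Uid2_in[OF assms]] Uid2_in[OF assms]])
  show "entry (rescale_mor2 (Uid2 c t b f)) k l = entry (Uid2 c t' b' f) k l" if "k < nsum f" "l < nsum f" for k l
    using that rescale_zero_entry[of f f k l] assms
    by (simp add: entry_Uid2 rescale_id_entry parallel_def)
qed

text \<open>An entry of the composite is a sum of products of cells; rescaling of cells respects
  sums, zero and products, so it passes through to the factors.\<close>

lemma rescale_Uvcomp:
  assumes u: "u \<in> hom2 (Ucat c t b) f g" and v: "v \<in> hom2 (Ucat c t b) g h"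
  shows "rescale_mor2 (Uvcomp c t b v u) = Uvcomp c t' b' (rescale_mor2 v) (rescale_mor2 u)"
proof (rule hom2_eqI[OF rescale_mor2_in[OF Uvcomp_in[OF u v]] Uvcomp_in[OF rescale_mor2_in[OF u] rescale_mor2_in[OF v]]])
  fix k l assume kl: "k < nsum h" "l < nsum f"
  note par = hom2_parallel[OF Uvcomp_in[OF u v]]
  interpret carrier_comm_monoid "entry_cells c t b f h k l" "add_cell c t b" "zero_entry c t b f h k l"
    using par kl by (rule entry_monoid)
  note e = hom2_entry[OF v kl(1)] hom2_entry[OF u _ kl(2)]
  have "rescale_cell (lsum (\<lambda>r. vcell c t b (entry v k r) (entry u r l)) [0..<nsum g]) =
      foldr (add_cell c t' b') (map (\<lambda>r. rescale_cell (vcell c t b (entry v k r) (entry u r l))) [0..<nsum g])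
        (zero_entry c t' b' f h k l)"
  proof (rule lsum_hom)
    show "rescale_cell (zero_entry c t b f h k l) = zero_entry c t' b' f h k l"
      using par kl by (rule rescale_zero_entry)
    show "rescale_cell (add_cell c t b X Y) = add_cell c t' b' (rescale_cell X) (rescale_cell Y)"
      if "X \<in> entry_cells c t b f h k l" "Y \<in> entry_cells c t b f h k l" for X Y
      using that unfolding entry_cells_eq by (rule rescale_cell_add)
    show "vcell c t b (entry v k r) (entry u r l) \<in> entry_cells c t b f h k l"
      if "r \<in> set [0..<nsum g]" for r
      using vcell_entry_in[OF e] hom2_dom1[OF u] that by simp
  qed
  also have "\<dots> = foldr (add_cell c t' b')
      (map (\<lambda>r. vcell c t' b' (rescale_cell (entry v k r)) (rescale_cell (entry u r l))) [0..<nsum g])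
        (zero_entry c t' b' f h k l)"
  proof (rule foldr_map_cong)
    fix r assume "r \<in> set [0..<nsum g]"
    then have r: "r < nsum g" by simp
    show "rescale_cell (vcell c t b (entry v k r) (entry u r l)) =
        vcell c t' b' (rescale_cell (entry v k r)) (rescale_cell (entry u r l))"
      by (rule rescale_cell_vcell[OF e(1)[OF r, unfolded entry_cells_eq]
            e(2)[OF r, unfolded entry_cells_eq hom2_dom1[OF u]]])
  qed
  finally show "entry (rescale_mor2 (Uvcomp c t b v u)) k l = entry (Uvcomp c t' b' (rescale_mor2 v) (rescale_mor2 u)) k l"
    by (simp add: entry_Uvcomp[OF u v kl] entry_Uvcomp[OF rescale_mor2_in[OF u] rescale_mor2_in[OF v] kl])
qed

lemma rescale_Uhcomp:
  assumes u: "u \<in> hom2 (Ucat c t b) f g" and u': "u' \<in> hom2 (Ucat c t b) f' g'"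
    and f: "cod1 f = dom1 f'"
  shows "rescale_mor2 (Uhcomp c t b u' u) = Uhcomp c t' b' (rescale_mor2 u') (rescale_mor2 u)"
proof (rule hom2_eqI[OF rescale_mor2_in[OF Uhcomp_in[OF u u' f]]
      Uhcomp_in[OF rescale_mor2_in[OF u] rescale_mor2_in[OF u'] f]])
  fix k l assume kl: "k < nsum (Ucomp1 g' g)" "l < nsum (Ucomp1 f' f)"
  note h = hparI[OF u u' f kl]
  note bd = hpar_bounds[OF h]
  note e = hom2_entry[OF u' bd(1,3)] hom2_entry[OF u bd(2,4)]
  show "entry (rescale_mor2 (Uhcomp c t b u' u)) k l =
      entry (Uhcomp c t' b' (rescale_mor2 u') (rescale_mor2 u)) k l"
    using rescale_cell_hcell[OF e[unfolded entry_cells_eq hpar_wt[OF h]]]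
    by (simp add: entry_Uhcomp[OF u u' kl] entry_Uhcomp[OF rescale_mor2_in[OF u] rescale_mor2_in[OF u'] kl])
qed

lemma rescale_add2:
  assumes u: "u \<in> hom2 (Ucat c t b) f g" and v: "v \<in> hom2 (Ucat c t b) f g"
  shows "rescale_mor2 (add2 (Ucat c t b) u v) = add2 (Ucat c t' b') (rescale_mor2 u) (rescale_mor2 v)"
proof (rule hom2_eqI[OF rescale_mor2_in[OF add2_in[OF u v]] add2_in[OF rescale_mor2_in[OF u] rescale_mor2_in[OF v]]])
  fix k l assume kl: "k < nsum g" "l < nsum f"
  show "entry (rescale_mor2 (add2 (Ucat c t b) u v)) k l =
      entry (add2 (Ucat c t' b') (rescale_mor2 u) (rescale_mor2 v)) k l"
    using rescale_cell_add hom2_entry[OF u kl] hom2_entry[OF v kl] unfolding entry_cells_eq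
    by (simp add: entry_add2[OF u kl] entry_add2[OF rescale_mor2_in[OF u] kl])
qed

lemma rescale_smult2:
  assumes u: "u \<in> hom2 (Ucat c t b) f g"
  shows "rescale_mor2 (smult2 (Ucat c t b) r u) = smult2 (Ucat c t' b') r (rescale_mor2 u)"
proof (rule hom2_eqI[OF rescale_mor2_in[OF smult2_in[OF u]] smult2_in[OF rescale_mor2_in[OF u]]])
  fix k l assume kl: "k < nsum g" "l < nsum f"
  show "entry (rescale_mor2 (smult2 (Ucat c t b) r u)) k l =
      entry (smult2 (Ucat c t' b') r (rescale_mor2 u)) k l"
    using rescale_cell_smult hom2_entry[OF u kl] unfolding entry_cells_eq
    by (simp add: entry_smult2[OF u kl] entry_smult2[OF rescale_mor2_in[OF u] kl])
qed

lemma graded_linear_2functor_rescale: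
  "graded_linear_2functor (Ucat c t b) (Ucat c t' b') (\<lambda>v. v) (\<lambda>f. f) rescale_mor2"
proof
  let ?C = "Ucat c t b" and ?D = "Ucat c t' b'"
  fix f g h f' g' u v u' a d e r n
  note sel = Ucat_sel(1-12) hom1_Ucat
  show "a \<in> Obj ?C \<Longrightarrow> a \<in> Obj ?D" "f \<in> hom1 ?C a d \<Longrightarrow> f \<in> hom1 ?D a d"
    "a \<in> Obj ?C \<Longrightarrow> id1 ?C a = id1 ?D a"
    "f \<in> hom1 ?C a d \<Longrightarrow> g \<in> hom1 ?C d e \<Longrightarrow> comp1 ?C g f = comp1 ?D g f"
    "f \<in> Mor1 ?C \<Longrightarrow> shift1 ?C n f = shift1 ?D n f"
    by (simp_all add: sel)
  show "u \<in> hom2 ?C f g \<Longrightarrow> rescale_mor2 u \<in> hom2 ?D f g"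
    "u \<in> hom2 ?C f g \<Longrightarrow> v \<in> hom2 ?C f g \<Longrightarrow>
      rescale_mor2 (add2 ?C u v) = add2 ?D (rescale_mor2 u) (rescale_mor2 v)"
    by (fact rescale_mor2_in rescale_add2)+
  show "f \<in> Mor1 ?C \<Longrightarrow> rescale_mor2 (id2 ?C f) = id2 ?D f"
    "u \<in> hom2 ?C f g \<Longrightarrow> v \<in> hom2 ?C g h \<Longrightarrow>
      rescale_mor2 (vcomp ?C v u) = vcomp ?D (rescale_mor2 v) (rescale_mor2 u)"
    "f \<in> hom1 ?C a d \<Longrightarrow> f' \<in> hom1 ?C d e \<Longrightarrow> u \<in> hom2 ?C f g \<Longrightarrow> u' \<in> hom2 ?C f' g' \<Longrightarrow>
      rescale_mor2 (hcomp ?C u' u) = hcomp ?D (rescale_mor2 u') (rescale_mor2 u)"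
    by (simp_all add: sel rescale_Uid2 rescale_Uvcomp rescale_Uhcomp)
  show "u \<in> Mor2 ?C \<Longrightarrow> rescale_mor2 (smult2 ?C r u) = smult2 ?D r (rescale_mor2 u)"
    by (rule rescale_smult2[OF Mor2_Ucat])
  show "u \<in> Mor2 ?C \<Longrightarrow> rescale_mor2 (shift2 ?C n u) = shift2 ?D n (rescale_mor2 u)"
    by (simp add: Ucat_sel(16) rescale_mor2_def)
qed

lemma rescale_matrix2: "rescale_mor2 (matrix2 f g e) = matrix2 f g (\<lambda>k l. rescale_cell (e k l))"
  by (auto simp: rescale_mor2_def matrix2_def fun_eq_iff)

lemma rescale_Ugen:
  "rescale_mor2 (Ugen c t b g v) = smult2 (Ucat c t' b') (gen_scale D g) (Ugen c t' b' g v)"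
proof -
  have "rescale_cell (cls c t b (TGen g v)) = smult_cell c t' b' (gen_scale D g) (cls c t' b' (TGen g v))"
    by (simp add: rescale_cell_cls[OF typed.intros(1)] smult_cell_cls[OF typed.intros(1)])
  then show ?thesis
    unfolding Ugen_def rescale_matrix2 Ucat_sel by (simp add: matrix2_def fun_eq_iff)
qed

text \<open>For cups, caps and crossings of distinct colours \<open>gen_scale\<close> is 1; this
  removes the trivial scalar that \<open>rescale_Ugen\<close> leaves in front of them.\<close>

lemma Ugen_one: "smult2 (Ucat c t' b') 1 (Ugen c t' b' g v) = Ugen c t' b' g v"
  unfolding Ucat_sel Ugen_def
  by (simp add: matrix2_def fun_eq_iff smult_cell_one[of _ c t' b' "gdom g" "gcod g" v "gdeg c g v"])

text \<open>The entries are identity and zero cells, in which no generator occurs. Thus the functor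
  respects the given decompositions into summands, not merely the direct sums as
  1-morphisms.\<close>

lemma rescale_Uincl_Uproj:
  assumes f: "f \<in> U1 c" "n < nsum f"
  shows "rescale_mor2 (Uincl c t b f n) = Uincl c t' b' f n"
    and "rescale_mor2 (Uproj c t b f n) = Uproj c t' b' f n"
proof -
  define fn where "fn = OneMor (dom1 f) (cod1 f) [summands f ! n]"
  have "fn \<in> U1 c"
    using f unfolding fn_def U1_def nsum_def by (auto dest: nth_mem)
  then have par: "parallel c fn f" "parallel c f fn"
    using f by (simp_all add: parallel_def fn_def)
  show "rescale_mor2 (Uincl c t b f n) = Uincl c t' b' f n"
    unfolding Uincl_def Let_def fn_def[symmetric] rescale_matrix2
    by (auto simp: matrix2_def fun_eq_iff rescale_id_entry rescale_zero_entry[OF par(1)])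
  show "rescale_mor2 (Uproj c t b f n) = Uproj c t' b' f n"
    unfolding Uproj_def Let_def fn_def[symmetric] rescale_matrix2
    by (auto simp: matrix2_def fun_eq_iff rescale_id_entry rescale_zero_entry[OF par(2)])
qed

section \<open>The inverse functor\<close>

lemma inverse_rescaling: "rescaling c (\<lambda>i. inverse (D i)) t' t b' b"
proof
  show "inverse (D i) \<noteq> 0" for i using D_nonzero by simp
  show "t i j = inverse (D i) * t' i j" if "i \<noteq> j" "cdot c i j = - 1" for i j
    using t'_minus[OF that] D_nonzero by simp
  show "t i j = t' i j" if "i \<noteq> j" "cdot c i j = 0" for i j
    using t'_zero[OF that] by simp
  \<comment> \<open>The exponents in \<open>rescale_params\<close> depend only on colour and weight,
    so each power meets the same power of the inverse.\<close>
  have inv: "inverse (D i) powi m * (D i powi m * x) = x" for i m x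
    using D_nonzero[of i] by (simp add: mult.assoc[symmetric] power_int_mult_distrib[symmetric])
  show "b = rescale_params c (\<lambda>i. inverse (D i)) b'"
    unfolding b'_eq rescale_params_def bubble_params.simps inv by simp
qed

end

text \<open>Rescaling back returns a representative up to \<open>eqv\<close>; on classes, and hence
  on matrices, this is an equality.\<close>

lemma (in rescaling) rescale_mor2_inverse:
  assumes "u \<in> hom2 (Ucat c t b) f g"
  shows "rescaling.rescale_mor2 c (\<lambda>i. inverse (D i)) t b (rescale_mor2 u) = u"
proof -
  interpret inv: rescaling c "\<lambda>i. inverse (D i)" t' t b' b by (rule inverse_rescaling)
  show ?thesis
  proof (rule hom2_eqI[OF inv.rescale_mor2_in[OF rescale_mor2_in[OF assms]] assms])
    fix k l assume "k < nsum g" "l < nsum f"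
    from hom2_entry[OF assms this] obtain s where s: "entry u k l = cls c t b s"
      and ty: "typed c s (snd (summands f ! l)) (snd (summands g ! k)) (dom1 f)
        (fst (summands g ! k) - fst (summands f ! l))"
      unfolding entry_cells_eq by (rule cellsE)
    from ty have "typed c (resc s) (snd (summands f ! l)) (snd (summands g ! k)) (dom1 f)
        (fst (summands g ! k) - fst (summands f ! l))" by simp
    note inv.rescale_cell_cls[OF this]
    moreover have "cls c t b (inv.resc (resc s)) = cls c t b s"
      by (intro cls_eqI rescale_tm_inverse[OF D_nonzero ty])
    ultimately show "entry (inv.rescale_mor2 (rescale_mor2 u)) k l = entry u k l"
      by (simp add: s rescale_cell_cls[OF ty])
  qed
qed

lemma (in rescaling) isomorphism_rescale:
  "isomorphism_2categories (Ucat c t b) (Ucat c t' b') (\<lambda>v. v) (\<lambda>f. f) rescale_mor2"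
proof -
  interpret inv: rescaling c "\<lambda>i. inverse (D i)" t' t b' b by (rule inverse_rescaling)
  have "inv.rescale_mor2 (rescale_mor2 u) = u" if "u \<in> Mor2 (Ucat c t b)" for u
    by (rule rescale_mor2_inverse[OF Mor2_Ucat[OF that]])
  \<comment> \<open>For the inverse rescaling, \<open>rescale_mor2_inverse\<close> speaks of
    \<open>inverse (inverse (D i))\<close>, which simplifies to \<open>D i\<close>, so the functor
    obtained is the original one.\<close>
  moreover have "rescale_mor2 (inv.rescale_mor2 u) = u" if "u \<in> Mor2 (Ucat c t' b')" for u
    using inv.rescale_mor2_inverse[OF Mor2_Ucat[OF that]] by simp
  ultimately show ?thesis
    unfolding isomorphism_2categories_def
    using graded_additive_2category_Ucat graded_linear_2functor_rescale inv.graded_linear_2functor_rescale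
    by blast
qed

theorem proposition3p3:
  fixes c :: "('i, 'x::ab_group_add, 'r::{comm_ring_1,ring_char_0}) cartan"
    and t t' :: "'i \<Rightarrow> 'i \<Rightarrow> 'k::field"
    and b b' :: "('i,'x,'k) bubble_params"
    and D :: "'i \<Rightarrow> 'k"
  assumes "cartan_datum c"
    and "choice_of_scalars c t"
    and "compatible c t b"
    and "\<And>i. D i \<noteq> 0"
    and "t' = rescale_scalars c D t b"
    and "b' = rescale_params c D b"
  shows "choice_of_scalars c t' \<and> compatible c t' b' \<and>
    (\<exists>beth.
      isomorphism_2categories (Ucat c t b) (Ucat c t' b') (\<lambda>v. v) (\<lambda>f. f) beth \<and>
      (\<forall>i v. beth (Ugen c t b (Dot i) v) = smult2 (Ucat c t' b') (D i) (Ugen c t' b' (Dot i) v)) \<and>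
      (\<forall>i v. beth (Ugen c t b (Cross i i) v) =
        smult2 (Ucat c t' b') (inverse (D i)) (Ugen c t' b' (Cross i i) v)) \<and>
      (\<forall>i j v. i \<noteq> j \<longrightarrow> beth (Ugen c t b (Cross i j) v) = Ugen c t' b' (Cross i j) v) \<and>
      (\<forall>i v. beth (Ugen c t b (CupFE i) v) = Ugen c t' b' (CupFE i) v \<and>
             beth (Ugen c t b (CupEF i) v) = Ugen c t' b' (CupEF i) v \<and>
             beth (Ugen c t b (CapFE i) v) = Ugen c t' b' (CapFE i) v \<and>
             beth (Ugen c t b (CapEF i) v) = Ugen c t' b' (CapEF i) v) \<and>
      (\<forall>f \<in> Mor1 (Ucat c t b). \<forall>n < nsum f.
             beth (Uincl c t b f n) = Uincl c t' b' f n \<and>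
             beth (Uproj c t b f n) = Uproj c t' b' f n))"
proof -
  interpret cartan_datum c by fact
  interpret rescaling c D t t' b b'
    by unfold_locales (simp_all add: assms rescale_scalars_def)
  have "choice_of_scalars c t' \<and> compatible c t' b'"
    using assms choice_of_scalars_rescale compatible_rescale by blast
  moreover have "\<forall>f \<in> Mor1 (Ucat c t b). \<forall>n < nsum f.
      rescale_mor2 (Uincl c t b f n) = Uincl c t' b' f n \<and>
      rescale_mor2 (Uproj c t b f n) = Uproj c t' b' f n"
    using rescale_Uincl_Uproj by (simp add: Ucat_sel(2))
  ultimately show ?thesis
    using isomorphism_rescale rescale_Ugen by (intro conjI exI[of _ rescale_mor2]) (simp_all add: Ugen_one)
qed

end
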